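(* Every dumbbell graph is determined by its $L$-spectrum. That is, for all integers $p\ge q\ge 3$ and $k\ge 0$, every finite simple undirected graph that has the same $L$-spectrum as $D_{p,k,q}$ is isomorphic to $D_{p,k,q}$.
   Context: All graphs are finite, simple and undirected. For a graph $G$ with vertices $v_1,\dots,v_n$, the Laplacian matrix is $L(G)=D(G)-A(G)$, where $A(G)$ is the adjacency matrix and $D(G)$ is the diagonal matrix of vertex degrees. The $L$-spectrum of $G$ is the multiset of eigenvalues of $L(G)$. Two graphs are $L$-cospectral if they have the same $L$-spectrum. A graph is determined by its $L$-spectrum if every graph $L$-cospectral with it is isomorphic to it. $P_n$ and $C_n$ denote the path and the cycle on $n$ vertices. The dumbbell graph $D_{p,k,q}$ (with $p\ge q\ge 3$, $k\ge 0$) is the graph obtained from two vertex-disjoint cycles $C_p$, $C_q$ and a path $P_{k+2}$ by identifying one end vertex of $P_{k+2}$ with a vertex of $C_p$ and the other end vertex with a vertex of $C_q$. It has $p+q+k$ vertices (for $k=0$ the two cycles are joined by a single edge). *)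

theory Defs
  imports
    "Graph_Theory.Graph_Theory"
    "Jordan_Normal_Form.Char_Poly"
    "HOL-Computational_Algebra.Polynomial"
begin

text \<open>
  A finite simple undirected graph is a \<^locale>\<open>pair_graph\<close>: a finite vertex set with a symmetric,
  irreflexive relation on it. Each edge is thus present as two opposite arcs, and the degree of a
  vertex is its out-degree.
\<close>

section \<open>The Laplacian spectrum\<close>

text \<open>In the matrices below \<open>vs\<close> is an enumeration of the vertices: \<open>distinct vs\<close> and
  \<open>set vs = pverts G\<close>.\<close>

definition adjacency_matrix :: "'a pair_pre_digraph \<Rightarrow> 'a list \<Rightarrow> real mat" where
  "adjacency_matrix G vs =
     mat (length vs) (length vs) (\<lambda>(i, j). if (vs ! i, vs ! j) \<in> parcs G then 1 else 0)"

definition degree_matrix :: "'a pair_pre_digraph \<Rightarrow> 'a list \<Rightarrow> real mat" where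
  "degree_matrix G vs = mat_diag (length vs) (\<lambda>i. real (out_degree (with_proj G) (vs ! i)))"

definition laplacian :: "'a pair_pre_digraph \<Rightarrow> 'a list \<Rightarrow> real mat" where
  "laplacian G vs = degree_matrix G vs - adjacency_matrix G vs"

text \<open>Eigenvalues are taken over the complex numbers and counted with their algebraic multiplicity,
  so that no eigenvalue is lost by definition.\<close>

definition mat_spectrum :: "real mat \<Rightarrow> complex multiset" where
  "mat_spectrum M = proots (char_poly (map_mat complex_of_real M))"

text \<open>The chosen enumeration is irrelevant, see \<open>L_spectrum_eq\<close> below.\<close>

definition L_spectrum :: "'a pair_pre_digraph \<Rightarrow> complex multiset" where
  "L_spectrum G = mat_spectrum (laplacian G (SOME vs. distinct vs \<and> set vs = pverts G))"

definition L_cospectral :: "'a pair_pre_digraph \<Rightarrow> 'b pair_pre_digraph \<Rightarrow> bool" where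
  "L_cospectral G H \<longleftrightarrow> L_spectrum G = L_spectrum H"

lemma laplacian_carrier [simp]: "laplacian G vs \<in> carrier_mat (length vs) (length vs)"
  by (auto simp: laplacian_def degree_matrix_def adjacency_matrix_def)

lemma laplacian_dim [simp]:
  "dim_row (laplacian G vs) = length vs" "dim_col (laplacian G vs) = length vs"
  using laplacian_carrier[of G vs] by (simp_all del: laplacian_carrier)

lemma laplacian_index:
  assumes "i < length vs" "j < length vs"
  shows "laplacian G vs $$ (i, j) =
    (if i = j then real (out_degree (with_proj G) (vs ! i)) else 0)
    - (if (vs ! i, vs ! j) \<in> parcs G then 1 else 0)"
  using assms by (auto simp: laplacian_def degree_matrix_def adjacency_matrix_def mat_diag_def)

lemma laplacian_similar:
  fixes G :: "'a pair_pre_digraph"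
  assumes "distinct vs" "distinct ws" "set vs = set ws"
  shows "similar_mat (laplacian G vs) (laplacian G ws)"
proof -
  define n where "n = length vs"
  have n': "length ws = n"
    using assms distinct_card unfolding n_def by metis
  define f where "f = (\<lambda>v w :: 'a. if v = w then 1 else (0 :: real))"
  define P where "P = mat n n (\<lambda>(i, j). f (vs ! i) (ws ! j))"
  define Q where "Q = mat n n (\<lambda>(i, j). f (ws ! i) (vs ! j))"
  define g where "g = (\<lambda>u v. (if u = v then real (out_degree (with_proj G) u) else 0)
    - (if (u, v) \<in> parcs G then 1 else (0 :: real)))"
  have Lv: "laplacian G vs = mat n n (\<lambda>(i, j). g (vs ! i) (vs ! j))"
    by (rule eq_matI)
      (use assms in
        \<open>auto simp: laplacian_index n_def g_def nth_eq_iff_index_eq\<close>)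
  have Lw: "laplacian G ws = mat n n (\<lambda>(i, j). g (ws ! i) (ws ! j))"
    by (rule eq_matI)
      (use assms n' in
        \<open>auto simp: laplacian_index g_def nth_eq_iff_index_eq\<close>)
  have prod: "mat n n (\<lambda>(i, j). a i (xs ! j)) * mat n n (\<lambda>(i, j). b (xs ! i) j)
      = mat n n (\<lambda>(i, j). \<Sum>x\<in>set ws. a i x * b x j :: real)"
    if xs: "distinct xs" "set xs = set ws" for xs a b
  proof -
    have l: "length xs = n" using n' xs assms distinct_card by metis
    have "(\<Sum>k = 0..<n. h (xs ! k)) = sum h (set ws)" for h :: "'a \<Rightarrow> real"
      using sum.reindex_bij_betw[OF bij_betw_nth[of xs "{0..<n}" "set ws"], of h] xs l
      by (simp add: lessThan_atLeast0)
    then show ?thesis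
      by (intro eq_matI) (auto simp: scalar_prod_def)
  qed
  have mem: "vs ! i \<in> set ws" "ws ! i \<in> set ws" if "i < n" for i
    using that n' nth_mem[of i vs] nth_mem[of i ws] unfolding n_def assms(3) by simp_all
  have delta: "(\<Sum>x\<in>set ws. f u x * h x) = h u" "(\<Sum>x\<in>set ws. h x * f x u) = h u"
    if "u \<in> set ws" for u h
    using that by (simp_all add: f_def if_distrib if_distribR sum.delta sum.delta' cong: if_cong)
  have f_nth: "f (vs ! i) (vs ! j) = (if i = j then 1 else 0)"
    "f (ws ! i) (ws ! j) = (if i = j then 1 else 0)" if "i < n" "j < n" for i j
    using that assms(1,2) n' by (simp_all add: f_def n_def nth_eq_iff_index_eq)
  have "P * Q = 1\<^sub>m n"
    unfolding P_def Q_def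
      prod[OF assms(2) refl, of "\<lambda>i. f (vs ! i)" "\<lambda>x j. f x (vs ! j)"]
    by (rule eq_matI) (simp_all add: delta mem f_nth)
  moreover have "Q * P = 1\<^sub>m n"
    unfolding P_def Q_def
      prod[OF assms(1) assms(3), of "\<lambda>i. f (ws ! i)" "\<lambda>x j. f x (ws ! j)"]
    by (rule eq_matI) (simp_all add: delta mem f_nth)
  moreover have "laplacian G vs = P * laplacian G ws * Q"
  proof -
    have 1: "P * laplacian G ws = mat n n (\<lambda>(i, j). g (vs ! i) (ws ! j))"
      unfolding P_def Lw
        prod[OF assms(2) refl, of "\<lambda>i. f (vs ! i)" "\<lambda>x j. g x (ws ! j)"]
      by (rule eq_matI) (simp_all add: delta mem)
    show ?thesis
      unfolding Lv 1 Q_def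
        prod[OF assms(2) refl, of "\<lambda>i. g (vs ! i)" "\<lambda>x j. f x (vs ! j)"]
      by (rule eq_matI) (simp_all add: delta mem)
  qed
  ultimately have "similar_mat_wit (laplacian G vs) (laplacian G ws) P Q"
    using laplacian_carrier[of G vs] laplacian_carrier[of G ws] n'
    unfolding similar_mat_wit_def by (auto simp: Let_def P_def Q_def n_def)
  then show ?thesis
    unfolding similar_mat_def by blast
qed

lemma L_spectrum_eq:
  assumes "distinct vs" "set vs = pverts G"
  shows "L_spectrum G = mat_spectrum (laplacian G vs)"
proof -
  define ws where "ws = (SOME ws. distinct ws \<and> set ws = pverts G)"
  have ws: "distinct ws \<and> set ws = pverts G"
    unfolding ws_def by (rule someI[of _ vs]) (use assms in auto)
  have "char_poly (laplacian G ws) = char_poly (laplacian G vs)"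
    by (rule char_poly_similar, rule laplacian_similar) (use ws assms in auto)
  then show ?thesis
    unfolding L_spectrum_def mat_spectrum_def ws_def[symmetric]
    by (metis laplacian_carrier of_real_hom.char_poly_hom)
qed

section \<open>Dumbbell graphs\<close>

text \<open>For lists of distinct vertices; a cycle needs at least three of them.\<close>

definition path_graph :: "'a list \<Rightarrow> 'a pair_pre_digraph" where
  "path_graph xs =
     mk_symmetric (with_proj \<lparr> pverts = set xs, parcs = set (zip xs (tl xs)) \<rparr>)"

definition cycle_graph :: "'a list \<Rightarrow> 'a pair_pre_digraph" where
  "cycle_graph xs =
     mk_symmetric (with_proj \<lparr> pverts = set xs, parcs = set (zip xs (rotate1 xs)) \<rparr>)"

text \<open>The cycles occupy the vertices \<open>0, \<dots>, p - 1\<close> and \<open>p + k, \<dots>, p + k + q - 1\<close>. The path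
  has the \<open>k + 2\<close> vertices \<open>p - 1, \<dots>, p + k\<close>, so it shares exactly its first vertex with the
  first cycle and exactly its last vertex with the second one.\<close>

definition dumbbell :: "nat \<Rightarrow> nat \<Rightarrow> nat \<Rightarrow> nat pair_pre_digraph" where
  "dumbbell p k q =
     (let C1 = cycle_graph [0..<p];
          P = path_graph [p - 1..<p + k + 1];
          C2 = cycle_graph [p + k..<p + k + q]
      in \<lparr> pverts = pverts C1 \<union> pverts P \<union> pverts C2,
           parcs = parcs C1 \<union> parcs P \<union> parcs C2 \<rparr>)"

lemma set_zip_upt_tl:
  "set (zip [a..<b] (tl [a..<b])) = {(i, Suc i) | i. a \<le> i \<and> Suc i < b}"
proof (intro equalityI subsetI)
  fix x assume "x \<in> {(i, Suc i) | i. a \<le> i \<and> Suc i < b}"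
  then obtain i where "x = (i, Suc i)" "a \<le> i" "Suc i < b" by blast
  then show "x \<in> set (zip [a..<b] (tl [a..<b]))"
    by (auto simp: set_zip nth_tl intro!: exI[of _ "i - a"])
qed (auto simp: set_zip nth_tl)

lemma set_zip_upt_rotate1:
  assumes "a < b"
  shows "set (zip [a..<b] (rotate1 [a..<b])) =
    insert (b - 1, a) {(i, Suc i) | i. a \<le> i \<and> Suc i < b}"
proof -
  have nth: "rotate1 [a..<b] ! i = (if Suc i = b - a then a else Suc (a + i))" if "i < b - a" for i
    using that by (auto simp: nth_rotate1)
  show ?thesis (is "?L = ?R")
  proof (intro equalityI subsetI)
    fix x assume "x \<in> ?L"
    then show "x \<in> ?R" using nth assms by (auto simp: set_zip split: if_splits)
  next
    fix x assume "x \<in> ?R"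
    then consider "x = (b - 1, a)" | i where "x = (i, Suc i)" "a \<le> i" "Suc i < b" by auto
    then show "x \<in> ?L"
    proof cases
      case 1
      then show ?thesis using nth[of "b - 1 - a"] assms
        by (auto simp: set_zip intro!: exI[of _ "b - 1 - a"])
    next
      case 2
      then show ?thesis using nth[of "i - a"] assms
        by (auto simp: set_zip intro!: exI[of _ "i - a"])
    qed
  qed
qed

lemma pverts_dumbbell:
  assumes "1 \<le> q" "1 \<le> p"
  shows "pverts (dumbbell p k q) = {0..<p + k + q}"
  using assms by (auto simp: dumbbell_def cycle_graph_def path_graph_def Let_def)

lemma parcs_dumbbell:
  assumes "1 \<le> q" "1 \<le> p"
  shows "(u, v) \<in> parcs (dumbbell p k q) \<longleftrightarrow>
    u < p + k + q \<and> v < p + k + q \<and>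
    (v = Suc u \<or> u = Suc v \<or>
     {u, v} = {0, p - 1} \<or> {u, v} = {p + k, p + k + q - 1})"
    (is "_ \<longleftrightarrow> ?rhs")
proof -
  have path: "(u, v) \<in> parcs (path_graph [a..<b]) \<longleftrightarrow>
    a \<le> u \<and> a \<le> v \<and> u < b \<and> v < b \<and> (v = Suc u \<or> u = Suc v)" for a b
    unfolding path_graph_def parcs_mk_symmetric with_proj_simps pair_pre_digraph.simps set_zip_upt_tl
    by auto
  have cycle: "(u, v) \<in> parcs (cycle_graph [a..<b]) \<longleftrightarrow>
    a \<le> u \<and> a \<le> v \<and> u < b \<and> v < b \<and>
    (v = Suc u \<or> u = Suc v \<or> u = a \<and> v = b - 1 \<or> u = b - 1 \<and> v = a)"
    if "a < b" for a b
    unfolding cycle_graph_def parcs_mk_symmetric with_proj_simps pair_pre_digraph.simps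
      set_zip_upt_rotate1[OF that]
    using that by auto
  have p: "0 < p" and q: "p + k < p + k + q"
    using assms by simp_all
  have "(u, v) \<in> parcs (dumbbell p k q) \<longleftrightarrow>
    (u, v) \<in> parcs (cycle_graph [0..<p]) \<or>
    (u, v) \<in> parcs (path_graph [p - 1..<p + k + 1]) \<or>
    (u, v) \<in> parcs (cycle_graph [p + k..<p + k + q])"
    by (simp add: dumbbell_def Let_def)
  also have "\<dots> \<longleftrightarrow> ?rhs" (is "?arcs \<longleftrightarrow> _")
  proof
    assume ?arcs
    then show ?rhs
      unfolding path cycle[OF p] cycle[OF q] doubleton_eq_iff
      using assms by (elim disjE conjE; auto)
  next
    assume r: ?rhs
    show ?arcs
      unfolding path cycle[OF p] cycle[OF q]
      using assms conjunct2[OF conjunct2[OF r]] conjunct1[OF r] conjunct1[OF conjunct2[OF r]]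
      unfolding doubleton_eq_iff
      apply (elim disjE conjE)
      subgoal by (cases "v < p"; cases "u < p + k"; auto)
      subgoal by (cases "u < p"; cases "v < p + k"; auto)
      by (simp; intro disjI2; linarith)+
  qed
  finally show ?thesis .
qed

lemma pair_graph_dumbbell:
  assumes "3 \<le> q" "3 \<le> p"
  shows "pair_graph (dumbbell p k q)"
proof -
  have pv: "pverts (dumbbell p k q) = {0..<p + k + q}"
    using assms by (simp add: pverts_dumbbell)
  have pa: "(u, v) \<in> parcs (dumbbell p k q) \<longleftrightarrow>
    u < p + k + q \<and> v < p + k + q \<and>
    (v = Suc u \<or> u = Suc v \<or>
     {u, v} = {0, p - 1} \<or> {u, v} = {p + k, p + k + q - 1})" for u v
    using assms by (simp add: parcs_dumbbell)
  have sub: "parcs (dumbbell p k q) \<subseteq> {0..<p + k + q} \<times> {0..<p + k + q}"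
    by (auto simp: pa)
  show ?thesis
  proof
    show "finite (parcs (dumbbell p k q))"
      using sub by (rule finite_subset) simp
    show "symmetric (with_proj (dumbbell p k q))"
      unfolding symmetric_def sym_def with_proj_simps pa doubleton_eq_iff by blast
    show "fst e \<noteq> snd e" if "e \<in> parcs (dumbbell p k q)" for e
      using that assms by (cases e) (auto simp: pa doubleton_eq_iff)
    show "fst e \<in> pverts (dumbbell p k q)" "snd e \<in> pverts (dumbbell p k q)"
      if "e \<in> parcs (dumbbell p k q)" for e
      unfolding pv using subsetD[OF sub that] by (simp_all add: mem_Times_iff)
    show "finite (pverts (dumbbell p k q))"
      unfolding pv by simp
  qed
qed

end

theory Submission
  imports Defs "Jordan_Normal_Form.Schur_Decomposition"
begin

text \<open>
  The traces of \<open>L\<close> and \<open>L\<^sup>2\<close> determine the sum of \<open>(d - 2)(d - 3)\<close> over the vertex degrees \<open>d\<close>.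
  It vanishes for a dumbbell, hence a cospectral graph \<open>H\<close> has all degrees 2 except for two vertices
  of degree 3. As 0 is a simple root of the characteristic polynomial, \<open>H\<close> is connected, so it is a
  dumbbell or a theta graph (three paths between the same two vertices).

  With \<open>\<lambda> = 2 - x - 1 / x\<close>, pivoting along the paths gives \<open>det (L - \<lambda>)\<close> in closed form: up to a
  factor that depends only on \<open>x\<close> and the number \<open>n\<close> of vertices, it is a polynomial \<open>\<Phi>\<close> in \<open>x\<close>. The limit of
  \<open>\<Phi> / (x - 1)\<^sup>3\<close> at 1 is \<open>8 n \<tau>\<close>, where \<open>\<tau>\<close> is \<open>p q\<close> for a dumbbell and \<open>a b + b c + c a\<close> for a
  theta graph with path lengths \<open>a \<le> b \<le> c\<close> (the number of spanning trees). At 0, \<open>\<Phi> + (1 + 2 x)\<^sup>2\<close> is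
  a single power of \<open>x\<close> with coefficient 1 plus \<open>x\<^sup>m R\<close> with \<open>R(0) \<ge> 2\<close>, where \<open>m\<close> is \<open>min p q\<close> resp.
  \<open>a + b\<close>; since a coefficient of at least 2 cannot come from the single power, \<open>\<Phi>\<close> determines
  \<open>m\<close>. For two dumbbells, \<open>n\<close>, \<open>p q\<close> and \<open>min p q\<close> determine the parameters. For a dumbbell and a theta graph,
  \<open>q = a + b\<close> and \<open>p q = a b + c q\<close> force \<open>p > c\<close>, whence \<open>p + q + k > a + b + c - 1 = n\<close>.
\<close>

section \<open>Determinants and traces of matrices indexed by a list\<close>


text \<open>Keeping the entry function apart from the enumeration turns block splitting and
  elimination into operations on the vertex list.\<close>

definition list_mat :: "('a \<Rightarrow> 'a \<Rightarrow> 'b) \<Rightarrow> 'a list \<Rightarrow> 'b mat" where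
  "list_mat g vs = mat (length vs) (length vs) (\<lambda>(i, j). g (vs ! i) (vs ! j))"

lemma list_mat_carrier [simp]: "list_mat g vs \<in> carrier_mat (length vs) (length vs)"
  by (simp add: list_mat_def)

lemma list_mat_cong:
  assumes "\<And>a b. a \<in> set vs \<Longrightarrow> b \<in> set vs \<Longrightarrow> g a b = h a b"
  shows "list_mat g vs = list_mat h vs"
  unfolding list_mat_def by (rule cong_mat) (use assms in auto)

lemma list_mat_append:
  "list_mat g (vs @ ws) = four_block_mat (list_mat g vs)
     (mat (length vs) (length ws) (\<lambda>(i, j). g (vs ! i) (ws ! j)))
     (mat (length ws) (length vs) (\<lambda>(i, j). g (ws ! i) (vs ! j))) (list_mat g ws)"
  by (rule eq_matI) (auto simp: list_mat_def nth_append)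

lemma det_list_mat_append:
  fixes g :: "'a \<Rightarrow> 'a \<Rightarrow> 'b :: idom"
  assumes "\<And>a b. a \<in> set vs \<Longrightarrow> b \<in> set ws \<Longrightarrow> g b a = 0"
  shows "det (list_mat g (vs @ ws)) = det (list_mat g vs) * det (list_mat g ws)"
  unfolding list_mat_append
  by (rule det_four_block_mat_lower_left_zero) (use assms in \<open>auto intro!: eq_matI\<close>)

text \<open>Gaussian elimination of one vertex: a unit lower triangular factor is split off, and the
  lower right block of the remaining factor is the Schur complement.\<close>

lemma det_list_mat_pivot:
  fixes g :: "'a \<Rightarrow> 'a \<Rightarrow> 'b :: field"
  assumes "g v v \<noteq> 0"
  shows "det (list_mat g (v # vs)) =
    g v v * det (list_mat (\<lambda>a b. g a b - g a v * g v b / g v v) vs)"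
proof -
  define m where "m = length vs"
  define A where "A = mat 1 1 (\<lambda>_. g v v)"
  define B where "B = mat 1 m (\<lambda>(i, j). g v (vs ! j))"
  define C where "C = mat m 1 (\<lambda>(i, j). g (vs ! i) v / g v v)"
  define S where "S = list_mat (\<lambda>a b. g a b - g a v * g v b / g v v) vs"
  have car: "A \<in> carrier_mat 1 1" "B \<in> carrier_mat 1 m" "C \<in> carrier_mat m 1" "S \<in> carrier_mat m m"
    by (simp_all add: A_def B_def C_def S_def m_def)
  have "list_mat g (v # vs) =
      four_block_mat (1\<^sub>m 1) (0\<^sub>m 1 m) C (1\<^sub>m m) * four_block_mat A B (0\<^sub>m m 1) S"
  proof (subst mult_four_block_mat[where ?nr1.0 = 1 and ?n1.0 = 1 and ?n2.0 = m and ?nr2.0 = m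
        and ?nc1.0 = 1 and ?nc2.0 = m])
    show "list_mat g (v # vs) = four_block_mat (1\<^sub>m 1 * A + 0\<^sub>m 1 m * 0\<^sub>m m 1)
        (1\<^sub>m 1 * B + 0\<^sub>m 1 m * S) (C * A + 1\<^sub>m m * 0\<^sub>m m 1) (C * B + 1\<^sub>m m * S)"
      using assms
      by (intro eq_matI)
        (auto simp: list_mat_def A_def B_def C_def S_def m_def nth_Cons' scalar_prod_def)
  qed (use car in auto)
  then have "det (list_mat g (v # vs)) =
      det (four_block_mat (1\<^sub>m 1) (0\<^sub>m 1 m) C (1\<^sub>m m)) * det (four_block_mat A B (0\<^sub>m m 1) S)"
    by (simp, intro det_mult[where n = "1 + m"]) (use car in auto)
  also have "det (four_block_mat (1\<^sub>m 1) (0\<^sub>m 1 m) C (1\<^sub>m m)) = 1"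
    by (subst det_four_block_mat_upper_right_zero[where n = 1 and m = m]) (use car in auto)
  also have "det (four_block_mat A B (0\<^sub>m m 1) S) = g v v * det S"
    by (subst det_four_block_mat_lower_left_zero[where n = 1 and m = m])
      (use car in \<open>auto simp: A_def det_single\<close>)
  finally show ?thesis
    by (simp add: S_def)
qed

lemma det_list_mat_two:
  fixes g :: "'a \<Rightarrow> 'a \<Rightarrow> 'b :: idom"
  shows "det (list_mat g [u, v]) = g u u * g v v - g u v * g v u"
proof -
  define m where "m = (\<lambda>c :: 'b. mat 1 1 (\<lambda>_. c))"
  have "list_mat g [u, v] = four_block_mat (m (g u u)) (m (g u v)) (m (g v u)) (m (g v v))"
    by (rule eq_matI) (auto simp: list_mat_def m_def less_2_cases_iff)
  also have "det \<dots> = det (m (g u u) * m (g v v) - m (g u v) * m (g v u))"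
    by (rule det_four_block_mat[where n = 1])
      (auto simp: m_def scalar_prod_def mult.commute intro!: eq_matI)
  also have "m (g u u) * m (g v v) - m (g u v) * m (g v u) = m (g u u * g v v - g u v * g v u)"
    by (rule eq_matI) (auto simp: m_def scalar_prod_def)
  finally show ?thesis
    by (simp add: det_single m_def)
qed

section \<open>Traces as power sums of the eigenvalues\<close>

lemma trace_comm:
  fixes A B :: "'b :: comm_semiring_0 mat"
  assumes "A \<in> carrier_mat n n" "B \<in> carrier_mat n n"
  shows "sum_list (diag_mat (A * B)) = sum_list (diag_mat (B * A))"
proof -
  have "sum_list (diag_mat (X * Y)) = (\<Sum>i<n. \<Sum>j<n. X $$ (i, j) * Y $$ (j, i))"
    if "X \<in> carrier_mat n n" "Y \<in> carrier_mat n n" for X Y :: "'b mat"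
    using that
    by (auto simp: diag_mat_def interv_sum_list_conv_sum_set_nat scalar_prod_def
        lessThan_atLeast0 intro!: sum.cong)
  note this[OF assms] this[OF assms(2,1)]
  then show ?thesis
    by (simp add: mult.commute) (rule sum.swap)
qed

lemma trace_similar:
  fixes A B :: "'b :: comm_ring_1 mat"
  assumes "similar_mat_wit A B P Q" "A \<in> carrier_mat n n"
  shows "sum_list (diag_mat A) = sum_list (diag_mat B)"
proof -
  note w = similar_mat_witD2[OF assms(2,1)]
  have "sum_list (diag_mat A) = sum_list (diag_mat ((P * B) * Q))"
    using w by simp
  also have "\<dots> = sum_list (diag_mat (Q * (P * B)))"
    using w by (intro trace_comm[where n = n]) auto
  also have "Q * (P * B) = B"
    using w(2,5-7) by (simp add: assoc_mult_mat[symmetric, of _ n n _ n _ n])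
  finally show ?thesis .
qed

text \<open>Schur triangulation replaces \<open>A\<close> by an upper triangular matrix with
  diagonal \<open>es\<close>, and traces are invariant under similarity.\<close>

lemma trace_eq_sum_eigenvalues:
  fixes A :: "complex mat"
  assumes A: "A \<in> carrier_mat n n" and c: "char_poly A = (\<Prod>e\<leftarrow>es. [:- e, 1:])"
  shows "sum_list (diag_mat A) = sum_list es"
    and "sum_list (diag_mat (A * A)) = (\<Sum>e\<leftarrow>es. e ^ 2)"
proof -
  obtain B P Q where "schur_decomposition A es = (B, P, Q)"
    by (cases "schur_decomposition A es")
  from schur_decomposition[OF A c this]
  have s: "similar_mat_wit A B P Q" and u: "upper_triangular B" and d: "diag_mat B = es"
    by auto
  note w = similar_mat_witD2[OF A s]
  show "sum_list (diag_mat A) = sum_list es"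
    using trace_similar[OF s A] d by simp
  have eq: "P * B * Q * (P * B * Q) = P * (B * B) * Q"
  proof -
    have "P * B * Q * (P * B * Q) = P * B * ((Q * P) * (B * Q))"
      using w(5-7) by (simp add: assoc_mult_mat[of _ n n _ n _ n])
    also have "Q * P * (B * Q) = B * Q"
      using w by simp
    also have "P * B * (B * Q) = P * (B * B) * Q"
      using w(5-7) by (simp add: assoc_mult_mat[of _ n n _ n _ n])
    finally show ?thesis .
  qed
  have "similar_mat_wit (A * A) (B * B) P Q"
    using w A eq unfolding similar_mat_wit_def by (auto simp: Let_def)
  then have "sum_list (diag_mat (A * A)) = sum_list (diag_mat (B * B))"
    by (rule trace_similar) (use A in auto)
  also have "\<dots> = (\<Sum>i<n. (\<Sum>j<n. B $$ (i, j) * B $$ (j, i)))"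
    using w(5)
    by (auto simp: diag_mat_def interv_sum_list_conv_sum_set_nat scalar_prod_def
        lessThan_atLeast0 intro!: sum.cong)
  also have "\<dots> = (\<Sum>i<n. (\<Sum>j<n. if j = i then B $$ (i, i) ^ 2 else 0))"
  proof (intro sum.cong refl)
    fix i j assume "i \<in> {..<n}" "j \<in> {..<n}"
    \<comment> \<open>Unless \<open>i = j\<close>, one of the two factors lies below the
      diagonal.\<close>
    then show "B $$ (i, j) * B $$ (j, i) = (if j = i then B $$ (i, i) ^ 2 else 0)"
      using u w(5) by (cases i j rule: linorder_cases) (auto simp: upper_triangular_def power2_eq_square)
  qed
  also have "\<dots> = (\<Sum>e\<leftarrow>es. e ^ 2)"
    using w(5) by (auto simp: d[symmetric] diag_mat_def interv_sum_list_conv_sum_set_nat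
        lessThan_atLeast0 comp_def)
  finally show "sum_list (diag_mat (A * A)) = (\<Sum>e\<leftarrow>es. e ^ 2)" .
qed

text \<open>The characteristic polynomial splits over the complex numbers, so both traces are power
  sums of one common list of roots. The embedding of the reals commutes with products and traces,
  which carries the equations back.\<close>

lemma trace_eq_of_char_poly_eq:
  fixes A B :: "real mat"
  assumes A: "A \<in> carrier_mat n n" and B: "B \<in> carrier_mat n n"
    and c: "char_poly A = char_poly B"
  shows "sum_list (diag_mat A) = sum_list (diag_mat B)"
    and "sum_list (diag_mat (A * A)) = sum_list (diag_mat (B * B))"
proof -
  let ?c = "map_mat complex_of_real"
  have cA: "?c A \<in> carrier_mat n n" and cB: "?c B \<in> carrier_mat n n"
    using A B by auto
  obtain es where es: "char_poly (?c A) = (\<Prod>e\<leftarrow>es. [:- e, 1:])"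
    using char_poly_factorized[OF cA] by blast
  have es': "char_poly (?c B) = (\<Prod>e\<leftarrow>es. [:- e, 1:])"
    using es unfolding of_real_hom.char_poly_hom[OF A] of_real_hom.char_poly_hom[OF B] c .
  have tr: "sum_list (diag_mat (?c M)) = complex_of_real (sum_list (diag_mat M))"
    if "M \<in> carrier_mat n n" for M
    using that
    by (auto simp: diag_mat_def interv_sum_list_conv_sum_set_nat intro!: sum.cong)
  have sq: "?c M * ?c M = ?c (M * M)" if "M \<in> carrier_mat n n" for M
    using that by (rule of_real_hom.mat_hom_mult[symmetric, OF that])
  have "complex_of_real (sum_list (diag_mat A)) = complex_of_real (sum_list (diag_mat B))"
    using trace_eq_sum_eigenvalues(1)[OF cA es] trace_eq_sum_eigenvalues(1)[OF cB es']
      tr[OF A] tr[OF B] by simp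
  then show "sum_list (diag_mat A) = sum_list (diag_mat B)"
    by simp
  have "complex_of_real (sum_list (diag_mat (A * A))) = complex_of_real (sum_list (diag_mat (B * B)))"
    using trace_eq_sum_eigenvalues(2)[OF cA es] trace_eq_sum_eigenvalues(2)[OF cB es']
      tr[of "A * A"] tr[of "B * B"] A B by (simp add: sq[OF A] sq[OF B])
  then show "sum_list (diag_mat (A * A)) = sum_list (diag_mat (B * B))"
    by (simp only: of_real_eq_iff)
qed

text \<open>A monic complex polynomial is the product over its root multiset, so passing to the
  roots loses nothing. The sizes \<open>n\<close> and \<open>m\<close> are independent because the
  number of vertices of a cospectral graph is itself read off the degree of the characteristic
  polynomial.\<close>

lemma mat_spectrum_eq_iff:
  assumes A: "A \<in> carrier_mat n n" and B: "B \<in> carrier_mat m m"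
  shows "mat_spectrum A = mat_spectrum B \<longleftrightarrow> char_poly A = char_poly B"
proof
  let ?c = "map_mat complex_of_real"
  assume eq: "mat_spectrum A = mat_spectrum B"
  have "char_poly (?c M) = (\<Prod>x\<in>#mat_spectrum M. [:- x, 1:])" if "M \<in> carrier_mat k k" for M k
    using complex_poly_decompose_multiset[of "char_poly (?c M)"] degree_monic_char_poly[of "?c M" k] that
    by (simp add: mat_spectrum_def)
  with A B eq have "char_poly (?c A) = char_poly (?c B)"
    by metis
  then have "map_poly complex_of_real (char_poly A) = map_poly complex_of_real (char_poly B)"
    using of_real_hom.char_poly_hom[OF A] of_real_hom.char_poly_hom[OF B] by metis
  then show "char_poly A = char_poly B"
    by (simp add: poly_eq_iff coeff_map_poly)
next
  assume "char_poly A = char_poly B"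
  then show "mat_spectrum A = mat_spectrum B"
    unfolding mat_spectrum_def of_real_hom.char_poly_hom[OF A] of_real_hom.char_poly_hom[OF B]
    by simp
qed

section \<open>Evaluating and factoring characteristic polynomials\<close>

lemma poly_char_poly_list_mat:
  fixes g :: "'a \<Rightarrow> 'a \<Rightarrow> 'b :: field"
  assumes "distinct vs"
  shows "poly (char_poly (list_mat g vs)) k = det (list_mat (\<lambda>a b. (if a = b then k else 0) - g a b) vs)"
  unfolding char_poly_def
  by (rule poly_det_cong[where n = "length vs"])
    (use assms in \<open>auto simp: list_mat_def char_poly_matrix_def nth_eq_iff_index_eq\<close>)

text \<open>Both sides are compared as functions, which suffices over an infinite field and reduces
  the claim to a block triangular determinant.\<close>

lemma char_poly_list_mat_append:
  fixes g :: "'a \<Rightarrow> 'a \<Rightarrow> 'b :: field_char_0"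
  assumes "distinct (vs @ ws)" "\<And>a b. a \<in> set vs \<Longrightarrow> b \<in> set ws \<Longrightarrow> g b a = 0"
  shows "char_poly (list_mat g (vs @ ws)) = char_poly (list_mat g vs) * char_poly (list_mat g ws)"
proof -
  have "poly (char_poly (list_mat g (vs @ ws))) k
      = poly (char_poly (list_mat g vs) * char_poly (list_mat g ws)) k" for k
    using assms
    by (subst poly_char_poly_list_mat, simp, subst det_list_mat_append)
      (auto simp: poly_char_poly_list_mat)
  then show ?thesis
    by (simp add: poly_eq_poly_eq_iff[symmetric] fun_eq_iff)
qed

text \<open>Zero row sums put the all-ones vector into the kernel; it is nonzero because
  \<open>vs\<close> is nonempty.\<close>

lemma poly_char_poly_zero_of_row_sums:
  fixes g :: "'a \<Rightarrow> 'a \<Rightarrow> 'b :: field"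
  assumes "distinct vs" "vs \<noteq> []" "\<And>a. a \<in> set vs \<Longrightarrow> (\<Sum>b\<in>set vs. g a b) = 0"
  shows "poly (char_poly (list_mat g vs)) 0 = 0"
proof -
  let ?n = "length vs"
  have "eigenvector (list_mat g vs) (vec ?n (\<lambda>_. 1)) 0"
    unfolding eigenvector_def
  proof (intro conjI)
    show "vec ?n (\<lambda>_. 1 :: 'b) \<noteq> 0\<^sub>v (dim_row (list_mat g vs))"
    proof (rule notI)
      assume "vec ?n (\<lambda>_. 1 :: 'b) = 0\<^sub>v (dim_row (list_mat g vs))"
      then have "vec ?n (\<lambda>_. 1 :: 'b) $ 0 = 0\<^sub>v (dim_row (list_mat g vs)) $ 0"
        by simp
      then show False
        using assms(2) by (simp add: list_mat_def)
    qed
    have "(\<Sum>i = 0..<?n. g a (vs ! i)) = (\<Sum>b\<in>set vs. g a b)" for a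
      using sum.reindex_bij_betw[OF bij_betw_nth[OF assms(1), of "{0..<?n}" "set vs"], of "g a"]
      by (simp add: lessThan_atLeast0)
    then show "list_mat g vs *\<^sub>v vec ?n (\<lambda>_. 1) = 0 \<cdot>\<^sub>v vec ?n (\<lambda>_. 1)"
      using assms(3) by (intro eq_vecI) (auto simp: list_mat_def scalar_prod_def)
  qed (simp add: list_mat_def)
  then show ?thesis
    using eigenvalue_root_char_poly[OF list_mat_carrier[of g vs]] unfolding eigenvalue_def by blast
qed

section \<open>Two families of polynomials\<close>


text \<open>These are the polynomials \<open>\<Phi>\<close>, normalised as in \<open>det_dumbbell\<close> and \<open>det_theta\<close> below.\<close>

definition dumbbell_poly :: "nat \<Rightarrow> nat \<Rightarrow> nat \<Rightarrow> real \<Rightarrow> real" where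
  "dumbbell_poly p q k x = (x ^ p - 1) * (x ^ q - 1) *
     (x ^ (2 * k + 2) * ((x + 2) * x ^ p - x) * ((x + 2) * x ^ q - x)
      - (x ^ p - 2 * x - 1) * (x ^ q - 2 * x - 1))"

definition theta_poly :: "nat \<Rightarrow> nat \<Rightarrow> nat \<Rightarrow> real \<Rightarrow> real" where
  "theta_poly a b c x =
     ((x + 2) * (x ^ a + 1) * (x ^ b + 1) * (x ^ c + 1) - (x + 1) *
       ((x ^ a + 1) * (x ^ b + 1) + (x ^ b + 1) * (x ^ c + 1) + (x ^ c + 1) * (x ^ a + 1))) *
     ((x + 2) * (x ^ a - 1) * (x ^ b - 1) * (x ^ c - 1) + (x + 1) *
       ((x ^ a - 1) * (x ^ b - 1) + (x ^ b - 1) * (x ^ c - 1) + (x ^ c - 1) * (x ^ a - 1)))"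

section \<open>Lowest-order terms at 0\<close>

lemma dumbbell_poly_commute: "dumbbell_poly p q k = dumbbell_poly q p k"
  by (simp add: dumbbell_poly_def fun_eq_iff mult_ac)

lemma dumbbell_poly_expansion:
  assumes "1 \<le> q" "q \<le> p"
  obtains R where "2 \<le> poly R 0"
    "\<And>x. dumbbell_poly p q k x = x ^ (2 * k + 4) + x ^ q * poly R x - (1 + 2 * x) ^ 2"
proof -
  obtain d where p: "p = q + d"
    using assms(2) le_Suc_ex by blast
  define x :: "real poly" where "x = [:0, 1:]"
  \<comment> \<open>With \<open>x ^ p = x ^ q * x ^ d\<close>, the three products in
    \<open>dumbbell_poly\<close> are \<open>1 + x ^ q * r1\<close>,
    \<open>x ^ 2 + x ^ q * r2\<close> and \<open>(2 * x + 1) ^ 2 + x ^ q * r3\<close>. The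
    polynomial \<open>R\<close> collects everything that carries the factor
    \<open>x ^ q\<close>.\<close>
  define r1 where "r1 = x ^ d * x ^ q - x ^ d - 1"
  define r2 where "r2 = (x + 2) ^ 2 * x ^ p - x * (x + 2) * (x ^ d + 1)"
  define r3 where "r3 = x ^ p - (2 * x + 1) * (x ^ d + 1)"
  define R where "R = r1 * (x ^ (2 * k + 2) * x ^ 2 - (2 * x + 1) ^ 2 + x ^ q * (x ^ (2 * k + 2) * r2 - r3))
    + x ^ (2 * k + 2) * r2 - r3"
  have x: "poly x t = t" for t
    by (simp add: x_def)
  show ?thesis
  proof
    \<comment> \<open>At 0 both \<open>r1\<close> and \<open>r3\<close> are
      \<open>- (0 ^ d + 1)\<close>, the factor next to \<open>r1\<close> is -1, and the terms with
      \<open>x ^ (2 * k + 2)\<close> vanish. The power \<open>0 ^ d\<close> is 1 exactly when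
      \<open>p = q\<close>.\<close>
    have "poly R 0 = 2 * (0 ^ d + 1)"
      using assms by (simp add: R_def r1_def r2_def r3_def x power_0_left)
    then show "2 \<le> poly R 0"
      by (simp add: power_0_left)
    show "dumbbell_poly p q k t = t ^ (2 * k + 4) + t ^ q * poly R t - (1 + 2 * t) ^ 2" for t
    proof -
      define Y where "Y = t ^ q"
      define D where "D = t ^ d"
      define K where "K = t ^ (2 * k)"
      have e: "t ^ p = Y * D" "t ^ (2 * k + 2) = K * t ^ 2" "t ^ (2 * k + 4) = K * t ^ 2 * t ^ 2"
        by (simp_all add: Y_def D_def K_def p power_add power2_eq_square power4_eq_xxxx)
      show ?thesis
        unfolding dumbbell_poly_def R_def r1_def r2_def r3_def e(3)
        by (simp add: x e(1,2) flip: Y_def D_def K_def del: power_add_numeral2)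
          (simp add: power2_eq_square algebra_simps)
    qed
  qed
qed

lemma theta_poly_expansion:
  assumes "1 \<le> a" "a \<le> b" "b \<le> c"
  obtains R where "2 \<le> poly R 0"
    "\<And>x. theta_poly a b c x = x ^ (2 * a + 2) + x ^ (a + b) * poly R x - (1 + 2 * x) ^ 2"
proof -
  obtain d where b: "b = a + d"
    using assms(2) le_Suc_ex by blast
  obtain e where c: "c = b + e"
    using assms(3) le_Suc_ex by blast
  define x :: "real poly" where "x = [:0, 1:]"
  define A B C D E where A: "A = x ^ a" and B: "B = x ^ b" and C: "C = x ^ c" and D: "D = x ^ d" and E: "E = x ^ e"
  \<comment> \<open>In the elementary symmetric functions \<open>e1\<close>, \<open>e2\<close>,
    \<open>e3\<close> of \<open>A\<close>, \<open>B\<close>, \<open>C\<close>, the two factors of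
    \<open>theta_poly\<close> are the sum and the difference of \<open>(x + 2) * e3 - x * e1\<close>
    and \<open>e2 - 2 * x - 1\<close>, so their product is a difference of squares. Here
    \<open>e2 = A * B * f\<close>, \<open>e3 = A * B * C\<close> and
    \<open>e1 ^ 2 = A ^ 2 + A * B * (1 + E) * (2 + D + D * E)\<close>; only
    \<open>x ^ 2 * A ^ 2\<close> and \<open>(2 * x + 1) ^ 2\<close> escape the factor
    \<open>A * B\<close>.\<close>
  define f where "f = 1 + E + E * D"
  define R where "R = 2 * (2 * x + 1) * f - A * B * f ^ 2 + x ^ 2 * (1 + E) * (2 + D + D * E)
     - 2 * x * (x + 2) * (A + B + C) * C + (x + 2) ^ 2 * A * B * C * C"
  have x: "poly x t = t" for t
    by (simp add: x_def)
  show ?thesis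
  proof
    have "poly R 0 = 2 * (1 + 0 ^ e + 0 ^ e * 0 ^ d)"
      using assms by (simp add: R_def f_def A B C D E x power_0_left)
    then show "2 \<le> poly R 0"
      by (simp add: power_0_left)
    show "theta_poly a b c t = t ^ (2 * a + 2) + t ^ (a + b) * poly R t - (1 + 2 * t) ^ 2" for t
    proof -
      define A' D' E' where A': "A' = t ^ a" and D': "D' = t ^ d" and E': "E' = t ^ e"
      have e: "t ^ b = A' * D'" "t ^ c = A' * D' * E'" "t ^ (2 * a + 2) = A' ^ 2 * t ^ 2" "t ^ (a + b) = A' ^ 2 * D'"
        by (simp_all add: A' D' E' b c power_add power2_eq_square mult_2)
      show ?thesis
        unfolding theta_poly_def R_def f_def e(3,4)
        by (simp add: x A B C D E e(1,2) flip: A' D' E')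
          (simp add: power2_eq_square algebra_simps)
    qed
  qed
qed

text \<open>The equation holds at infinitely many points, hence between polynomials. If
  \<open>q < r\<close>, the coefficient at \<open>q\<close> is at least 2 on the left, while on the
  right only the single power contributes, at most 1.\<close>

lemma lowest_exponent_eq:
  fixes R S :: "real poly"
  assumes R: "2 \<le> poly R 0" and S: "2 \<le> poly S 0"
    and eq: "\<And>x. 1 < x \<Longrightarrow> x ^ i + x ^ q * poly R x = x ^ j + x ^ r * poly S x"
  shows "q = r"
proof -
  have aux: False if R: "2 \<le> poly R 0" and "q < r"
    and eq: "monom 1 i + monom 1 q * R = monom 1 j + monom 1 r * S" for q r i j and R S :: "real poly"
  proof -
    have "coeff (monom 1 i + monom 1 q * R) q = coeff (monom 1 j + monom 1 r * S) q"
      using eq by simp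
    then have "(if i = q then 1 else 0) + coeff R 0 = (if j = q then 1 else 0 :: real)"
      using \<open>q < r\<close> by (simp add: coeff_monom_mult)
    moreover have "2 \<le> coeff R 0"
      using R by (simp add: poly_0_coeff_0)
    ultimately show False
      by (simp split: if_splits)
  qed
  let ?d = "(monom 1 i + monom 1 q * R) - (monom 1 j + monom 1 r * S)"
  have "{1<..} \<subseteq> {x. poly ?d x = 0}"
    using eq by (auto simp: poly_monom)
  moreover have "infinite {1 :: real<..}"
    by (rule infinite_Ioi)
  ultimately have "infinite {x. poly ?d x = 0}"
    using finite_subset by blast
  then have "?d = 0"
    using poly_roots_finite by blast
  then have "monom 1 i + monom 1 q * R = monom 1 j + monom 1 r * S"
    by simp
  then show ?thesis
    using aux[OF R] aux[OF S] by (metis linorder_neqE_nat)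
qed

section \<open>Order of vanishing at 1\<close>

lemma tendsto_power_quotient: "((\<lambda>x :: real. (x ^ n - 1) / (x - 1)) \<longlongrightarrow> real n) (at_right 1)"
proof -
  have "((\<lambda>x :: real. x ^ n) has_field_derivative real n) (at 1)"
    by (auto intro!: derivative_eq_intros)
  then have "((\<lambda>x :: real. (x ^ n - 1) / (x - 1)) \<longlongrightarrow> real n) (at 1)"
    by (simp add: has_field_derivative_iff)
  then show ?thesis
    by (rule filterlim_mono) (auto simp: at_le)
qed

lemma tendsto_quotient_at_right:
  fixes f :: "real \<Rightarrow> real"
  assumes "(f has_field_derivative D) (at 1)" "f 1 = 0"
  shows "((\<lambda>x. f x / (x - 1)) \<longlongrightarrow> D) (at_right 1)"
  using assms by (auto simp: has_field_derivative_iff intro: filterlim_mono at_le)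

text \<open>The first two factors have simple zeros at 1, with derivatives \<open>p\<close> and
  \<open>q\<close>. The last factor vanishes there too, with derivative
  \<open>8 * (p + q + k)\<close>.\<close>

lemma dumbbell_poly_limit:
  assumes "1 \<le> p" "1 \<le> q"
  shows "((\<lambda>x. dumbbell_poly p q k x / (x - 1) ^ 3) \<longlongrightarrow> 8 * real (p + q + k) * real (p * q)) (at_right 1)"
proof -
  let ?B = "\<lambda>x :: real. x ^ (2 * k + 2) * ((x + 2) * x ^ p - x) * ((x + 2) * x ^ q - x)
      - (x ^ p - 2 * x - 1) * (x ^ q - 2 * x - 1)"
  have "(?B has_field_derivative 8 * real (p + q + k)) (at 1)"
    using assms by (auto intro!: derivative_eq_intros simp: algebra_simps)
  then have "((\<lambda>x. ?B x / (x - 1)) \<longlongrightarrow> 8 * real (p + q + k)) (at_right 1)"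
    by (rule tendsto_quotient_at_right) simp
  from tendsto_mult[OF tendsto_mult[OF tendsto_power_quotient[of p] tendsto_power_quotient[of q]] this]
  have "((\<lambda>x. (x ^ p - 1) / (x - 1) * ((x ^ q - 1) / (x - 1)) * (?B x / (x - 1)))
      \<longlongrightarrow> 8 * real (p + q + k) * real (p * q)) (at_right 1)"
    by (simp add: mult_ac)
  then show ?thesis
    by (simp add: dumbbell_poly_def power3_eq_cube)
qed

text \<open>The first factor has a simple zero at 1. The second has a double one: divided by
  \<open>(x - 1) ^ 2\<close> it becomes an expression in the quotients \<open>?g\<close> that tends
  to \<open>2 * (a * b + b * c + c * a)\<close>.\<close>

lemma theta_poly_limit:
  assumes "1 \<le> a" "1 \<le> b" "1 \<le> c"
  shows "((\<lambda>x. theta_poly a b c x / (x - 1) ^ 3) \<longlongrightarrow>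
    8 * real (a + b + c - 1) * real (a * b + b * c + c * a)) (at_right 1)"
proof -
  let ?S = "\<lambda>x :: real. (x + 2) * (x ^ a + 1) * (x ^ b + 1) * (x ^ c + 1) - (x + 1) *
       ((x ^ a + 1) * (x ^ b + 1) + (x ^ b + 1) * (x ^ c + 1) + (x ^ c + 1) * (x ^ a + 1))"
  let ?g = "\<lambda>n (x :: real). (x ^ n - 1) / (x - 1)"
  have "(?S has_field_derivative 4 * real (a + b + c - 1)) (at 1)"
    using assms by (auto intro!: derivative_eq_intros simp: algebra_simps of_nat_diff)
  then have 1: "((\<lambda>x. ?S x / (x - 1)) \<longlongrightarrow> 4 * real (a + b + c - 1)) (at_right 1)"
    by (rule tendsto_quotient_at_right) simp
  have 2: "((\<lambda>x. (x + 2) * (x - 1) * (?g a x * ?g b x * ?g c x) + (x + 1) *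
      (?g a x * ?g b x + ?g b x * ?g c x + ?g c x * ?g a x)) \<longlongrightarrow>
    (1 + 2) * (1 - 1) * (real a * real b * real c) + (1 + 1) * (real a * real b + real b * real c + real c * real a))
    (at_right 1)"
    by (intro tendsto_intros tendsto_power_quotient)
  have 3: "4 * real (a + b + c - 1) *
      ((1 + 2) * (1 - 1) * (real a * real b * real c) + (1 + 1) * (real a * real b + real b * real c + real c * real a)) =
    8 * real (a + b + c - 1) * real (a * b + b * c + c * a)"
    by simp
  have "((\<lambda>x. ?S x / (x - 1) * ((x + 2) * (x - 1) * (?g a x * ?g b x * ?g c x) + (x + 1) *
      (?g a x * ?g b x + ?g b x * ?g c x + ?g c x * ?g a x))) \<longlongrightarrow>
     8 * real (a + b + c - 1) * real (a * b + b * c + c * a)) (at_right 1)"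
    by (rule tendsto_eq_rhs[OF tendsto_mult[OF 1 2] 3])
  moreover have "\<forall>\<^sub>F x in at_right 1. ?S x / (x - 1) * ((x + 2) * (x - 1) * (?g a x * ?g b x * ?g c x) + (x + 1) *
      (?g a x * ?g b x + ?g b x * ?g c x + ?g c x * ?g a x)) = theta_poly a b c x / (x - 1) ^ 3"
  proof (rule eventually_at_rightI[of 1 2])
    fix x :: real assume "x \<in> {1<..<2}"
    then have x: "x - 1 \<noteq> 0" by simp
    define y where "y = x - 1"
    define A B C where "A = x ^ a - 1" and "B = x ^ b - 1" and "C = x ^ c - 1"
    have g: "S / y * ((x + 2) * y * (A / y * (B / y) * (C / y)) + (x + 1) *
      (A / y * (B / y) + B / y * (C / y) + C / y * (A / y))) = S * ((x + 2) * A * B * C + (x + 1) * (A * B + B * C + C * A)) / y ^ 3" for S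
      using x[folded y_def] by (simp add: field_simps power3_eq_cube)
    show "?S x / (x - 1) * ((x + 2) * (x - 1) * (?g a x * ?g b x * ?g c x) + (x + 1) *
      (?g a x * ?g b x + ?g b x * ?g c x + ?g c x * ?g a x)) = theta_poly a b c x / (x - 1) ^ 3"
      unfolding theta_poly_def by (rule g[unfolded y_def A_def B_def C_def])
  qed simp
  ultimately show ?thesis
    by (rule Lim_transform_eventually)
qed

section \<open>Recovering the parameters from the polynomial\<close>

lemma dumbbell_poly_eqD:
  assumes eq: "\<And>x. 1 < x \<Longrightarrow> dumbbell_poly p q k x = dumbbell_poly p' q' k' x"
    and n: "p + q + k = p' + q' + k'"
    and pos: "1 \<le> q" "q \<le> p" "1 \<le> p'" "1 \<le> q'"
  shows "p' = p \<and> q' = q \<and> k' = k \<or> p' = q \<and> q' = p \<and> k' = k"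
proof -
  have ev: "\<forall>\<^sub>F x in at_right 1. dumbbell_poly p q k x / (x - 1) ^ 3 = dumbbell_poly p' q' k' x / (x - 1) ^ 3"
    by (rule eventually_at_rightI[of 1 2]) (use eq in auto)
  have "8 * real (p + q + k) * real (p * q) = 8 * real (p' + q' + k') * real (p' * q')"
    by (rule tendsto_unique[OF _ Lim_transform_eventually[OF dumbbell_poly_limit ev] dumbbell_poly_limit])
      (use pos in auto)
  then have "real (p * q) = real (p' * q')"
    unfolding n using pos by simp
  then have pq: "p * q = p' * q'"
    using of_nat_eq_iff by blast
  \<comment> \<open>The expansion needs the smaller cycle length in second place. As
    \<open>p'\<close> and \<open>q'\<close> come in no known order, \<open>key\<close> is stated for
    general \<open>r\<close> and \<open>s\<close>, and \<open>dumbbell_poly_commute\<close> provides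
    the swap.\<close>
  have key: "q = s" if sr: "1 \<le> s" "s \<le> r" and eq: "\<And>x. 1 < x \<Longrightarrow> dumbbell_poly p q k x = dumbbell_poly r s k' x" for r s
  proof -
    obtain R where R: "2 \<le> poly R 0"
      "\<And>x. dumbbell_poly p q k x = x ^ (2 * k + 4) + x ^ q * poly R x - (1 + 2 * x) ^ 2"
      using dumbbell_poly_expansion[OF pos(1,2)] by blast
    obtain S where S: "2 \<le> poly S 0"
      "\<And>x. dumbbell_poly r s k' x = x ^ (2 * k' + 4) + x ^ s * poly S x - (1 + 2 * x) ^ 2"
      using dumbbell_poly_expansion[OF sr] by blast
    show ?thesis
      by (rule lowest_exponent_eq[OF R(1) S(1), of "2 * k + 4" _ "2 * k' + 4"]) (use eq R(2) S(2) in force)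
  qed
  show ?thesis
  proof (cases "q' \<le> p'")
    case True
    then have "q = q'"
      using key pos eq by blast
    then show ?thesis
      using pq n pos by simp
  next
    case False
    then have "q = p'"
      using key[of p' q'] pos eq dumbbell_poly_commute[of p' q' k'] by simp
    then show ?thesis
      using pq n pos by (simp add: mult.commute)
  qed
qed

text \<open>The hypothesis \<open>n\<close> compares vertex counts: a theta graph with path lengths
  \<open>a\<close>, \<open>b\<close>, \<open>c\<close> has \<open>a + b + c - 1\<close>
  vertices.\<close>

lemma dumbbell_poly_neq_theta_poly:
  assumes eq: "\<And>x. 1 < x \<Longrightarrow> dumbbell_poly p q k x = theta_poly a b c x"
    and n: "p + q + k + 1 = a + b + c"
    and pos: "1 \<le> q" "q \<le> p" "1 \<le> a" "1 \<le> b" "1 \<le> c"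
  shows False
proof -
  have sym: "theta_poly a b c = theta_poly b a c" "theta_poly a b c = theta_poly a c b" for a b c
    by (simp_all add: theta_poly_def fun_eq_iff algebra_simps)
  \<comment> \<open>The theta polynomial is symmetric in the three lengths, so they may be taken in
    increasing order.\<close>
  have main: False if ord: "1 \<le> a" "a \<le> b" "b \<le> c" and n: "p + q + k + 1 = a + b + c"
    and eq: "\<And>x. 1 < x \<Longrightarrow> dumbbell_poly p q k x = theta_poly a b c x" for a b c
  proof -
    have ev: "\<forall>\<^sub>F x in at_right 1. dumbbell_poly p q k x / (x - 1) ^ 3 = theta_poly a b c x / (x - 1) ^ 3"
      by (rule eventually_at_rightI[of 1 2]) (use eq in auto)
    have n': "a + b + c - 1 = p + q + k"
      using n by simp
    have "8 * real (p + q + k) * real (p * q) = 8 * real (a + b + c - 1) * real (a * b + b * c + c * a)"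
      by (rule tendsto_unique[OF _ Lim_transform_eventually[OF dumbbell_poly_limit ev] theta_poly_limit])
        (use pos ord in auto)
    then have "real (p * q) = real (a * b + b * c + c * a)"
      unfolding n' using pos by (simp del: of_nat_mult of_nat_add)
    then have pq: "p * q = a * b + b * c + c * a"
      using of_nat_eq_iff by blast
    obtain R where R: "2 \<le> poly R 0"
      "\<And>x. dumbbell_poly p q k x = x ^ (2 * k + 4) + x ^ q * poly R x - (1 + 2 * x) ^ 2"
      using dumbbell_poly_expansion[OF pos(1,2)] by blast
    obtain S where S: "2 \<le> poly S 0"
      "\<And>x. theta_poly a b c x = x ^ (2 * a + 2) + x ^ (a + b) * poly S x - (1 + 2 * x) ^ 2"
      using theta_poly_expansion[OF ord] by blast
    have q: "q = a + b"
      by (rule lowest_exponent_eq[OF R(1) S(1), of "2 * k + 4" _ "2 * a + 2"]) (use eq R(2) S(2) in force)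
    \<comment> \<open>With \<open>q = a + b\<close> the vertex count leaves
      \<open>c = p + k + 1\<close>. Then \<open>p * q\<close> is at most \<open>c * (a + b)\<close>,
      which misses the positive term \<open>a * b\<close>.\<close>
    have "p \<le> c"
      using n q by simp
    then have "p * q \<le> c * (a + b)"
      unfolding q by (rule mult_right_mono) simp
    also have "\<dots> < a * b + b * c + c * a"
      using ord by (simp add: algebra_simps)
    finally show False
      using pq by simp
  qed
  consider "a \<le> b" "b \<le> c" | "a \<le> c" "c \<le> b" | "b \<le> a" "a \<le> c" | "b \<le> c" "c \<le> a" | "c \<le> a" "a \<le> b" | "c \<le> b" "b \<le> a"
    by linarith
  then show False
    using main[of a b c] main[of a c b] main[of b a c] main[of b c a] main[of c a b] main[of c b a]
      eq n pos sym by cases (auto simp: add_ac)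
qed

section \<open>Eliminating paths from a determinant\<close>


text \<open>A loop \<open>c = d\<close> counts twice; loops arise when a cycle is contracted to one vertex.\<close>

definition edge_weight :: "'a \<Rightarrow> 'a \<Rightarrow> 'a \<Rightarrow> 'a \<Rightarrow> real" where
  "edge_weight c d a b = of_bool (a = c \<and> b = d) + of_bool (a = d \<and> b = c)"

lemma edge_weight_eq_0:
  "a \<notin> {c, d} \<or> b \<notin> {c, d} \<Longrightarrow> edge_weight c d a b = 0"
  by (elim disjE) (simp_all add: edge_weight_def)

text \<open>The weighted adjacency matrix of a walk. Weights are summed along the list, so a cycle
  through \<open>u\<close> is written \<open>u # ys @ [u]\<close>, and an edge used twice shows up
  as an entry above 1.\<close>

fun path_weight :: "'a list \<Rightarrow> 'a \<Rightarrow> 'a \<Rightarrow> real" where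
  "path_weight (c # d # zs) a b = edge_weight c d a b + path_weight (d # zs) a b"
| "path_weight _ a b = 0"

lemma path_weight_Cons:
  "zs \<noteq> [] \<Longrightarrow> path_weight (c # zs) a b = edge_weight c (hd zs) a b + path_weight zs a b"
  by (cases zs) auto

lemma path_weight_snoc:
  "zs \<noteq> [] \<Longrightarrow> path_weight (zs @ [d]) a b = path_weight zs a b + edge_weight (last zs) d a b"
  by (induction zs) (auto simp: path_weight_Cons split: if_splits)

lemma path_weight_rev: "path_weight (rev zs) a b = path_weight zs a b"
proof (induction zs)
  case (Cons c zs)
  have "edge_weight (hd zs) c a b = edge_weight c (hd zs) a b"
    by (simp add: edge_weight_def)
  then show ?case
    using Cons by (cases "zs = []") (simp_all add: path_weight_snoc path_weight_Cons last_rev)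
qed simp

lemma edge_weight_commute: "edge_weight c d a b = edge_weight c d b a"
  by (simp add: edge_weight_def conj_commute)

lemma path_weight_commute: "path_weight zs a b = path_weight zs b a"
proof (induction zs a b rule: path_weight.induct)
  case (1 c d zs a b)
  then show ?case
    using edge_weight_commute[of c d a b] by (simp only: path_weight.simps)
qed simp_all

lemma path_weight_eq_0:
  "a \<notin> set zs \<or> b \<notin> set zs \<Longrightarrow> path_weight zs a b = 0"
proof (induction zs a b rule: path_weight.induct)
  case (1 c d zs a b)
  have "edge_weight c d a b = 0"
    by (rule edge_weight_eq_0) (use 1(2) in simp, blast)
  moreover have "path_weight (d # zs) a b = 0"
    by (rule 1(1)) (use 1(2) in simp, blast)
  ultimately show ?case
    by simp
qed simp_all

lemma path_weight_map:
  assumes "inj_on f (insert a (insert b (set zs)))"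
  shows "path_weight (map f zs) (f a) (f b) = path_weight zs a b"
  using assms
proof (induction zs a b rule: path_weight.induct)
  case (1 c d zs a b)
  then have "path_weight (map f (d # zs)) (f a) (f b) = path_weight (d # zs) a b"
    by (intro 1(1) inj_on_subset[OF 1(2)]) auto
  moreover have "edge_weight (f c) (f d) (f a) (f b) = edge_weight c d a b"
  proof -
    have "f a = f c \<longleftrightarrow> a = c" "f b = f c \<longleftrightarrow> b = c" "f a = f d \<longleftrightarrow> a = d" "f b = f d \<longleftrightarrow> b = d"
      by (rule inj_on_eq_iff[OF 1(2)]; simp)+
    then show ?thesis
      by (simp add: edge_weight_def)
  qed
  ultimately show ?case
    by simp
qed simp_all

text \<open>With \<open>z = x + 1 / x\<close> this is the determinant of \<open>z I - A\<close> for the path with \<open>j - 1\<close> vertices.\<close>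

definition qnum :: "real \<Rightarrow> nat \<Rightarrow> real" where
  "qnum x j = (x ^ j - inverse (x ^ j)) / (x - inverse x)"

lemma qnum_0 [simp]: "qnum x 0 = 0"
  by (simp add: qnum_def)

lemma diff_inverse_pos:
  fixes x :: real
  assumes "1 < x"
  shows "0 < x - inverse x"
  using assms by (smt (verit) inverse_less_1_iff)

lemma qnum_1 [simp]: "1 < x \<Longrightarrow> qnum x (Suc 0) = 1"
  using diff_inverse_pos[of x] by (simp add: qnum_def)

lemma qnum_pos: "1 < x \<Longrightarrow> 0 < j \<Longrightarrow> 0 < qnum x j"
  unfolding qnum_def by (intro divide_pos_pos diff_inverse_pos) auto

text \<open>In terms of determinants, a path with \<open>i + m\<close> vertices is expanded at one
  edge: the product of the two parts, minus the product of what remains of them without the end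
  points of that edge. It is verified here on the closed form.\<close>

lemma qnum_mult:
  assumes "1 < x"
  shows "qnum x (Suc m) * qnum x (Suc i) = qnum x (Suc (i + m)) + qnum x i * qnum x m"
proof -
  define w where "w = x - inverse x"
  have w: "w \<noteq> 0"
    using diff_inverse_pos[OF assms] by (simp add: w_def)
  define A B where "A = x ^ m" and "B = x ^ i"
  have nz: "A \<noteq> 0" "B \<noteq> 0" "x \<noteq> 0"
    using assms by (auto simp: A_def B_def)
  have "(x * A - inverse (x * A)) * (x * B - inverse (x * B))
      = w * (x * (B * A) - inverse (x * (B * A))) + (B - inverse B) * (A - inverse A)"
    unfolding w_def using nz by (simp add: field_simps)
  moreover have "a * b = w * c + d * e \<Longrightarrow> a / w * (b / w) = c / w + d / w * (e / w)" for a b c d e :: real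
    using w by (simp add: divide_simps)
  ultimately show ?thesis
    unfolding qnum_def w_def[symmetric] power_Suc power_add A_def[symmetric] B_def[symmetric]
    by blast
qed

lemma qnum_Suc_Suc:
  assumes "1 < x"
  shows "qnum x (Suc (Suc j)) = (x + inverse x) * qnum x (Suc j) - qnum x j"
proof -
  define w where "w = x - inverse x"
  have w: "w \<noteq> 0"
    using diff_inverse_pos[OF assms] by (simp add: w_def)
  have "x * (x * x ^ j) - inverse (x * (x * x ^ j))
      = (x + inverse x) * (x * x ^ j - inverse (x * x ^ j)) - (x ^ j - inverse (x ^ j))"
    using assms by (simp add: field_simps)
  moreover have "a = z * b - c \<Longrightarrow> a / w = z * (b / w) - c / w" for a b c z :: real
    by (simp add: diff_divide_distrib)
  ultimately show ?thesis
    unfolding qnum_def w_def[symmetric] power_Suc by blast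
qed

text \<open>What eliminating the \<open>m\<close> inner vertices of a path from \<open>s\<close> to
  \<open>t\<close> subtracts from the rest of the matrix: the path becomes a single edge of weight
  \<open>1 / qnum x (Suc m)\<close> and shifts the diagonal at its ends. For \<open>s = t\<close>
  both terms count twice.\<close>

definition path_correction :: "real \<Rightarrow> nat \<Rightarrow> 'a \<Rightarrow> 'a \<Rightarrow> 'a \<Rightarrow> 'a \<Rightarrow> real" where
  "path_correction x m s t a b =
     qnum x m / qnum x (Suc m) * (of_bool (a = s \<and> b = s) + of_bool (a = t \<and> b = t))
     + edge_weight s t a b / qnum x (Suc m)"

text \<open>The matrix on the left is the state after \<open>j\<close> pivots on a path attached to \<open>s\<close>: the next vertex of
  the path is joined to \<open>s\<close> by an edge of weight \<open>1 / qnum x (Suc j)\<close>, and its diagonal entry has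
  dropped by \<open>qnum x j / qnum x (Suc j)\<close>.\<close>

lemma det_eliminate_path_aux:
  fixes h :: "'a \<Rightarrow> 'a \<Rightarrow> real"
  assumes "1 < x" "distinct ys" "s \<notin> set ys" "t \<notin> set ys" "set ys \<inter> set vs = {}"
    and "\<And>a b. a \<in> set ys \<or> b \<in> set ys \<Longrightarrow> h a b = 0"
  shows "det (list_mat (\<lambda>a b. h a b + (x + inverse x) * of_bool (a = b \<and> a \<in> set ys)
        - qnum x j / qnum x (Suc j) * of_bool (a = hd (ys @ [t]) \<and> b = hd (ys @ [t]))
        - edge_weight s (hd (ys @ [t])) a b / qnum x (Suc j) - path_weight (ys @ [t]) a b) (ys @ vs)) =
    qnum x (Suc j + length ys) / qnum x (Suc j) *
    det (list_mat (\<lambda>a b. h a b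
        - qnum x (length ys) / (qnum x (Suc j) * qnum x (Suc j + length ys)) * of_bool (a = s \<and> b = s)
        - qnum x (j + length ys) / qnum x (Suc j + length ys) * of_bool (a = t \<and> b = t)
        - edge_weight s t a b / qnum x (Suc j + length ys)) vs)"
  using assms(2-)
proof (induction ys arbitrary: j h)
  case Nil
  then show ?case
    using qnum_pos[OF assms(1), of "Suc j"] by simp
next
  case (Cons y ys)
  let ?q = "qnum x" and ?z = "x + inverse x" and ?n = "hd (ys @ [t])" and ?m = "length ys"
  let ?M = "\<lambda>a b. h a b + ?z * of_bool (a = b \<and> a \<in> set (y # ys))
        - ?q j / ?q (Suc j) * of_bool (a = hd ((y # ys) @ [t]) \<and> b = hd ((y # ys) @ [t]))
        - edge_weight s (hd ((y # ys) @ [t])) a b / ?q (Suc j) - path_weight ((y # ys) @ [t]) a b"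
  \<comment> \<open>The pivot on \<open>y\<close> alters the diagonal at \<open>s\<close>. The
    induction hypothesis holds for all \<open>h\<close>, so this change is absorbed into
    \<open>?h\<close>.\<close>
  let ?h = "\<lambda>a b. h a b - 1 / (?q (Suc j) * ?q (Suc (Suc j))) * of_bool (a = s \<and> b = s)"
  have pos: "0 < ?q (Suc i)" for i
    using qnum_pos[OF assms(1)] by simp
  have y: "y \<noteq> s" "y \<noteq> t" "y \<notin> set ys" "y \<notin> set vs" "y \<noteq> ?n" "y \<notin> set (ys @ [t])"
    using Cons.prems by (auto simp: hd_append)
  have h0: "h y b = 0" "h a y = 0" for a b
    using Cons.prems(5) by auto
  have pw: "path_weight ((y # ys) @ [t]) a b = edge_weight y ?n a b + path_weight (ys @ [t]) a b" for a b
    by (simp add: path_weight_Cons)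
  have pw0: "path_weight (ys @ [t]) a y = 0" "path_weight (ys @ [t]) y b = 0" for a b
    using y by (auto intro: path_weight_eq_0)
  \<comment> \<open>By the three-term recurrence \<open>qnum_Suc_Suc\<close> the pivot is a quotient
    of consecutive values of \<open>qnum\<close>, so the product of all pivots telescopes.\<close>
  have piv: "?M y y = ?q (Suc (Suc j)) / ?q (Suc j)"
    unfolding pw pw0 h0 qnum_Suc_Suc[OF assms(1)] using y pos[of j]
    by (simp add: edge_weight_def field_simps)
  have col: "?M a y = - (of_bool (a = s) / ?q (Suc j) + of_bool (a = ?n))"
    and row: "?M y a = - (of_bool (a = s) / ?q (Suc j) + of_bool (a = ?n))" if "a \<noteq> y" for a
    unfolding pw pw0 h0 using y that by (auto simp: edge_weight_def)
  have "det (list_mat ?M (y # (ys @ vs))) =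
      ?M y y * det (list_mat (\<lambda>a b. ?M a b - ?M a y * ?M y b / ?M y y) (ys @ vs))"
    by (rule det_list_mat_pivot) (use pos[of j] pos[of "Suc j"] in \<open>simp only: piv, simp\<close>)
  also have "list_mat (\<lambda>a b. ?M a b - ?M a y * ?M y b / ?M y y) (ys @ vs) =
      list_mat (\<lambda>a b. ?h a b + ?z * of_bool (a = b \<and> a \<in> set ys)
        - ?q (Suc j) / ?q (Suc (Suc j)) * of_bool (a = ?n \<and> b = ?n)
        - edge_weight s ?n a b / ?q (Suc (Suc j)) - path_weight (ys @ [t]) a b) (ys @ vs)"
  proof (rule list_mat_cong)
    fix a b assume "a \<in> set (ys @ vs)" "b \<in> set (ys @ vs)"
    then have ab: "a \<noteq> y" "b \<noteq> y"
      using y by auto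
    have M: "?M a b = h a b + ?z * of_bool (a = b \<and> a \<in> set ys) - path_weight (ys @ [t]) a b"
      unfolding pw using ab y by (simp add: edge_weight_def)
    define c d where "c = ?q (Suc j)" and "d = ?q (Suc (Suc j))"
    have nz: "c \<noteq> 0" "d \<noteq> 0"
      using pos[of j] pos[of "Suc j"] by (simp_all add: c_def d_def)
    have e: "(- (of_bool (a = s) / c + of_bool (a = ?n))) * (- (of_bool (b = s) / c + of_bool (b = ?n))) / (d / c)
       = 1 / (c * d) * of_bool (a = s \<and> b = s) + c / d * of_bool (a = ?n \<and> b = ?n) + edge_weight s ?n a b / d"
      using nz by (simp add: edge_weight_def of_bool_conj field_simps)
    have aux: "X = r1 + r2 + r3 \<Longrightarrow> H + Z - P - X = H - r1 + Z - r2 - r3 - P"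
      for X r1 r2 r3 H Z P :: real
      by simp
    show "?M a b - ?M a y * ?M y b / ?M y y = ?h a b + ?z * of_bool (a = b \<and> a \<in> set ys)
        - ?q (Suc j) / ?q (Suc (Suc j)) * of_bool (a = ?n \<and> b = ?n)
        - edge_weight s ?n a b / ?q (Suc (Suc j)) - path_weight (ys @ [t]) a b"
      unfolding M col[OF ab(1)] row[OF ab(2)] piv
      unfolding c_def[symmetric] d_def[symmetric] by (rule aux[OF e])
  qed
  also have "det \<dots> = ?q (Suc (Suc j) + ?m) / ?q (Suc (Suc j)) *
    det (list_mat (\<lambda>a b. ?h a b
        - ?q ?m / (?q (Suc (Suc j)) * ?q (Suc (Suc j) + ?m)) * of_bool (a = s \<and> b = s)
        - ?q (Suc j + ?m) / ?q (Suc (Suc j) + ?m) * of_bool (a = t \<and> b = t)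
        - edge_weight s t a b / ?q (Suc (Suc j) + ?m)) vs)"
    by (rule Cons.IH) (use Cons.prems in auto)
  also have "list_mat (\<lambda>a b. ?h a b
        - ?q ?m / (?q (Suc (Suc j)) * ?q (Suc (Suc j) + ?m)) * of_bool (a = s \<and> b = s)
        - ?q (Suc j + ?m) / ?q (Suc (Suc j) + ?m) * of_bool (a = t \<and> b = t)
        - edge_weight s t a b / ?q (Suc (Suc j) + ?m)) vs =
      list_mat (\<lambda>a b. h a b
        - ?q (length (y # ys)) / (?q (Suc j) * ?q (Suc j + length (y # ys))) * of_bool (a = s \<and> b = s)
        - ?q (j + length (y # ys)) / ?q (Suc j + length (y # ys)) * of_bool (a = t \<and> b = t)
        - edge_weight s t a b / ?q (Suc j + length (y # ys))) vs"
  proof (rule list_mat_cong)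
    fix a b
    define c d e where "c = ?q (Suc j)" and "d = ?q (Suc (Suc j))" and "e = ?q (Suc (Suc (j + ?m)))"
    have nz: "c \<noteq> 0" "d \<noteq> 0" "e \<noteq> 0"
      using pos[of j] pos[of "Suc j"] pos[of "Suc (j + ?m)"] by (simp_all add: c_def d_def e_def)
    \<comment> \<open>The addition formula merges the correction at \<open>s\<close> from this pivot
      with the one from the remaining vertices.\<close>
    have "?q (Suc ?m) * d = e + c * ?q ?m"
      using qnum_mult[OF assms(1), of ?m "Suc j"] by (simp add: c_def d_def e_def)
    then have eq: "?q (Suc ?m) = (e + c * ?q ?m) / d"
      using nz by (simp add: field_simps)
    have "1 / (c * d) + ?q ?m / (d * e) = ?q (Suc ?m) / (c * e)"
      unfolding eq using nz by (simp add: divide_simps)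
    then show "?h a b
        - ?q ?m / (?q (Suc (Suc j)) * ?q (Suc (Suc j) + ?m)) * of_bool (a = s \<and> b = s)
        - ?q (Suc j + ?m) / ?q (Suc (Suc j) + ?m) * of_bool (a = t \<and> b = t)
        - edge_weight s t a b / ?q (Suc (Suc j) + ?m) =
      h a b - ?q (length (y # ys)) / (?q (Suc j) * ?q (Suc j + length (y # ys))) * of_bool (a = s \<and> b = s)
        - ?q (j + length (y # ys)) / ?q (Suc j + length (y # ys)) * of_bool (a = t \<and> b = t)
        - edge_weight s t a b / ?q (Suc j + length (y # ys))"
      by (cases "a = s \<and> b = s") (simp_all flip: c_def d_def e_def)
  qed
  finally show ?case
    unfolding piv using pos[of "Suc j"] by simp
qed

text \<open>The case \<open>j = 0\<close>: since \<open>qnum x 0 = 0\<close> and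
  \<open>qnum x (Suc 0) = 1\<close>, the initial state is the untouched path.\<close>

lemma det_eliminate_path:
  fixes h :: "'a \<Rightarrow> 'a \<Rightarrow> real"
  assumes "1 < x" "distinct ys" "s \<notin> set ys" "t \<notin> set ys" "set ys \<inter> set vs = {}"
    and "\<And>a b. a \<in> set ys \<or> b \<in> set ys \<Longrightarrow> h a b = 0"
    and "\<And>a b. g a b = h a b + (x + inverse x) * of_bool (a = b \<and> a \<in> set ys) - path_weight (s # ys @ [t]) a b"
  shows "det (list_mat g (ys @ vs)) = qnum x (Suc (length ys)) *
    det (list_mat (\<lambda>a b. h a b - path_correction x (length ys) s t a b) vs)"
proof -
  have "g = (\<lambda>a b. h a b + (x + inverse x) * of_bool (a = b \<and> a \<in> set ys)
        - qnum x 0 / qnum x (Suc 0) * of_bool (a = hd (ys @ [t]) \<and> b = hd (ys @ [t]))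
        - edge_weight s (hd (ys @ [t])) a b / qnum x (Suc 0) - path_weight (ys @ [t]) a b)"
    using assms(1,7) by (auto simp: fun_eq_iff path_weight_Cons)
  then show ?thesis
    using det_eliminate_path_aux[OF assms(1-6), where j = 0] assms(1)
    by (simp add: path_correction_def algebra_simps)
qed

text \<open>The inner vertices of the three paths are disjoint and avoid \<open>u\<close> and
  \<open>v\<close>, so each elimination leaves the other paths untouched and a matrix on
  \<open>[u, v]\<close> remains. Ends may coincide, which covers cycles at \<open>u\<close> or
  \<open>v\<close> as well as paths between them.\<close>

lemma det_three_paths:
  assumes x: "1 < x" and d: "distinct (ys1 @ ys2 @ ys3 @ [u, v])"
    and st: "{s1, t1, s2, t2, s3, t3} \<subseteq> {u, v}"
    and g: "\<And>a b. g a b = (x + inverse x) * of_bool (a = b \<and> a \<in> set (ys1 @ ys2 @ ys3)) +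
      (x + inverse x + 1) * of_bool (a = b \<and> a \<in> {u, v}) -
      path_weight (s1 # ys1 @ [t1]) a b - path_weight (s2 # ys2 @ [t2]) a b - path_weight (s3 # ys3 @ [t3]) a b"
  shows "det (list_mat g (ys1 @ ys2 @ ys3 @ [u, v])) =
    qnum x (Suc (length ys1)) * qnum x (Suc (length ys2)) * qnum x (Suc (length ys3)) *
    det (list_mat (\<lambda>a b. (x + inverse x + 1) * of_bool (a = b \<and> a \<in> {u, v}) -
      path_correction x (length ys1) s1 t1 a b - path_correction x (length ys2) s2 t2 a b
      - path_correction x (length ys3) s3 t3 a b) [u, v])"
proof -
  let ?z = "x + inverse x"
  \<comment> \<open>These are the entries outside the path eliminated next; \<open>h2\<close> and
    \<open>h3\<close> carry the corrections already made.\<close>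
  define h1 where "h1 = (\<lambda>a b. ?z * of_bool (a = b \<and> a \<in> set (ys2 @ ys3)) +
      (?z + 1) * of_bool (a = b \<and> a \<in> {u, v})
      - path_weight (s2 # ys2 @ [t2]) a b - path_weight (s3 # ys3 @ [t3]) a b)"
  define h2 where "h2 = (\<lambda>a b. ?z * of_bool (a = b \<and> a \<in> set ys3) +
      (?z + 1) * of_bool (a = b \<and> a \<in> {u, v})
      - path_weight (s3 # ys3 @ [t3]) a b - path_correction x (length ys1) s1 t1 a b)"
  define h3 where "h3 = (\<lambda>a b. (?z + 1) * of_bool (a = b \<and> a \<in> {u, v})
      - path_correction x (length ys1) s1 t1 a b - path_correction x (length ys2) s2 t2 a b)"
  have pc0: "path_correction x m s t a b = 0"
    if "a \<notin> {u, v} \<or> b \<notin> {u, v}" "s \<in> {u, v}" "t \<in> {u, v}" for m s t a b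
  proof -
    have "edge_weight s t a b = 0"
      using that by (intro edge_weight_eq_0) blast
    moreover have "\<not> (a = s \<and> b = s)" "\<not> (a = t \<and> b = t)"
      using that by blast+
    ultimately show ?thesis
      by (simp only: path_correction_def) simp
  qed
  have d1: "set ys1 \<inter> (set ys2 \<union> set ys3 \<union> {u, v}) = {}"
    and d2: "set ys2 \<inter> (set ys3 \<union> {u, v}) = {}" and d3: "set ys3 \<inter> {u, v} = {}"
    using d by auto
  have sub: "set (s2 # ys2 @ [t2]) \<subseteq> set ys2 \<union> {u, v}" "set (s3 # ys3 @ [t3]) \<subseteq> set ys3 \<union> {u, v}"
    using st by auto
  have st': "s1 \<in> {u, v}" "t1 \<in> {u, v}" "s2 \<in> {u, v}" "t2 \<in> {u, v}" "s3 \<in> {u, v}" "t3 \<in> {u, v}"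
    using st by blast+
  have ends: "s \<notin> set ys" if "s \<in> {u, v}" "set ys \<inter> {u, v} = {}" for s :: 'a and ys
    using that by blast
  have "det (list_mat g (ys1 @ ys2 @ ys3 @ [u, v])) = qnum x (Suc (length ys1)) *
    det (list_mat (\<lambda>a b. h1 a b - path_correction x (length ys1) s1 t1 a b) (ys2 @ ys3 @ [u, v]))"
  proof (rule det_eliminate_path[OF x])
    show "h1 a b = 0" if "a \<in> set ys1 \<or> b \<in> set ys1" for a b
    proof -
      have "path_weight (s2 # ys2 @ [t2]) a b = 0" "path_weight (s3 # ys3 @ [t3]) a b = 0"
        by (rule path_weight_eq_0, use that d1 sub in blast)+
      moreover have "\<not> (a = b \<and> a \<in> set (ys2 @ ys3))" "\<not> (a = b \<and> a \<in> {u, v})"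
        using that d1 by (simp_all only: set_append) blast+
      ultimately show ?thesis
        by (simp only: h1_def) simp
    qed
    show "g a b = h1 a b + ?z * of_bool (a = b \<and> a \<in> set ys1) - path_weight (s1 # ys1 @ [t1]) a b" for a b
    proof -
      have "of_bool (a = b \<and> a \<in> set (ys1 @ ys2 @ ys3)) =
          of_bool (a = b \<and> a \<in> set (ys2 @ ys3)) + (of_bool (a = b \<and> a \<in> set ys1) :: real)"
        using d1 by (cases "a \<in> set ys1") auto
      then show ?thesis
        unfolding g h1_def by (simp only: ring_distribs)
    qed
    show "s1 \<notin> set ys1" "t1 \<notin> set ys1"
      using st' d1 by (blast intro!: ends)+
    show "set ys1 \<inter> set (ys2 @ ys3 @ [u, v]) = {}"
      using d1 by auto
  qed (use d in simp)
  also have "det (list_mat (\<lambda>a b. h1 a b - path_correction x (length ys1) s1 t1 a b) (ys2 @ ys3 @ [u, v])) =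
    qnum x (Suc (length ys2)) *
    det (list_mat (\<lambda>a b. h2 a b - path_correction x (length ys2) s2 t2 a b) (ys3 @ [u, v]))"
  proof (rule det_eliminate_path[OF x])
    show "h2 a b = 0" if "a \<in> set ys2 \<or> b \<in> set ys2" for a b
    proof -
      have "path_weight (s3 # ys3 @ [t3]) a b = 0" "path_correction x (length ys1) s1 t1 a b = 0"
        by (rule path_weight_eq_0, use that d2 sub in blast) (rule pc0[OF _ st'(1,2)], use that d2 in blast)
      moreover have "\<not> (a = b \<and> a \<in> set ys3)" "\<not> (a = b \<and> a \<in> {u, v})"
        using that d2 by blast+
      ultimately show ?thesis
        by (simp only: h2_def) simp
    qed
    show "h1 a b - path_correction x (length ys1) s1 t1 a b =
        h2 a b + ?z * of_bool (a = b \<and> a \<in> set ys2) - path_weight (s2 # ys2 @ [t2]) a b" for a b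
    proof -
      have "of_bool (a = b \<and> a \<in> set (ys2 @ ys3)) =
          of_bool (a = b \<and> a \<in> set ys3) + (of_bool (a = b \<and> a \<in> set ys2) :: real)"
        using d2 by (cases "a \<in> set ys2") auto
      then show ?thesis
        unfolding h1_def h2_def by (simp only: ring_distribs)
    qed
    show "s2 \<notin> set ys2" "t2 \<notin> set ys2"
      using st' d2 by (blast intro!: ends)+
    show "set ys2 \<inter> set (ys3 @ [u, v]) = {}"
      using d2 by auto
  qed (use d in simp)
  also have "det (list_mat (\<lambda>a b. h2 a b - path_correction x (length ys2) s2 t2 a b) (ys3 @ [u, v])) =
    qnum x (Suc (length ys3)) *
    det (list_mat (\<lambda>a b. h3 a b - path_correction x (length ys3) s3 t3 a b) [u, v])"
  proof (rule det_eliminate_path[OF x])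
    show "h3 a b = 0" if "a \<in> set ys3 \<or> b \<in> set ys3" for a b
    proof -
      have "path_correction x (length ys1) s1 t1 a b = 0" "path_correction x (length ys2) s2 t2 a b = 0"
        by (rule pc0[OF _ st'(1,2)], use that d3 in blast) (rule pc0[OF _ st'(3,4)], use that d3 in blast)
      moreover have "\<not> (a = b \<and> a \<in> {u, v})"
        using that d3 by blast
      ultimately show ?thesis
        by (simp only: h3_def) simp
    qed
    show "h2 a b - path_correction x (length ys2) s2 t2 a b =
        h3 a b + ?z * of_bool (a = b \<and> a \<in> set ys3) - path_weight (s3 # ys3 @ [t3]) a b" for a b
      unfolding h2_def h3_def by (simp only: ring_distribs)
    show "s3 \<notin> set ys3" "t3 \<notin> set ys3"
      using st' d3 by (blast intro!: ends)+
    show "set ys3 \<inter> set [u, v] = {}"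
      using d3 by simp
  qed (use d in simp)
  finally show ?thesis
    by (simp add: h3_def mult.assoc)
qed

section \<open>Closed forms of the two determinants\<close>

lemma qnum_quotients:
  fixes x :: real
  assumes "1 < x"
  shows "(qnum x m + 1) / qnum x (Suc m) = (x ^ Suc m + x ^ 2) / (x * (x ^ Suc m + 1))"
    and "(qnum x m - 1) / qnum x (Suc m) = (x ^ Suc m - x ^ 2) / (x * (x ^ Suc m - 1))"
    and "qnum x (Suc m) = ((x ^ Suc m) ^ 2 - 1) * x / (x ^ Suc m * (x ^ 2 - 1))"
proof -
  define A where "A = x ^ Suc m"
  have A: "1 < A"
    unfolding A_def using assms by (intro one_less_power) auto
  have x2: "1 < x ^ 2"
    using assms by (simp add: one_less_power)
  have w: "x - inverse x = (x ^ 2 - 1) / x"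
    using assms by (simp add: field_simps power2_eq_square)
  have Q: "qnum x (Suc m) = (A ^ 2 - 1) * x / (A * (x ^ 2 - 1))"
    unfolding qnum_def A_def[symmetric] w using A assms x2 by (simp add: field_simps power2_eq_square)
  have xm: "x ^ m = A / x"
    using assms by (simp add: A_def)
  have q: "qnum x m = (A ^ 2 - x ^ 2) / (A * (x ^ 2 - 1))"
    unfolding qnum_def xm w using A assms x2 by (simp add: field_simps power2_eq_square)
  have A2: "A ^ 2 - 1 = (A - 1) * (A + 1)"
    by (simp add: power2_eq_square algebra_simps)
  \<comment> \<open>Each numerator shares a linear factor with \<open>A ^ 2 - 1\<close>, which
    cancels in the quotient.\<close>
  have q1: "qnum x m + 1 = (A - 1) * (A + x ^ 2) / (A * (x ^ 2 - 1))"
    and q2: "qnum x m - 1 = (A + 1) * (A - x ^ 2) / (A * (x ^ 2 - 1))"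
    unfolding q using A x2 by (simp_all add: field_simps power2_eq_square)
  have nz: "A - 1 \<noteq> 0" "A + 1 \<noteq> 0" "A \<noteq> 0" "x ^ 2 - 1 \<noteq> 0" "x \<noteq> 0"
    using A less_imp_neq[OF x2] assms by auto
  show "(qnum x m + 1) / qnum x (Suc m) = (x ^ Suc m + x ^ 2) / (x * (x ^ Suc m + 1))"
    "(qnum x m - 1) / qnum x (Suc m) = (x ^ Suc m - x ^ 2) / (x * (x ^ Suc m - 1))"
    unfolding q1 q2 Q A_def[symmetric] A2 using nz by (simp_all add: divide_simps)
  show "qnum x (Suc m) = ((x ^ Suc m) ^ 2 - 1) * x / (x ^ Suc m * (x ^ 2 - 1))"
    using Q by (simp add: A_def)
qed

text \<open>The graph has \<open>m1 + m2 + m3 + 2\<close> vertices. The prefactor clears every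
  denominator of the three values of \<open>qnum\<close> except \<open>(x - 1) ^ 2\<close>, which
  the determinant on \<open>[u, v]\<close> compensates.\<close>

lemma qnum_product:
  assumes x: "1 < x"
  shows "(x - 1) * (x + 1) ^ 3 * x ^ (m1 + m2 + m3 + 2) * (qnum x (Suc m1) * qnum x (Suc m2) * qnum x (Suc m3)) =
    ((x ^ Suc m1) ^ 2 - 1) * ((x ^ Suc m2) ^ 2 - 1) * ((x ^ Suc m3) ^ 2 - 1) * x ^ 2 / (x - 1) ^ 2"
proof -
  define A B C where A: "A = x ^ Suc m1" and B: "B = x ^ Suc m2" and C: "C = x ^ Suc m3"
  have nz: "A \<noteq> 0" "B \<noteq> 0" "C \<noteq> 0" "x \<noteq> 0" "x - 1 \<noteq> 0" "x + 1 \<noteq> 0"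
    using x by (auto simp: A B C)
  have n: "x ^ (m1 + m2 + m3 + 2) = A * B * C / x"
    using x by (simp add: A B C power_add power2_eq_square)
  have x2: "x ^ 2 - 1 = (x - 1) * (x + 1)"
    by (simp add: power2_eq_square algebra_simps)
  have "(x - 1) * (x + 1) ^ 3 * (A * B * C / x) *
     (a * x / (A * ((x - 1) * (x + 1))) * (b * x / (B * ((x - 1) * (x + 1)))) * (c * x / (C * ((x - 1) * (x + 1))))) =
     a * b * c * x ^ 2 / (x - 1) ^ 2" for a b c
    using nz by (simp add: divide_simps) (simp add: power2_eq_square power3_eq_cube)
  then show ?thesis
    unfolding qnum_quotients(3)[OF x] n A[symmetric] B[symmetric] C[symmetric] x2 .
qed

text \<open>The matrix left on \<open>[u, v]\<close> has diagonal
  \<open>\<alpha> - \<gamma>\<close>, \<open>\<beta> - \<gamma>\<close> and off-diagonal entries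
  \<open>- \<delta>\<close>: each cycle contributes only to its own branching vertex, the connecting
  path to both.\<close>

lemma det_dumbbell:
  assumes x: "1 < x" and d: "distinct (ys1 @ ys2 @ ys3 @ [u, v])"
    and g: "\<And>a b. g a b = (x + inverse x) * of_bool (a = b \<and> a \<in> set (ys1 @ ys2 @ ys3)) +
      (x + inverse x + 1) * of_bool (a = b \<and> a \<in> {u, v}) -
      path_weight (u # ys1 @ [u]) a b - path_weight (v # ys2 @ [v]) a b - path_weight (u # ys3 @ [v]) a b"
  shows "dumbbell_poly (Suc (length ys1)) (Suc (length ys2)) (length ys3) x =
    (x - 1) * (x + 1) ^ 3 * x ^ (length ys1 + length ys2 + length ys3 + 2) *
    det (list_mat g (ys1 @ ys2 @ ys3 @ [u, v]))"
proof -
  let ?m1 = "length ys1" and ?m2 = "length ys2" and ?m3 = "length ys3"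
  define A B C where A: "A = x ^ Suc ?m1" and B: "B = x ^ Suc ?m2" and C: "C = x ^ Suc ?m3"
  have gt: "1 < A" "1 < B" "1 < C"
    unfolding A B C using x by (intro one_less_power; simp)+
  define P1 P2 P3 where P: "P1 = qnum x (Suc ?m1)" "P2 = qnum x (Suc ?m2)" "P3 = qnum x (Suc ?m3)"
  have pos: "0 < P1" "0 < P2" "0 < P3"
    using qnum_pos[OF x] by (simp_all add: P)
  have uv: "u \<noteq> v"
    using d by auto
  define \<alpha> where "\<alpha> = x + inverse x + 1 - 2 * ((qnum x ?m1 + 1) / P1)"
  define \<beta> where "\<beta> = x + inverse x + 1 - 2 * ((qnum x ?m2 + 1) / P2)"
  define \<gamma> where "\<gamma> = qnum x ?m3 / P3"
  define \<delta> where "\<delta> = 1 / P3"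
  have "det (list_mat g (ys1 @ ys2 @ ys3 @ [u, v])) = P1 * P2 * P3 * ((\<alpha> - \<gamma>) * (\<beta> - \<gamma>) - \<delta> * \<delta>)"
    unfolding P
    by (subst det_three_paths[OF x d _ g])
      (use uv in \<open>auto simp: det_list_mat_two path_correction_def edge_weight_def \<alpha>_def \<beta>_def \<gamma>_def \<delta>_def P
         add_divide_distrib algebra_simps\<close>)
  \<comment> \<open>The combinations \<open>\<gamma> + \<delta>\<close> and
    \<open>\<gamma> - \<delta>\<close> are the quotients with closed forms in
    \<open>qnum_quotients\<close>.\<close>
  also have "(\<alpha> - \<gamma>) * (\<beta> - \<gamma>) - \<delta> * \<delta> = \<alpha> * \<beta> - (\<alpha> + \<beta>) * (((\<gamma> + \<delta>) + (\<gamma> - \<delta>)) / 2) + (\<gamma> + \<delta>) * (\<gamma> - \<delta>)"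
    by (simp add: field_simps)
  also have "\<gamma> + \<delta> = (C + x ^ 2) / (x * (C + 1))"
    using qnum_quotients(1)[OF x, of ?m3] by (simp add: \<gamma>_def \<delta>_def P C add_divide_distrib)
  also have "\<gamma> - \<delta> = (C - x ^ 2) / (x * (C - 1))"
    using qnum_quotients(2)[OF x, of ?m3] by (simp add: \<gamma>_def \<delta>_def P C diff_divide_distrib)
  also have "\<alpha> = ((x ^ 2 + x - 1) * A - x ^ 2 + x + 1) / (x * (A + 1))"
    unfolding \<alpha>_def P qnum_quotients(1)[OF x] A[symmetric] using gt x
    by (simp add: divide_simps) (simp add: power2_eq_square algebra_simps)
  also have "\<beta> = ((x ^ 2 + x - 1) * B - x ^ 2 + x + 1) / (x * (B + 1))"
    unfolding \<beta>_def P qnum_quotients(1)[OF x] B[symmetric] using gt x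
    by (simp add: divide_simps) (simp add: power2_eq_square algebra_simps)
  finally have det: "det (list_mat g (ys1 @ ys2 @ ys3 @ [u, v])) =
    P1 * P2 * P3 *
    (((x ^ 2 + x - 1) * A - x ^ 2 + x + 1) / (x * (A + 1)) * (((x ^ 2 + x - 1) * B - x ^ 2 + x + 1) / (x * (B + 1)))
     - (((x ^ 2 + x - 1) * A - x ^ 2 + x + 1) / (x * (A + 1)) + ((x ^ 2 + x - 1) * B - x ^ 2 + x + 1) / (x * (B + 1)))
       * (((C + x ^ 2) / (x * (C + 1)) + (C - x ^ 2) / (x * (C - 1))) / 2)
     + (C + x ^ 2) / (x * (C + 1)) * ((C - x ^ 2) / (x * (C - 1))))" (is "_ = _ * ?E") .
  have E: "(x ^ 2 * (A + 1) * (B + 1) * (C + 1) * (C - 1)) * ?E =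
    ((x ^ 2 + x - 1) * A - x ^ 2 + x + 1) * ((x ^ 2 + x - 1) * B - x ^ 2 + x + 1) * (C ^ 2 - 1)
    - (((x ^ 2 + x - 1) * A - x ^ 2 + x + 1) * (B + 1) + ((x ^ 2 + x - 1) * B - x ^ 2 + x + 1) * (A + 1)) * (C ^ 2 - x ^ 2)
    + (C ^ 2 - x ^ 4) * (A + 1) * (B + 1)"
  proof -
    \<comment> \<open>Only the denominators matter here, so the numerators of
      \<open>\<alpha>\<close> and \<open>\<beta>\<close> are replaced by arbitrary \<open>a\<close>
      and \<open>b\<close>.\<close>
    have "(x ^ 2 * (A + 1) * (B + 1) * (C + 1) * (C - 1)) *
      (a / (x * (A + 1)) * (b / (x * (B + 1)))
       - (a / (x * (A + 1)) + b / (x * (B + 1))) * (((C + x ^ 2) / (x * (C + 1)) + (C - x ^ 2) / (x * (C - 1))) / 2)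
       + (C + x ^ 2) / (x * (C + 1)) * ((C - x ^ 2) / (x * (C - 1)))) =
      a * b * (C ^ 2 - 1) - (a * (B + 1) + b * (A + 1)) * (C ^ 2 - x ^ 2) + (C ^ 2 - x ^ 4) * (A + 1) * (B + 1)"
      for a b
    proof -
      have 1: "(C + x ^ 2) / (x * (C + 1)) + (C - x ^ 2) / (x * (C - 1)) = 2 * (C ^ 2 - x ^ 2) / (x * ((C + 1) * (C - 1)))"
        using gt x by (simp add: divide_simps) (simp add: power2_eq_square algebra_simps)
      have 2: "(C + x ^ 2) / (x * (C + 1)) * ((C - x ^ 2) / (x * (C - 1))) = (C ^ 2 - x ^ 4) / (x ^ 2 * ((C + 1) * (C - 1)))"
        by (simp add: power2_eq_square power4_eq_xxxx algebra_simps)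
      have 3: "C ^ 2 - 1 = (C + 1) * (C - 1)"
        by (simp add: power2_eq_square algebra_simps)
      have "C + 1 \<noteq> 0" "C - 1 \<noteq> 0" "A + 1 \<noteq> 0" "B + 1 \<noteq> 0" "x \<noteq> 0"
        using gt x by auto
      then show ?thesis
        unfolding 1 2 3
        by (simp add: divide_simps) (simp add: power2_eq_square algebra_simps)
    qed
    then show ?thesis .
  qed
  have PP: "(x - 1) * (x + 1) ^ 3 * x ^ (?m1 + ?m2 + ?m3 + 2) * (P1 * P2 * P3) =
      (A ^ 2 - 1) * (B ^ 2 - 1) * (C ^ 2 - 1) * x ^ 2 / (x - 1) ^ 2"
    unfolding P A B C by (rule qnum_product[OF x])
  have "dumbbell_poly (Suc ?m1) (Suc ?m2) ?m3 x = (A - 1) * (B - 1) *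
      (C ^ 2 * ((x + 2) * A - x) * ((x + 2) * B - x) - (A - 2 * x - 1) * (B - 2 * x - 1))"
  proof -
    have "x ^ (2 * ?m3 + 2) = x ^ (Suc ?m3 * 2)"
      by (simp add: mult.commute)
    also have "\<dots> = C ^ 2"
      unfolding C by (rule power_mult)
    finally show ?thesis
      by (simp only: dumbbell_poly_def A B)
  qed
  also have "\<dots> = (A - 1) * (B - 1) / (x - 1) ^ 2 * ((x ^ 2 * (A + 1) * (B + 1) * (C + 1) * (C - 1)) * ?E)"
    unfolding E using x by (simp add: divide_simps) (simp add: power2_eq_square power4_eq_xxxx algebra_simps)
  also have "\<dots> = (A ^ 2 - 1) * (B ^ 2 - 1) * (C ^ 2 - 1) * x ^ 2 / (x - 1) ^ 2 * ?E"
  proof -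
    have sq: "y ^ 2 - 1 = (y + 1) * (y - 1)" for y :: real
      by (simp add: power2_eq_square algebra_simps)
    have "(A - 1) * (B - 1) / (x - 1) ^ 2 * ((x ^ 2 * (A + 1) * (B + 1) * (C + 1) * (C - 1)) * e)
        = (A ^ 2 - 1) * (B ^ 2 - 1) * (C ^ 2 - 1) * x ^ 2 / (x - 1) ^ 2 * e" for e
      unfolding sq by simp
    then show ?thesis .
  qed
  finally show ?thesis
    unfolding det PP[symmetric] by (simp only: mult.assoc)
qed

text \<open>Interchanging \<open>u\<close> and \<open>v\<close> fixes the matrix left on
  \<open>[u, v]\<close>, so its eigenvectors are \<open>(1, 1)\<close> and \<open>(1, -1)\<close>.
  The eigenvalues \<open>U\<close> and \<open>V\<close> give the two factors of
  \<open>theta_poly\<close>.\<close>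

lemma det_theta:
  assumes x: "1 < x" and d: "distinct (ys1 @ ys2 @ ys3 @ [u, v])"
    and g: "\<And>a b. g a b = (x + inverse x) * of_bool (a = b \<and> a \<in> set (ys1 @ ys2 @ ys3)) +
      (x + inverse x + 1) * of_bool (a = b \<and> a \<in> {u, v}) -
      path_weight (u # ys1 @ [v]) a b - path_weight (u # ys2 @ [v]) a b - path_weight (u # ys3 @ [v]) a b"
  shows "theta_poly (Suc (length ys1)) (Suc (length ys2)) (Suc (length ys3)) x =
    (x - 1) * (x + 1) ^ 3 * x ^ (length ys1 + length ys2 + length ys3 + 2) *
    det (list_mat g (ys1 @ ys2 @ ys3 @ [u, v]))"
proof -
  let ?m1 = "length ys1" and ?m2 = "length ys2" and ?m3 = "length ys3"
  define A B C where A: "A = x ^ Suc ?m1" and B: "B = x ^ Suc ?m2" and C: "C = x ^ Suc ?m3"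
  have "1 < A" "1 < B" "1 < C"
    unfolding A B C using x by (intro one_less_power; simp)+
  then have nz: "A + 1 \<noteq> 0" "B + 1 \<noteq> 0" "C + 1 \<noteq> 0" "A - 1 \<noteq> 0" "B - 1 \<noteq> 0" "C - 1 \<noteq> 0" "x \<noteq> 0" "x - 1 \<noteq> 0"
    using x by auto
  define P1 P2 P3 where P: "P1 = qnum x (Suc ?m1)" "P2 = qnum x (Suc ?m2)" "P3 = qnum x (Suc ?m3)"
  have uv: "u \<noteq> v"
    using d by auto
  define U where "U = x + inverse x + 1 - (qnum x ?m1 + 1) / P1 - (qnum x ?m2 + 1) / P2 - (qnum x ?m3 + 1) / P3"
  define V where "V = x + inverse x + 1 - (qnum x ?m1 - 1) / P1 - (qnum x ?m2 - 1) / P2 - (qnum x ?m3 - 1) / P3"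
  define S where "S = (x + 2) * (A + 1) * (B + 1) * (C + 1) - (x + 1) *
       ((A + 1) * (B + 1) + (B + 1) * (C + 1) + (C + 1) * (A + 1))"
  define T where "T = (x + 2) * (A - 1) * (B - 1) * (C - 1) + (x + 1) *
       ((A - 1) * (B - 1) + (B - 1) * (C - 1) + (C - 1) * (A - 1))"
  have "det (list_mat g (ys1 @ ys2 @ ys3 @ [u, v])) = P1 * P2 * P3 * (U * V)"
    unfolding P
    by (subst det_three_paths[OF x d _ g])
      (use uv in \<open>auto simp: det_list_mat_two path_correction_def edge_weight_def U_def V_def P
         add_divide_distrib diff_divide_distrib algebra_simps\<close>)
  also have "U = (x - 1) * S / (x * ((A + 1) * (B + 1) * (C + 1)))"
    unfolding U_def P qnum_quotients(1)[OF x] A[symmetric] B[symmetric] C[symmetric] S_def using nz(1-3,7)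
    by (simp add: divide_simps) (simp add: power2_eq_square algebra_simps)
  also have "V = (x - 1) * T / (x * ((A - 1) * (B - 1) * (C - 1)))"
    unfolding V_def P qnum_quotients(2)[OF x] A[symmetric] B[symmetric] C[symmetric] T_def using nz(4-7)
    by (simp add: divide_simps) (simp add: power2_eq_square algebra_simps)
  finally have det: "det (list_mat g (ys1 @ ys2 @ ys3 @ [u, v])) = P1 * P2 * P3 *
    ((x - 1) * S / (x * ((A + 1) * (B + 1) * (C + 1))) * ((x - 1) * T / (x * ((A - 1) * (B - 1) * (C - 1)))))"
    (is "_ = _ * ?E") .
  have PP: "(x - 1) * (x + 1) ^ 3 * x ^ (?m1 + ?m2 + ?m3 + 2) * (P1 * P2 * P3) =
      (A ^ 2 - 1) * (B ^ 2 - 1) * (C ^ 2 - 1) * x ^ 2 / (x - 1) ^ 2"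
    unfolding P A B C by (rule qnum_product[OF x])
  have sq: "y ^ 2 - 1 = (y + 1) * (y - 1)" for y :: real
    by (simp add: power2_eq_square algebra_simps)
  have "theta_poly (Suc ?m1) (Suc ?m2) (Suc ?m3) x = S * T"
    unfolding theta_poly_def S_def T_def A B C ..
  also have "\<dots> = (A ^ 2 - 1) * (B ^ 2 - 1) * (C ^ 2 - 1) * x ^ 2 / (x - 1) ^ 2 * ?E"
    unfolding sq using nz by (simp add: divide_simps) (simp add: power2_eq_square)
  finally show ?thesis
    unfolding det PP[symmetric] by (simp only: mult.assoc)
qed

section \<open>Graphs with two vertices of degree three\<close>


lemma edge_weight_left: "c \<noteq> d \<Longrightarrow> edge_weight c d c b = of_bool (b = d)"
  by (simp add: edge_weight_def)

lemma edge_weight_right: "c \<noteq> d \<Longrightarrow> edge_weight c d d b = of_bool (b = c)"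
  by (simp add: edge_weight_def)

lemma of_bool_add_exclusive:
  "\<not> (P \<and> Q) \<Longrightarrow> of_bool P + of_bool Q = (of_bool (P \<or> Q) :: real)"
  by (cases P; cases Q) simp_all

lemma edge_weight_nonneg: "0 \<le> edge_weight c d a b"
  by (simp add: edge_weight_def)

lemma path_weight_nonneg: "0 \<le> path_weight zs a b"
  by (induction zs a b rule: path_weight.induct) (simp_all add: edge_weight_nonneg)

lemma path_weight_append:
  "path_weight (xs @ c # zs) a b = path_weight (xs @ [c]) a b + path_weight (c # zs) a b"
proof (induction xs)
  case (Cons d xs)
  then show ?case
    by (cases xs) simp_all
qed simp

lemma path_weight_consecutive_pos: "0 < path_weight (xs @ c # d # zs) d c"
proof -
  have "path_weight (xs @ c # d # zs) d c =
      path_weight (xs @ [c]) d c + (edge_weight c d d c + path_weight (d # zs) d c)"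
    by (subst path_weight_append) simp
  moreover have "1 \<le> edge_weight c d d c"
    by (simp add: edge_weight_def)
  ultimately show ?thesis
    using path_weight_nonneg[of "xs @ [c]" d c] path_weight_nonneg[of "d # zs" d c] by linarith
qed

lemma path_weight_last:
  assumes "z \<notin> set (s # zs)"
  shows "path_weight (s # zs @ [z]) z b = of_bool (b = last (s # zs))"
proof -
  have "path_weight ((s # zs) @ [z]) z b = path_weight (s # zs) z b + edge_weight (last (s # zs)) z z b"
    by (rule path_weight_snoc) simp
  moreover have "path_weight (s # zs) z b = 0"
    using assms by (intro path_weight_eq_0) simp
  moreover have "last (s # zs) \<noteq> z"
    using assms last_in_set[of "s # zs"] by (metis list.distinct(1))
  ultimately show ?thesis
    by (simp add: edge_weight_right)
qed

lemma path_weight_ends: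
  assumes "ys \<noteq> []"
  shows "path_weight (s # ys @ [t]) a b =
    edge_weight s (hd ys) a b + path_weight ys a b + edge_weight (last ys) t a b"
  using assms path_weight_snoc[of ys t a b] path_weight_Cons[of "ys @ [t]" s a b]
  by simp

text \<open>The shape of a cospectral graph once its degrees and its connectedness are known.
  Connectedness is stated through closed vertex sets, since a proper closed set is what produces a
  second zero eigenvalue.\<close>

locale two_branch_graph =
  fixes V :: "'a set" and E :: "'a \<Rightarrow> 'a \<Rightarrow> bool" and u v :: 'a
  assumes finite_V: "finite V"
    and E_in_V: "E a b \<Longrightarrow> a \<in> V \<and> b \<in> V"
    and E_sym: "E a b \<Longrightarrow> E b a"
    and E_irrefl: "\<not> E a a"
    and branch: "u \<in> V" "v \<in> V" "u \<noteq> v"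
    and degree_two: "a \<in> V \<Longrightarrow> a \<notin> {u, v} \<Longrightarrow> card {b. E a b} = 2"
    and degree_three: "card {b. E u b} = 3" "card {b. E v b} = 3"
    and connected: "S \<subseteq> V \<Longrightarrow> S \<noteq> {} \<Longrightarrow> (\<And>a b. a \<in> S \<Longrightarrow> E a b \<Longrightarrow> b \<in> S) \<Longrightarrow> S = V"
begin

text \<open>The list \<open>ys\<close> holds the inner vertices, and \<open>s = t\<close> is
  allowed, for a cycle. The last condition makes the walk account for every neighbour of an inner
  vertex. For an empty \<open>ys\<close> the two edge conditions say that \<open>s\<close> and
  \<open>t\<close> are adjacent.\<close>

definition branch_path :: "'a \<Rightarrow> 'a list \<Rightarrow> 'a \<Rightarrow> bool" where
  "branch_path s ys t \<longleftrightarrow> s \<in> {u, v} \<and> t \<in> {u, v} \<and> distinct ys \<and> set ys \<subseteq> V - {u, v} \<and>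
     E (last (s # ys)) t \<and> E s (hd (ys @ [t])) \<and>
     (\<forall>a\<in>set ys. \<forall>b. path_weight (s # ys @ [t]) a b = of_bool (E a b))"

lemma branch_pathD:
  assumes "branch_path s ys t"
  shows "s \<in> {u, v}" "t \<in> {u, v}" "distinct ys" "set ys \<subseteq> V - {u, v}" "E (last (s # ys)) t"
    "E s (hd (ys @ [t]))" "\<And>a b. a \<in> set ys \<Longrightarrow> path_weight (s # ys @ [t]) a b = of_bool (E a b)"
  using assms unfolding branch_path_def by blast+

lemma two_neighbours:
  assumes "z \<in> V" "z \<notin> {u, v}" "E p z"
  obtains c where "c \<noteq> p" "\<And>b. E z b \<longleftrightarrow> b = p \<or> b = c"
proof -
  obtain x y where xy: "{b. E z b} = {x, y}" "x \<noteq> y"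
    using degree_two[OF assms(1,2)] by (auto simp: card_2_iff)
  have "p \<in> {b. E z b}"
    using E_sym[OF assms(3)] by simp
  then have "p = x \<or> p = y"
    unfolding xy by blast
  then show thesis
  proof
    assume "p = x"
    show thesis
      by (rule that[of y]) (use xy \<open>p = x\<close> in blast)+
  next
    assume "p = y"
    show thesis
      by (rule that[of x]) (use xy \<open>p = y\<close> in blast)+
  qed
qed

text \<open>The path is followed away from \<open>s\<close>: as \<open>z\<close> has degree two, its
  neighbour \<open>c\<close> other than its predecessor is forced. Either \<open>c\<close> is a
  branching vertex and the path ends, or it is a new vertex and the path grows; finiteness of
  \<open>V\<close> bounds the length.\<close>

lemma branch_path_extend:
  assumes "s \<in> {u, v}" "distinct (zs @ [z])" "set (zs @ [z]) \<subseteq> V - {u, v}" "E (last (s # zs)) z"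
    and "E s (hd (zs @ [z]))"
    and "\<And>a b. a \<in> set zs \<Longrightarrow> path_weight (s # zs @ [z]) a b = of_bool (E a b)"
  shows "\<exists>ys t. branch_path s (zs @ z # ys) t"
  using assms(2-)
proof (induction "card V - length zs" arbitrary: zs z rule: less_induct)
  case less
  let ?p = "last (s # zs)"
  have z: "z \<in> V" "z \<notin> {u, v}" "z \<notin> set (s # zs)"
    using less.prems assms(1) by auto
  obtain c where c: "c \<noteq> ?p" "\<And>b. E z b \<longleftrightarrow> b = ?p \<or> b = c"
    using two_neighbours[OF z(1,2) less.prems(3)] by blast
  have zc: "z \<noteq> c"
    using c(2) E_irrefl by blast
  \<comment> \<open>The walk records every neighbour of a vertex in \<open>zs\<close>, and it joins
    \<open>z\<close> only to its predecessor.\<close>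
  have cz: "c \<notin> set zs"
  proof
    assume "c \<in> set zs"
    then have "path_weight (s # zs @ [z]) c z = of_bool (E c z)"
      by (rule less.prems(5))
    moreover have "E c z"
      using c(2) E_sym by blast
    moreover have "path_weight (s # zs @ [z]) c z = of_bool (c = ?p)"
      using path_weight_last[OF z(3), of c] path_weight_commute[of "s # zs @ [z]" c z] by simp
    ultimately show False
      using c(1) by simp
  qed
  have pw: "path_weight (s # (zs @ [z]) @ [c]) a b = of_bool (E a b)" if "a \<in> set (zs @ [z])" for a b
  proof -
    have split: "path_weight (s # (zs @ [z]) @ [c]) a b =
        path_weight (s # zs @ [z]) a b + edge_weight z c a b"
      using path_weight_snoc[of "s # zs @ [z]" c a b] by simp
    show ?thesis
    proof (cases "a = z")
      case True
      show ?thesis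
        unfolding split unfolding True path_weight_last[OF z(3)] edge_weight_left[OF zc] c(2)
        by (rule of_bool_add_exclusive) (use c(1) in simp)
    next
      case False
      then have "a \<in> set zs"
        using that by simp
      moreover have "edge_weight z c a b = 0"
        using False \<open>a \<in> set zs\<close> cz by (intro edge_weight_eq_0) blast
      ultimately show ?thesis
        unfolding split using less.prems(5) by simp
    qed
  qed
  have Ezc: "E z c"
    using c(2) by blast
  show ?case
  proof (cases "c \<in> {u, v}")
    case True
    have "branch_path s (zs @ [z]) c"
      unfolding branch_path_def
    proof (intro conjI ballI allI)
      show "E (last (s # zs @ [z])) c"
        using Ezc by simp
      show "E s (hd ((zs @ [z]) @ [c]))"
        using less.prems(4) by (cases zs) auto
    qed (use assms(1) True less.prems pw in auto)
    then show ?thesis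
      by blast
  next
    case False
    have cV: "c \<in> V"
      using E_in_V[OF Ezc] by blast
    have "length (zs @ [z]) \<le> card V"
      using less.prems(1,2) finite_V by (metis Diff_subset card_mono distinct_card order_trans)
    then have "card V - length (zs @ [z]) < card V - length zs"
      by simp
    then have "\<exists>ys t. branch_path s ((zs @ [z]) @ c # ys) t"
    proof (rule less.hyps)
      show "distinct ((zs @ [z]) @ [c])"
        using less.prems(1) cz zc by simp
      show "set ((zs @ [z]) @ [c]) \<subseteq> V - {u, v}"
        using less.prems(2) False cV by simp
      show "E (last (s # zs @ [z])) c"
        using Ezc by simp
      show "E s (hd ((zs @ [z]) @ [c]))"
        using less.prems(4) by (cases zs) auto
    qed (use pw in simp)
    then obtain ys t where "branch_path s ((zs @ [z]) @ c # ys) t"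
      by blast
    then have "branch_path s (zs @ z # (c # ys)) t"
      by simp
    then show ?thesis
      by blast
  qed
qed

lemma branch_path_from:
  assumes "s \<in> {u, v}" "E s y"
  obtains ys t where "branch_path s ys t" "hd (ys @ [t]) = y"
proof (cases "y \<in> {u, v}")
  case True
  have "branch_path s [] y"
    using assms True by (simp add: branch_path_def)
  then show thesis
    using that[of "[]" y] by simp
next
  case False
  have "y \<in> V"
    using E_in_V[OF assms(2)] by blast
  then have "\<exists>ys t. branch_path s ([] @ y # ys) t"
    using assms False by (intro branch_path_extend) auto
  then obtain ys t where "branch_path s (y # ys) t"
    by auto
  then show thesis
    using that[of "y # ys" t] by simp
qed

section \<open>How branch paths meet the branching vertices and each other\<close>

lemma branch_path_closed:
  assumes "branch_path s ys t" "a \<in> set ys" "E a b"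
  shows "b \<in> set ys \<union> {s, t}"
proof (rule ccontr)
  assume "b \<notin> set ys \<union> {s, t}"
  then have "path_weight (s # ys @ [t]) a b = 0"
    by (intro path_weight_eq_0) simp
  then show False
    using branch_pathD(7)[OF assms(1,2), of b] assms(3) by simp
qed

lemma branch_path_end_neighbour:
  assumes "branch_path s ys t" "a \<in> set ys" "E a w" "w \<in> {u, v}"
  shows "a = hd ys \<and> w = s \<or> a = last ys \<and> w = t"
proof (rule ccontr)
  assume n: "\<not> (a = hd ys \<and> w = s \<or> a = last ys \<and> w = t)"
  have ys: "ys \<noteq> []"
    using assms(2) by auto
  note p = branch_pathD[OF assms(1)]
  have "a \<noteq> s" "a \<noteq> t" "w \<notin> set ys" "w \<noteq> hd ys" "w \<noteq> last ys"
    using p(1,2,4) assms(2,4) hd_in_set[OF ys] last_in_set[OF ys] by blast+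
  then have "edge_weight s (hd ys) a w = 0" "edge_weight (last ys) t a w = 0" "path_weight ys a w = 0"
    using n by (simp_all add: edge_weight_def path_weight_eq_0)
  then have "path_weight (s # ys @ [t]) a w = 0"
    by (simp add: path_weight_ends[OF ys])
  then show False
    using p(7)[OF assms(2), of w] assms(3) by simp
qed

text \<open>With no inner vertex the cycle would be a loop; with a single one it would use an edge
  twice and give an entry 2. A simple graph excludes both.\<close>

lemma branch_path_ends_distinct:
  assumes "branch_path s ys s"
  shows "ys \<noteq> []" "hd ys \<noteq> last ys"
proof -
  note p = branch_pathD[OF assms]
  show ys: "ys \<noteq> []"
    using p(6) E_irrefl by auto
  show "hd ys \<noteq> last ys"
  proof
    assume eq: "hd ys = last ys"
    let ?a = "hd ys"
    have a: "?a \<in> set ys" "?a \<noteq> s"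
      using ys p(1,4) hd_in_set[OF ys] by blast+
    have "path_weight (s # ys @ [s]) ?a s = 1 + path_weight ys ?a s + 1"
      unfolding path_weight_ends[OF ys] eq[symmetric] using a by (simp add: edge_weight_def)
    moreover have "path_weight (s # ys @ [s]) ?a s \<le> 1"
      using p(7)[OF a(1), of s] by simp
    ultimately show False
      using path_weight_nonneg[of ys ?a s] by simp
  qed
qed

text \<open>At the first vertex of \<open>ys2\<close> that lies on \<open>ys1\<close>, its
  predecessor is an inner vertex of the second path by the condition on the head. As a neighbour of
  an inner vertex of the first path it lies on \<open>ys1\<close>, against minimality, or is a
  branching vertex, which inner vertices are not.\<close>

lemma branch_path_disjoint:
  assumes 1: "branch_path s1 ys1 t1" and 2: "branch_path s2 ys2 t2"
    and hd: "hd (ys2 @ [t2]) \<notin> set ys1"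
  shows "set ys1 \<inter> set ys2 = {}"
proof (rule ccontr)
  assume "set ys1 \<inter> set ys2 \<noteq> {}"
  then have "\<exists>a\<in>set ys2. a \<in> set ys1"
    by blast
  then obtain us a ws where us: "ys2 = us @ a # ws" "a \<in> set ys1" "\<forall>b\<in>set us. b \<notin> set ys1"
    using split_list_first_prop[of ys2 "\<lambda>a. a \<in> set ys1"] by blast
  have "us \<noteq> []"
    using hd us by auto
  then obtain us' p where us': "us = us' @ [p]"
    by (cases us rule: rev_cases) auto
  have "0 < path_weight ((s2 # us') @ p # a # ws @ [t2]) a p"
    by (rule path_weight_consecutive_pos)
  then have "0 < path_weight (s2 # ys2 @ [t2]) a p"
    by (simp add: us us')
  moreover have a2: "a \<in> set ys2"
    using us by simp
  ultimately have "E a p"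
    using branch_pathD(7)[OF 2 a2, of p] by (cases "E a p") auto
  then have "p \<in> set ys1 \<union> {s1, t1}"
    by (rule branch_path_closed[OF 1 us(2)])
  moreover have "p \<notin> set ys1"
    using us(3) us' by simp
  moreover have "p \<notin> {u, v}"
    using branch_pathD(4)[OF 2] us us' by auto
  ultimately show False
    using branch_pathD(1,2)[OF 1] by blast
qed

lemma branch_path_weight_ends:
  assumes "branch_path s ys t" "a \<in> {u, v}" "b \<in> {u, v}"
  shows "path_weight (s # ys @ [t]) a b = (if ys = [] then edge_weight s t a b else 0)"
proof (cases "ys = []")
  case False
  have "a \<notin> set ys" "b \<notin> set ys"
    using branch_pathD(4)[OF assms(1)] assms by blast+
  moreover from this have "a \<noteq> hd ys" "b \<noteq> hd ys" "a \<noteq> last ys" "b \<noteq> last ys"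
    using False by force+
  ultimately show ?thesis
    using False by (simp add: path_weight_ends path_weight_eq_0 edge_weight_def)
qed simp

text \<open>The vertices of the three paths form a closed set, hence all of \<open>V\<close>. The
  row of an inner vertex is accounted for by its own path alone, so only the entries among
  \<open>u\<close> and \<open>v\<close> remain, which \<open>uv\<close> and \<open>loops\<close>
  supply.\<close>

lemma three_paths_cover:
  assumes b: "branch_path s1 ys1 t1" "branch_path s2 ys2 t2" "branch_path s3 ys3 t3"
    and disj: "set ys1 \<inter> set ys2 = {}" "set ys1 \<inter> set ys3 = {}" "set ys2 \<inter> set ys3 = {}"
    and u: "\<And>a. E u a \<Longrightarrow> a \<in> set ys1 \<union> set ys2 \<union> set ys3 \<union> {u, v}"
    and v: "\<And>a. E v a \<Longrightarrow> a \<in> set ys1 \<union> set ys2 \<union> set ys3 \<union> {u, v}"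
    and uv: "path_weight (s1 # ys1 @ [t1]) u v + path_weight (s2 # ys2 @ [t2]) u v +
      path_weight (s3 # ys3 @ [t3]) u v = of_bool (E u v)"
    and loops: "\<And>w. w \<in> {u, v} \<Longrightarrow> path_weight (s1 # ys1 @ [t1]) w w = 0 \<and>
      path_weight (s2 # ys2 @ [t2]) w w = 0 \<and> path_weight (s3 # ys3 @ [t3]) w w = 0"
  shows "distinct (ys1 @ ys2 @ ys3 @ [u, v])" "set (ys1 @ ys2 @ ys3 @ [u, v]) = V"
    "\<And>a b. a \<in> V \<Longrightarrow> b \<in> V \<Longrightarrow> of_bool (E a b) = path_weight (s1 # ys1 @ [t1]) a b +
      path_weight (s2 # ys2 @ [t2]) a b + path_weight (s3 # ys3 @ [t3]) a b"
proof -
  let ?W = "\<lambda>a b. path_weight (s1 # ys1 @ [t1]) a b +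
      path_weight (s2 # ys2 @ [t2]) a b + path_weight (s3 # ys3 @ [t3]) a b"
  let ?S = "set ys1 \<union> set ys2 \<union> set ys3 \<union> {u, v}"
  note p1 = branch_pathD[OF b(1)] and p2 = branch_pathD[OF b(2)] and p3 = branch_pathD[OF b(3)]
  have u_notin: "u \<notin> set ys1" "u \<notin> set ys2" "u \<notin> set ys3"
    and v_notin: "v \<notin> set ys1" "v \<notin> set ys2" "v \<notin> set ys3"
    using p1(4) p2(4) p3(4) by blast+
  show "distinct (ys1 @ ys2 @ ys3 @ [u, v])"
    using p1(3) p2(3) p3(3) disj branch(3) u_notin v_notin by auto
  have S: "?S = V"
  proof (rule connected)
    show "?S \<subseteq> V"
      using p1(4) p2(4) p3(4) branch by blast
    fix a c assume "a \<in> ?S" and E: "E a c"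
    then consider "a \<in> set ys1" | "a \<in> set ys2" | "a \<in> set ys3" | "a = u" | "a = v"
      by blast
    then show "c \<in> ?S"
    proof cases
      case 1
      then show ?thesis
        using branch_path_closed[OF b(1) _ E] p1(1,2) by blast
    next
      case 2
      then show ?thesis
        using branch_path_closed[OF b(2) _ E] p2(1,2) by blast
    next
      case 3
      then show ?thesis
        using branch_path_closed[OF b(3) _ E] p3(1,2) by blast
    qed (use u v E in blast)+
  qed simp
  then show "set (ys1 @ ys2 @ ys3 @ [u, v]) = V"
    by auto
  have sets: "set (s1 # ys1 @ [t1]) \<subseteq> set ys1 \<union> {u, v}" "set (s2 # ys2 @ [t2]) \<subseteq> set ys2 \<union> {u, v}"
    "set (s3 # ys3 @ [t3]) \<subseteq> set ys3 \<union> {u, v}"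
    using p1(1,2) p2(1,2) p3(1,2) by auto
  have interior: "?W a c = of_bool (E a c)" if a: "a \<in> ?S" "a \<notin> {u, v}" for a c
  proof -
    consider "a \<in> set ys1" | "a \<in> set ys2" | "a \<in> set ys3"
      using a by blast
    then show ?thesis
    proof cases
      case 1
      then have "path_weight (s2 # ys2 @ [t2]) a c = 0" "path_weight (s3 # ys3 @ [t3]) a c = 0"
        by (rule_tac path_weight_eq_0, use a(2) sets disj in blast)+
      then show ?thesis
        using p1(7)[OF 1] by simp
    next
      case 2
      then have "path_weight (s1 # ys1 @ [t1]) a c = 0" "path_weight (s3 # ys3 @ [t3]) a c = 0"
        by (rule_tac path_weight_eq_0, use a(2) sets disj in blast)+
      then show ?thesis
        using p2(7)[OF 2] by simp
    next
      case 3
      then have "path_weight (s1 # ys1 @ [t1]) a c = 0" "path_weight (s2 # ys2 @ [t2]) a c = 0"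
        by (rule_tac path_weight_eq_0, use a(2) sets disj in blast)+
      then show ?thesis
        using p3(7)[OF 3] by simp
    qed
  qed
  have commute: "?W a c = ?W c a" for a c
    using path_weight_commute[of "s1 # ys1 @ [t1]" a c] path_weight_commute[of "s2 # ys2 @ [t2]" a c]
      path_weight_commute[of "s3 # ys3 @ [t3]" a c] by argo
  have E_commute: "E a c \<longleftrightarrow> E c a" for a c
    using E_sym by blast
  show "of_bool (E a c) = ?W a c" if "a \<in> V" "c \<in> V" for a c
  proof (cases "a \<in> {u, v} \<and> c \<in> {u, v}")
    case True
    then consider "a = c" | "a = u" "c = v" | "a = v" "c = u"
      by blast
    then show ?thesis
    proof cases
      case 1
      then show ?thesis
        using loops[of a] True E_irrefl[of a] by simp
    next
      case 2
      then show ?thesis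
        using uv by simp
    next
      case 3
      then show ?thesis
        unfolding commute[of a] E_commute[of a] using uv by simp
    qed
  next
    case False
    then show ?thesis
      using interior[of a c] interior[of c a] that unfolding commute[of a c] E_commute[of a c] S by auto
  qed
qed

section \<open>Dumbbell or theta graph\<close>

lemma third_neighbour:
  assumes "card {b. E w b} = 3" "E w x" "E w y" "x \<noteq> y"
  obtains z where "z \<noteq> x" "z \<noteq> y" "\<And>b. E w b \<longleftrightarrow> b = x \<or> b = y \<or> b = z"
proof -
  obtain c d e where cde: "{b. E w b} = {c, d, e}" "c \<noteq> d" "c \<noteq> e" "d \<noteq> e"
    using assms(1) by (auto simp: card_3_iff)
  have iff: "E w b \<longleftrightarrow> b = c \<or> b = d \<or> b = e" for b
    using cde(1) by blast
  have "\<exists>z. z \<noteq> x \<and> z \<noteq> y \<and> {c, d, e} = {x, y, z}"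
    using assms(2-4) cde(2-4) unfolding iff by auto
  then obtain z where z: "z \<noteq> x" "z \<noteq> y" "{c, d, e} = {x, y, z}"
    by blast
  show thesis
  proof (rule that[OF z(1,2)])
    fix b
    have "E w b \<longleftrightarrow> b \<in> {c, d, e}"
      by (simp add: iff)
    then show "E w b \<longleftrightarrow> b = x \<or> b = y \<or> b = z"
      unfolding z(3) by simp
  qed
qed

text \<open>The cycle uses two neighbours of \<open>u\<close>. The path through the third must reach
  \<open>v\<close>, and then no edge at \<open>u\<close> is left for a path that leaves
  \<open>v\<close> in another direction; so that path returns to \<open>v\<close> and closes the
  second cycle.\<close>

lemma dumbbell_case:
  assumes b1: "branch_path u ys1 u"
  shows "\<exists>ys2 ys3. distinct (ys1 @ ys2 @ ys3 @ [u, v]) \<and> set (ys1 @ ys2 @ ys3 @ [u, v]) = V \<and>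
    (\<forall>a\<in>V. \<forall>b\<in>V. of_bool (E a b) = path_weight (u # ys1 @ [u]) a b +
      path_weight (v # ys2 @ [v]) a b + path_weight (u # ys3 @ [v]) a b)"
proof -
  note p1 = branch_pathD[OF b1]
  note ys1 = branch_path_ends_distinct[OF b1]
  have E1: "E u (hd ys1)" "E u (last ys1)"
    using p1(5,6) ys1(1) E_sym by auto
  have in1: "hd ys1 \<in> set ys1" "last ys1 \<in> set ys1"
    using ys1(1) by simp_all
  obtain w where w: "w \<noteq> hd ys1" "w \<noteq> last ys1" "\<And>b. E u b \<longleftrightarrow> b = hd ys1 \<or> b = last ys1 \<or> b = w"
    using third_neighbour[OF degree_three(1) E1 ys1(2)] by blast
  have Euw: "E u w"
    using w(3) by blast
  obtain ys3 t3 where b3: "branch_path u ys3 t3" "hd (ys3 @ [t3]) = w"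
    using branch_path_from[OF _ Euw] by blast
  have w1: "w \<notin> set ys1"
    using branch_path_end_neighbour[OF b1 _ E_sym[OF Euw]] w(1,2) by blast
  have d13: "set ys1 \<inter> set ys3 = {}"
    using branch_path_disjoint[OF b1 b3(1)] b3(2) w1 by simp
  \<comment> \<open>A return to \<open>u\<close> would give it a fourth neighbour, the last vertex
    of \<open>ys3\<close>.\<close>
  have "t3 \<noteq> u"
  proof
    assume t3: "t3 = u"
    note ys3 = branch_path_ends_distinct[OF b3(1)[unfolded t3]]
    have "E u (last ys3)"
      using branch_pathD(5)[OF b3(1)] ys3(1) t3 E_sym by auto
    moreover have "last ys3 \<in> set ys3" "hd ys3 = w"
      using ys3(1) b3(2) by simp_all
    ultimately show False
      using w(3) ys3(2) in1 d13 by auto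
  qed
  then have t3: "t3 = v"
    using branch_pathD(2)[OF b3(1)] by blast
  have p3: "branch_path u ys3 v"
    using b3(1) t3 by simp
  define y where "y = last (u # ys3)"
  have Evy: "E v y"
    using branch_pathD(5)[OF p3] E_sym by (simp add: y_def)
  have v3: "v \<notin> set ys3" "u \<notin> set ys3" and v1: "v \<notin> set ys1" "u \<notin> set ys1"
    using branch_pathD(4)[OF p3] p1(4) by blast+
  have empty3: "ys3 = [] \<longleftrightarrow> w = v"
  proof
    show "ys3 = []" if "w = v"
      using b3(2) that v3 hd_in_set[of ys3] by (cases ys3) auto
  qed (use b3(2) t3 in simp)
  have w3: "w \<in> set ys3 \<union> {v}"
    using b3(2) t3 by (cases ys3) auto
  have y3: "y \<in> set ys3 \<union> {u}"
    unfolding y_def by auto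
  obtain x z where "E v x" "x \<noteq> y" and z: "z \<noteq> y" "z \<noteq> x" "\<And>b. E v b \<longleftrightarrow> b = y \<or> b = x \<or> b = z"
  proof -
    have "\<exists>x. E v x \<and> x \<noteq> y"
    proof (rule ccontr)
      assume "\<nexists>x. E v x \<and> x \<noteq> y"
      then have "{b. E v b} \<subseteq> {y}"
        by blast
      then have "card {b. E v b} \<le> 1"
        using card_mono[of "{y}"] by fastforce
      then show False
        using degree_three(2) by simp
    qed
    then obtain x where x: "E v x" "x \<noteq> y"
      by blast
    then show thesis
      using third_neighbour[OF degree_three(2) Evy x(1)] that by metis
  qed
  obtain ys2 t2 where b2: "branch_path v ys2 t2" "hd (ys2 @ [t2]) = x"
    using branch_path_from[OF _ \<open>E v x\<close>] by blast
  have x1: "x \<notin> set ys1"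
    using branch_path_end_neighbour[OF b1 _ E_sym[OF \<open>E v x\<close>]] branch(3) by blast
  have x3: "x \<notin> set ys3"
  proof
    assume "x \<in> set ys3"
    then have "x = last ys3"
      using branch_path_end_neighbour[OF p3 _ E_sym[OF \<open>E v x\<close>]] branch(3) by blast
    moreover have "ys3 \<noteq> []"
      using \<open>x \<in> set ys3\<close> by auto
    ultimately show False
      using \<open>x \<noteq> y\<close> by (simp add: y_def)
  qed
  have d12: "set ys1 \<inter> set ys2 = {}"
    using branch_path_disjoint[OF b1 b2(1)] b2(2) x1 by simp
  have d32: "set ys3 \<inter> set ys2 = {}"
    using branch_path_disjoint[OF p3 b2(1)] b2(2) x3 by simp
  \<comment> \<open>If \<open>x = u\<close>, then \<open>u\<close> and \<open>v\<close> are
    adjacent, \<open>ys3\<close> is empty and \<open>y = u\<close>, contrary to the choice of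
    \<open>x\<close>.\<close>
  have "x \<noteq> u"
  proof
    assume "x = u"
    then have "v = w"
      using \<open>E v x\<close> E_sym w(3) in1 v1 by metis
    then show False
      using empty3 \<open>x = u\<close> \<open>x \<noteq> y\<close> by (simp add: y_def)
  qed
  have "x \<noteq> v"
    using \<open>E v x\<close> E_irrefl by blast
  have ys2: "ys2 \<noteq> []"
    using b2(2) branch_pathD(2)[OF b2(1)] \<open>x \<noteq> u\<close> \<open>x \<noteq> v\<close> by auto
  \<comment> \<open>A path ending at \<open>u\<close> would arrive from a neighbour of
    \<open>u\<close>, but these are the two ends of \<open>ys1\<close> and \<open>w\<close>, and
    \<open>w\<close> lies on \<open>ys3\<close> or is \<open>v\<close>.\<close>
  have "t2 \<noteq> u"
  proof
    assume "t2 = u"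
    then have "E u (last ys2)"
      using branch_pathD(5)[OF b2(1)] ys2 E_sym by auto
    moreover have l: "last ys2 \<in> set ys2"
      using ys2 by simp
    moreover have "last ys2 \<noteq> v"
      using l branch_pathD(4)[OF b2(1)] by blast
    ultimately show False
      using w(3) in1 d12 d32 w3 by auto
  qed
  then have p2: "branch_path v ys2 v"
    using b2(1) branch_pathD(2)[OF b2(1)] by auto
  note ys2' = branch_path_ends_distinct[OF p2]
  have E2: "E v (last ys2)"
    using branch_pathD(5)[OF p2] ys2 E_sym by auto
  have in2: "hd ys2 \<in> set ys2" "last ys2 \<in> set ys2" "hd ys2 = x"
    using ys2 b2(2) hd_in_set[OF ys2] by simp_all
  have u2: "u \<notin> set ys2"
    using branch_pathD(4)[OF p2] by blast
  have "last ys2 \<noteq> y"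
  proof
    assume "last ys2 = y"
    then have "y \<in> set ys2"
      using in2(2) by simp
    then show False
      using y3 d32 u2 by blast
  qed
  then have "last ys2 = z"
    using z(3)[of "last ys2"] E2 ys2'(2) in2(3) by simp
  have d23: "set ys2 \<inter> set ys3 = {}"
    using d32 by blast
  note ends = branch_path_weight_ends[OF b1] branch_path_weight_ends[OF p2] branch_path_weight_ends[OF p3]
  have c: "E u a \<Longrightarrow> a \<in> set ys1 \<union> set ys2 \<union> set ys3 \<union> {u, v}"
    "E v a \<Longrightarrow> a \<in> set ys1 \<union> set ys2 \<union> set ys3 \<union> {u, v}" for a
  proof -
    show "a \<in> set ys1 \<union> set ys2 \<union> set ys3 \<union> {u, v}" if "E u a"
    proof -
      have "a = hd ys1 \<or> a = last ys1 \<or> a = w"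
        using that w(3)[of a] by simp
      then show ?thesis
        using in1 w3 by (elim disjE) blast+
    qed
    show "a \<in> set ys1 \<union> set ys2 \<union> set ys3 \<union> {u, v}" if "E v a"
    proof -
      have "a = y \<or> a = hd ys2 \<or> a = last ys2"
        using that z(3)[of a] in2(3) \<open>last ys2 = z\<close> by simp
      then show ?thesis
        using in2(1,2) y3 by (elim disjE) blast+
    qed
  qed
  have Euv: "E u v \<longleftrightarrow> ys3 = []"
    unfolding empty3 using w(3) in1 v1 by metis
  have uv: "path_weight (u # ys1 @ [u]) u v + path_weight (v # ys2 @ [v]) u v +
      path_weight (u # ys3 @ [v]) u v = of_bool (E u v)"
    using ends[of u v] ys1(1) ys2 branch(3) by (simp add: Euv edge_weight_left)
  have loops: "path_weight (u # ys1 @ [u]) a a = 0 \<and>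
      path_weight (v # ys2 @ [v]) a a = 0 \<and> path_weight (u # ys3 @ [v]) a a = 0" if "a \<in> {u, v}" for a
  proof -
    have "edge_weight u v a a = 0"
      using branch(3) by (simp add: edge_weight_def)
    then show ?thesis
      using ends[OF that that] ys1(1) ys2 by simp
  qed
  note cover = three_paths_cover[OF b1 p2 p3 d12 d13 d23 c uv loops]
  show ?thesis
    by (rule exI[of _ ys2], rule exI[of _ ys3]) (use cover in blast)
qed

text \<open>Without a cycle at \<open>u\<close>, all three paths from \<open>u\<close> end at
  \<open>v\<close>. They start with different neighbours of \<open>u\<close>, hence are disjoint and
  arrive from three different neighbours of \<open>v\<close>, which are then all of them.\<close>

lemma theta_case:
  assumes no_loop: "\<nexists>ys. branch_path u ys u"
  shows "\<exists>ys1 ys2 ys3. distinct (ys1 @ ys2 @ ys3 @ [u, v]) \<and> set (ys1 @ ys2 @ ys3 @ [u, v]) = V \<and>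
    (\<forall>a\<in>V. \<forall>b\<in>V. of_bool (E a b) = path_weight (u # ys1 @ [v]) a b +
      path_weight (u # ys2 @ [v]) a b + path_weight (u # ys3 @ [v]) a b)"
proof -
  obtain w1 w2 w3 where w: "{b. E u b} = {w1, w2, w3}" "w1 \<noteq> w2" "w1 \<noteq> w3" "w2 \<noteq> w3"
    using degree_three(1) by (auto simp: card_3_iff)
  have E_iff: "E u b \<longleftrightarrow> b = w1 \<or> b = w2 \<or> b = w3" for b
    using w(1) by blast
  have path: "\<exists>ys. branch_path u ys v \<and> hd (ys @ [v]) = y" if E: "E u y" for y
  proof -
    obtain ys t where b: "branch_path u ys t" "hd (ys @ [t]) = y"
      using branch_path_from[OF _ E] by blast
    moreover have "t = v"
      using b(1) no_loop branch_pathD(2)[OF b(1)] by blast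
    ultimately show ?thesis
      by blast
  qed
  have Ew: "E u w1" "E u w2" "E u w3"
    by (simp_all add: E_iff)
  obtain ys1 where b1: "branch_path u ys1 v" "hd (ys1 @ [v]) = w1"
    using path[OF Ew(1)] by blast
  obtain ys2 where b2: "branch_path u ys2 v" "hd (ys2 @ [v]) = w2"
    using path[OF Ew(2)] by blast
  obtain ys3 where b3: "branch_path u ys3 v" "hd (ys3 @ [v]) = w3"
    using path[OF Ew(3)] by blast
  have disj: "set ys \<inter> set ys' = {}"
    if b: "branch_path u ys v" "branch_path u ys' v" and ne: "hd (ys @ [v]) \<noteq> hd (ys' @ [v])" for ys ys'
  proof (rule branch_path_disjoint[OF b], rule notI)
    assume h: "hd (ys' @ [v]) \<in> set ys"
    have "hd (ys' @ [v]) = hd ys"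
      using branch_path_end_neighbour[OF b(1) h E_sym[OF branch_pathD(6)[OF b(2)]]] branch(3) by blast
    moreover have "ys \<noteq> []"
      using h by auto
    ultimately show False
      using ne by simp
  qed
  have d: "set ys1 \<inter> set ys2 = {}" "set ys1 \<inter> set ys3 = {}" "set ys2 \<inter> set ys3 = {}"
    using disj[OF b1(1) b2(1)] disj[OF b1(1) b3(1)] disj[OF b2(1) b3(1)] b1(2) b2(2) b3(2) w(2-4)
    by simp_all
  have hd_in: "hd (ys @ [v]) \<in> set ys \<union> {u, v}" for ys
    by (cases ys) auto
  have empty: "ys = [] \<longleftrightarrow> hd (ys @ [v]) = v" if "branch_path u ys v" for ys
    using branch_pathD(4)[OF that] by (cases ys) auto
  have last_ne: "last (u # ys) \<noteq> last (u # ys')"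
    if b: "branch_path u ys v" "branch_path u ys' v" and ne: "hd (ys @ [v]) \<noteq> hd (ys' @ [v])"
      and d: "set ys \<inter> set ys' = {}" for ys ys'
  proof -
    have "u \<notin> set ys" "u \<notin> set ys'"
      using branch_pathD(4)[OF b(1)] branch_pathD(4)[OF b(2)] by blast+
    moreover have "ys \<noteq> [] \<or> ys' \<noteq> []"
      using ne by auto
    moreover have "last zs \<in> set zs" if "zs \<noteq> []" for zs :: "'a list"
      using that by simp
    ultimately show ?thesis
      using d by (cases "ys = []"; cases "ys' = []") (metis disjoint_iff last.simps)+
  qed
  have "{last (u # ys1), last (u # ys2), last (u # ys3)} = {b. E v b}"
  proof (rule card_subset_eq)
    show "finite {b. E v b}"
      using degree_three(2) card.infinite by fastforce
    show "{last (u # ys1), last (u # ys2), last (u # ys3)} \<subseteq> {b. E v b}"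
      using branch_pathD(5)[OF b1(1)] branch_pathD(5)[OF b2(1)] branch_pathD(5)[OF b3(1)] E_sym by blast
    have "last (u # ys1) \<noteq> last (u # ys2)" "last (u # ys1) \<noteq> last (u # ys3)" "last (u # ys2) \<noteq> last (u # ys3)"
      using last_ne[OF b1(1) b2(1)] last_ne[OF b1(1) b3(1)] last_ne[OF b2(1) b3(1)] d b1(2) b2(2) b3(2) w(2-4)
      by simp_all
    then show "card {last (u # ys1), last (u # ys2), last (u # ys3)} = card {b. E v b}"
      unfolding degree_three(2) by (simp only: card_3_iff) blast
  qed
  note N_v = this
  have last_in: "last (u # ys) \<in> set ys \<union> {u, v}" for ys
    by auto
  have E_v: "a \<in> set ys1 \<union> set ys2 \<union> set ys3 \<union> {u, v}" if "E v a" for a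
  proof -
    have "a \<in> {last (u # ys1), last (u # ys2), last (u # ys3)}"
      unfolding N_v using that by simp
    then show ?thesis
      using last_in[of ys1] last_in[of ys2] last_in[of ys3] by blast
  qed
  have E_u: "a \<in> set ys1 \<union> set ys2 \<union> set ys3 \<union> {u, v}" if "E u a" for a
    using that hd_in[of ys1] hd_in[of ys2] hd_in[of ys3] b1(2) b2(2) b3(2) unfolding E_iff by blast
  have uv: "path_weight (u # ys1 @ [v]) u v + path_weight (u # ys2 @ [v]) u v +
      path_weight (u # ys3 @ [v]) u v = of_bool (E u v)"
  proof -
    have "path_weight (u # ys @ [v]) u v = of_bool (hd (ys @ [v]) = v)" if "branch_path u ys v" for ys
      using branch_path_weight_ends[OF that, of u v] branch(3)
      unfolding empty[OF that, symmetric] by (cases "ys = []") (simp_all add: edge_weight_left)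
    then show ?thesis
      using b1 b2 b3 w(2-4) unfolding E_iff by (cases "w1 = v"; cases "w2 = v"; cases "w3 = v") simp_all
  qed
  have loops: "path_weight (u # ys1 @ [v]) a a = 0 \<and>
      path_weight (u # ys2 @ [v]) a a = 0 \<and> path_weight (u # ys3 @ [v]) a a = 0" if "a \<in> {u, v}" for a
  proof -
    have "edge_weight u v a a = 0"
      using branch(3) by (simp add: edge_weight_def)
    then show ?thesis
      using branch_path_weight_ends[OF b1(1) that that] branch_path_weight_ends[OF b2(1) that that]
        branch_path_weight_ends[OF b3(1) that that] by (simp split: if_splits)
  qed
  note cover = three_paths_cover[OF b1(1) b2(1) b3(1) d E_u E_v uv loops]
  show ?thesis
    by (rule exI[of _ ys1], rule exI[of _ ys2], rule exI[of _ ys3]) (use cover in blast)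
qed

end

section \<open>The Laplacian\<close>


lemma sum_nth_distinct:
  "distinct vs \<Longrightarrow> (\<Sum>i<length vs. f (vs ! i)) = sum f (set vs)"
  using sum.reindex_bij_betw[OF bij_betw_nth[of vs "{..<length vs}" "set vs"], of f] by simp

lemma trace_list_mat:
  assumes "distinct vs"
  shows "sum_list (diag_mat (list_mat g vs)) = (\<Sum>a\<in>set vs. g a a)"
  using sum_nth_distinct[OF assms, of "\<lambda>a. g a a"]
  by (simp add: diag_mat_def interv_sum_list_conv_sum_set_nat list_mat_def lessThan_atLeast0)

lemma trace_list_mat_square:
  fixes g :: "'a \<Rightarrow> 'a \<Rightarrow> 'b :: comm_semiring_0"
  assumes "distinct vs"
  shows "sum_list (diag_mat (list_mat g vs * list_mat g vs)) =
    (\<Sum>a\<in>set vs. \<Sum>b\<in>set vs. g a b * g b a)"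
proof -
  have "sum_list (diag_mat (list_mat g vs * list_mat g vs)) =
    (\<Sum>i<length vs. \<Sum>j<length vs. g (vs ! i) (vs ! j) * g (vs ! j) (vs ! i))"
    by (simp add: diag_mat_def interv_sum_list_conv_sum_set_nat list_mat_def lessThan_atLeast0
        scalar_prod_def)
  also have "\<dots> = (\<Sum>i<length vs. \<Sum>b\<in>set vs. g (vs ! i) b * g b (vs ! i))"
    by (intro sum.cong refl sum_nth_distinct[OF assms])
  also have "\<dots> = (\<Sum>a\<in>set vs. \<Sum>b\<in>set vs. g a b * g b a)"
    by (rule sum_nth_distinct[OF assms])
  finally show ?thesis .
qed

definition lap_entry :: "('a \<Rightarrow> 'a \<Rightarrow> bool) \<Rightarrow> 'a \<Rightarrow> 'a \<Rightarrow> real" where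
  "lap_entry E a b = (if a = b then real (card {c. E a c}) else 0) - of_bool (E a b)"

lemma laplacian_eq_list_mat:
  assumes "distinct vs"
  shows "laplacian G vs = list_mat (lap_entry (\<lambda>a b. (a, b) \<in> parcs G)) vs"
proof (rule eq_matI)
  have deg: "out_degree (with_proj G) a = card {b. (a, b) \<in> parcs G}" for a
  proof -
    have "out_arcs (with_proj G) a = Pair a ` {b. (a, b) \<in> parcs G}"
      by (auto simp: out_arcs_def)
    then show ?thesis
      by (simp add: out_degree_def card_image inj_on_def)
  qed
  fix i j assume "i < dim_row (list_mat (lap_entry (\<lambda>a b. (a, b) \<in> parcs G)) vs)"
    "j < dim_col (list_mat (lap_entry (\<lambda>a b. (a, b) \<in> parcs G)) vs)"
  then have ij: "i < length vs" "j < length vs"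
    by (simp_all add: list_mat_def)
  then show "laplacian G vs $$ (i, j) = list_mat (lap_entry (\<lambda>a b. (a, b) \<in> parcs G)) vs $$ (i, j)"
    unfolding laplacian_index[OF ij] deg
    using assms by (simp add: list_mat_def lap_entry_def nth_eq_iff_index_eq)
qed (simp_all add: list_mat_def)

lemma sum_of_bool_card:
  assumes "finite V" "\<And>b. E a b \<Longrightarrow> b \<in> V"
  shows "(\<Sum>b\<in>V. of_bool (E a b)) = real (card {b. E a b})"
proof -
  have "{b \<in> V. E a b} = {b. E a b}"
    using assms(2) by blast
  then show ?thesis
    using assms(1) by (simp add: of_bool_def flip: sum.inter_filter)
qed

lemma lap_entry_row_sum:
  assumes "finite V" "a \<in> V" "\<And>b. E a b \<Longrightarrow> b \<in> V"
  shows "(\<Sum>b\<in>V. lap_entry E a b) = 0"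
  using sum_of_bool_card[of V E a] assms by (simp add: lap_entry_def sum_subtractf)

lemma lap_entry_trace:
  assumes "\<And>a. \<not> E a a"
  shows "(\<Sum>a\<in>V. lap_entry E a a) = (\<Sum>a\<in>V. real (card {b. E a b}))"
  using assms by (simp add: lap_entry_def)

text \<open>An off-diagonal product is 1 for adjacent vertices and 0 otherwise, and the diagonal
  gives the square of the degree.\<close>

lemma lap_entry_trace_square:
  assumes "finite V" "\<And>a. \<not> E a a" "\<And>a b. E a b \<Longrightarrow> E b a" "\<And>a b. E a b \<Longrightarrow> b \<in> V"
  shows "(\<Sum>a\<in>V. \<Sum>b\<in>V. lap_entry E a b * lap_entry E b a) =
    (\<Sum>a\<in>V. real (card {b. E a b}) ^ 2 + real (card {b. E a b}))"
proof (rule sum.cong)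
  fix a assume a: "a \<in> V"
  have "(\<Sum>b\<in>V. lap_entry E a b * lap_entry E b a) =
      (\<Sum>b\<in>V. (if a = b then real (card {c. E a c}) ^ 2 else 0) + of_bool (E a b))"
  proof (rule sum.cong)
    fix b
    show "lap_entry E a b * lap_entry E b a =
        (if a = b then real (card {c. E a c}) ^ 2 else 0) + of_bool (E a b)"
    proof (cases "a = b")
      case True
      then show ?thesis
        using assms(2) by (simp add: lap_entry_def power2_eq_square)
    next
      case False
      have "E a b = E b a"
        using assms(3) by blast
      then show ?thesis
        using False by (simp add: lap_entry_def)
    qed
  qed simp
  also have "\<dots> = real (card {b. E a b}) ^ 2 + real (card {b. E a b})"
    using a assms(1) sum_of_bool_card[of V E a] assms(4) by (simp add: sum.distrib)
  finally show "(\<Sum>b\<in>V. lap_entry E a b * lap_entry E b a) =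
      real (card {b. E a b}) ^ 2 + real (card {b. E a b})" .
qed simp

text \<open>Subtracting \<open>2 - x - inverse x\<close> from the diagonal of the Laplacian leaves
  \<open>x + inverse x\<close> at degree two and one more at degree three, the form to which path
  elimination applies. The sign comes from negating all \<open>length ys + 2\<close> rows.\<close>

lemma poly_char_poly_shift:
  fixes g W :: "'a \<Rightarrow> 'a \<Rightarrow> real"
  assumes d: "distinct (ys @ [u, v])"
    and g: "\<And>a b. a \<in> set (ys @ [u, v]) \<Longrightarrow> b \<in> set (ys @ [u, v]) \<Longrightarrow>
      g a b = (if a = b then if a \<in> {u, v} then 3 else 2 else 0) - W a b"
  shows "det (list_mat (\<lambda>a b. (x + inverse x) * of_bool (a = b \<and> a \<in> set ys) +
      (x + inverse x + 1) * of_bool (a = b \<and> a \<in> {u, v}) - W a b) (ys @ [u, v])) =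
    (- 1) ^ (length ys + 2) * poly (char_poly (list_mat g (ys @ [u, v]))) (2 - x - inverse x)"
proof -
  let ?vs = "ys @ [u, v]"
  let ?M = "\<lambda>a b. (x + inverse x) * of_bool (a = b \<and> a \<in> set ys) +
      (x + inverse x + 1) * of_bool (a = b \<and> a \<in> {u, v}) - W a b"
  have "poly (char_poly (list_mat g ?vs)) (2 - x - inverse x) =
      det (list_mat (\<lambda>a b. (if a = b then 2 - x - inverse x else 0) - g a b) ?vs)"
    by (rule poly_char_poly_list_mat[OF d])
  also have "list_mat (\<lambda>a b. (if a = b then 2 - x - inverse x else 0) - g a b) ?vs =
      list_mat (\<lambda>a b. - 1 * ?M a b) ?vs"
  proof (rule list_mat_cong)
    fix a b assume ab: "a \<in> set ?vs" "b \<in> set ?vs"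
    have disj: "u \<notin> set ys" "v \<notin> set ys"
      using d by simp_all
    note gab = g[OF ab]
    show "(if a = b then 2 - x - inverse x else 0) - g a b = - 1 * ?M a b"
    proof (cases "a = b")
      case True
      show ?thesis
      proof (cases "a \<in> {u, v}")
        case in_uv: True
        then have "a \<notin> set ys"
          using disj by blast
        then show ?thesis
          using True in_uv gab by simp
      next
        case False
        then have "a \<in> set ys"
          using ab(1) by simp
        then show ?thesis
          using True False gab by simp
      qed
    next
      case False
      then show ?thesis
        by (simp only: g[OF ab]) simp
    qed
  qed
  also have "list_mat (\<lambda>a b. - 1 * ?M a b) ?vs = - 1 \<cdot>\<^sub>m list_mat ?M ?vs"
    by (rule eq_matI) (simp_all add: list_mat_def)
  also have "det \<dots> = (- 1) ^ (length ys + 2) * det (list_mat ?M ?vs)"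
    by (subst det_smult) (simp add: list_mat_def)
  finally show ?thesis
    by (simp flip: power_add mult.assoc)
qed

text \<open>The factor in front depends on \<open>x\<close> and \<open>n\<close> only. So equal
  characteristic polynomials give equal values of \<open>dumbbell_poly\<close>, and likewise for
  \<open>theta_poly\<close> below.\<close>

lemma dumbbell_char_poly:
  assumes x: "1 < x" and d: "distinct (ys1 @ ys2 @ ys3 @ [u, v])"
    and g: "\<And>a b. a \<in> set (ys1 @ ys2 @ ys3 @ [u, v]) \<Longrightarrow> b \<in> set (ys1 @ ys2 @ ys3 @ [u, v]) \<Longrightarrow>
      g a b = (if a = b then if a \<in> {u, v} then 3 else 2 else 0) -
        (path_weight (u # ys1 @ [u]) a b + path_weight (v # ys2 @ [v]) a b + path_weight (u # ys3 @ [v]) a b)"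
    and n: "n = length (ys1 @ ys2 @ ys3 @ [u, v])"
  shows "dumbbell_poly (Suc (length ys1)) (Suc (length ys2)) (length ys3) x = (x - 1) * (x + 1) ^ 3 * x ^ n *
    ((- 1) ^ n * poly (char_poly (list_mat g (ys1 @ ys2 @ ys3 @ [u, v]))) (2 - x - inverse x))"
proof -
  have l: "length (ys1 @ ys2 @ ys3) + 2 = n" "length ys1 + length ys2 + length ys3 + 2 = n"
    using n by simp_all
  let ?M = "\<lambda>a b. (x + inverse x) * of_bool (a = b \<and> a \<in> set (ys1 @ ys2 @ ys3)) +
    (x + inverse x + 1) * of_bool (a = b \<and> a \<in> {u, v}) - (path_weight (u # ys1 @ [u]) a b + path_weight (v # ys2 @ [v]) a b + path_weight (u # ys3 @ [v]) a b)"
  have "det (list_mat ?M ((ys1 @ ys2 @ ys3) @ [u, v])) = (- 1) ^ (length (ys1 @ ys2 @ ys3) + 2) *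
    poly (char_poly (list_mat g ((ys1 @ ys2 @ ys3) @ [u, v]))) (2 - x - inverse x)"
    by (rule poly_char_poly_shift) (use d g in \<open>simp_all only: append_assoc\<close>)
  then have "det (list_mat ?M (ys1 @ ys2 @ ys3 @ [u, v])) =
    (- 1) ^ n * poly (char_poly (list_mat g (ys1 @ ys2 @ ys3 @ [u, v]))) (2 - x - inverse x)"
    by (simp only: l append_assoc)
  moreover have "?M a b = (x + inverse x) * of_bool (a = b \<and> a \<in> set (ys1 @ ys2 @ ys3)) +
      (x + inverse x + 1) * of_bool (a = b \<and> a \<in> {u, v}) -
      path_weight (u # ys1 @ [u]) a b - path_weight (v # ys2 @ [v]) a b - path_weight (u # ys3 @ [v]) a b" for a b
    by (simp only: diff_diff_eq)
  note det_dumbbell[OF x d this]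
  ultimately show ?thesis
    by (simp only: l)
qed

lemma theta_char_poly:
  assumes x: "1 < x" and d: "distinct (ys1 @ ys2 @ ys3 @ [u, v])"
    and g: "\<And>a b. a \<in> set (ys1 @ ys2 @ ys3 @ [u, v]) \<Longrightarrow> b \<in> set (ys1 @ ys2 @ ys3 @ [u, v]) \<Longrightarrow>
      g a b = (if a = b then if a \<in> {u, v} then 3 else 2 else 0) -
        (path_weight (u # ys1 @ [v]) a b + path_weight (u # ys2 @ [v]) a b + path_weight (u # ys3 @ [v]) a b)"
    and n: "n = length (ys1 @ ys2 @ ys3 @ [u, v])"
  shows "theta_poly (Suc (length ys1)) (Suc (length ys2)) (Suc (length ys3)) x = (x - 1) * (x + 1) ^ 3 * x ^ n *
    ((- 1) ^ n * poly (char_poly (list_mat g (ys1 @ ys2 @ ys3 @ [u, v]))) (2 - x - inverse x))"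
proof -
  have l: "length (ys1 @ ys2 @ ys3) + 2 = n" "length ys1 + length ys2 + length ys3 + 2 = n"
    using n by simp_all
  let ?M = "\<lambda>a b. (x + inverse x) * of_bool (a = b \<and> a \<in> set (ys1 @ ys2 @ ys3)) +
    (x + inverse x + 1) * of_bool (a = b \<and> a \<in> {u, v}) - (path_weight (u # ys1 @ [v]) a b + path_weight (u # ys2 @ [v]) a b + path_weight (u # ys3 @ [v]) a b)"
  have "det (list_mat ?M ((ys1 @ ys2 @ ys3) @ [u, v])) = (- 1) ^ (length (ys1 @ ys2 @ ys3) + 2) *
    poly (char_poly (list_mat g ((ys1 @ ys2 @ ys3) @ [u, v]))) (2 - x - inverse x)"
    by (rule poly_char_poly_shift) (use d g in \<open>simp_all only: append_assoc\<close>)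
  then have "det (list_mat ?M (ys1 @ ys2 @ ys3 @ [u, v])) =
    (- 1) ^ n * poly (char_poly (list_mat g (ys1 @ ys2 @ ys3 @ [u, v]))) (2 - x - inverse x)"
    by (simp only: l append_assoc)
  moreover have "?M a b = (x + inverse x) * of_bool (a = b \<and> a \<in> set (ys1 @ ys2 @ ys3)) +
      (x + inverse x + 1) * of_bool (a = b \<and> a \<in> {u, v}) -
      path_weight (u # ys1 @ [v]) a b - path_weight (u # ys2 @ [v]) a b - path_weight (u # ys3 @ [v]) a b" for a b
    by (simp only: diff_diff_eq)
  note det_theta[OF x d this]
  ultimately show ?thesis
    by (simp only: l)
qed

text \<open>The substituted eigenvalue is \<open>- ((x - 1) ^ 2 / x)\<close>, so a double root 0
  would make the polynomial vanish to order at least five at 1, whereas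
  \<open>dumbbell_poly_limit\<close> gives order exactly three.\<close>

lemma dumbbell_simple_root:
  assumes eq: "\<And>x. 1 < x \<Longrightarrow> dumbbell_poly p q k x = (x - 1) * (x + 1) ^ 3 * x ^ n *
      ((- 1) ^ n * poly c (2 - x - inverse x))"
    and pq: "1 \<le> p" "1 \<le> q"
  shows "c \<noteq> [:0, 1:] ^ 2 * r"
proof
  assume c: "c = [:0, 1:] ^ 2 * r"
  let ?f = "\<lambda>x :: real. (x + 1) ^ 3 * x ^ n * ((- 1) ^ n * ((x - 1) ^ 2 / x ^ 2 * poly r (2 - x - inverse x)))"
  have "(?f \<longlongrightarrow> (1 + 1) ^ 3 * 1 ^ n * ((- 1) ^ n * ((1 - 1) ^ 2 / 1 ^ 2 * poly r (2 - 1 - inverse 1)))) (at_right 1)"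
    by (intro tendsto_intros) auto
  then have "(?f \<longlongrightarrow> 0) (at_right 1)"
    by simp
  moreover have "\<forall>\<^sub>F x in at_right 1. ?f x = dumbbell_poly p q k x / (x - 1) ^ 3"
  proof (rule eventually_at_rightI[of 1 2])
    fix x :: real assume "x \<in> {1<..<2}"
    then have x: "1 < x" by simp
    have "2 - x - inverse x = - ((x - 1) ^ 2 / x)"
      using x by (simp add: field_simps power2_eq_square)
    then have l: "(2 - x - inverse x) ^ 2 = (x - 1) ^ 4 / x ^ 2"
      by (simp add: power_divide)
    have "(x - 1) * a * (s * (((x - 1) ^ 4 / x ^ 2) * b)) / (x - 1) ^ 3 = a * (s * ((x - 1) ^ 2 / x ^ 2 * b))" for a s b
      using x by (simp add: divide_simps) (simp add: eval_nat_numeral)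
    from this[of "(x + 1) ^ 3 * x ^ n" "(- 1) ^ n" "poly r (2 - x - inverse x)"]
    show "?f x = dumbbell_poly p q k x / (x - 1) ^ 3"
      unfolding eq[OF x] c by (simp add: l mult.assoc)
  qed simp
  ultimately have "((\<lambda>x. dumbbell_poly p q k x / (x - 1) ^ 3) \<longlongrightarrow> 0) (at_right 1)"
    by (rule Lim_transform_eventually)
  then have "8 * real (p + q + k) * real (p * q) = 0"
    using tendsto_unique[OF _ dumbbell_poly_limit[OF pq]] by simp
  then show False
    using pq by simp
qed

text \<open>By symmetry of \<open>E\<close> the complement of \<open>S\<close> is closed too, so the
  Laplacian splits into two blocks. Each has zero row sums and contributes one factor with root
  0.\<close>

lemma closed_subset_double_root:
  assumes fin: "finite V" and E: "\<And>a b. E a b \<Longrightarrow> a \<in> V \<and> b \<in> V" and sym: "\<And>a b. E a b \<Longrightarrow> E b a"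
    and S: "S \<subseteq> V" "S \<noteq> {}" "S \<noteq> V" "\<And>a b. a \<in> S \<Longrightarrow> E a b \<Longrightarrow> b \<in> S"
  obtains vs r where "distinct vs" "set vs = V" "char_poly (list_mat (lap_entry E) vs) = [:0, 1:] ^ 2 * r"
proof -
  obtain us where us: "set us = S" "distinct us"
    using finite_distinct_list[of S] finite_subset[OF S(1) fin] by blast
  obtain ws where ws: "set ws = V - S" "distinct ws"
    using finite_distinct_list[of "V - S"] fin by blast
  let ?c = "\<lambda>zs. char_poly (list_mat (lap_entry E) zs)"
  have "lap_entry E b a = 0" if "a \<in> set us" "b \<in> set ws" for a b
  proof -
    have "a \<noteq> b" "\<not> E b a"
      using that us ws S(4)[of a b] sym by blast+
    then show ?thesis
      by (simp add: lap_entry_def)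
  qed
  then have prod: "?c (us @ ws) = ?c us * ?c ws"
    using us ws by (intro char_poly_list_mat_append) auto
  have "poly (?c us) 0 = 0"
  proof (rule poly_char_poly_zero_of_row_sums[OF us(2)])
    show "us \<noteq> []"
      using us S(2) by auto
    fix a assume "a \<in> set us"
    then show "(\<Sum>b\<in>set us. lap_entry E a b) = 0"
      using us(1) S(4) by (intro lap_entry_row_sum) auto
  qed
  then obtain r1 where r1: "?c us = [:0, 1:] * r1"
    by (auto simp: poly_eq_0_iff_dvd elim: dvdE)
  have "poly (?c ws) 0 = 0"
  proof (rule poly_char_poly_zero_of_row_sums[OF ws(2)])
    show "ws \<noteq> []"
      using ws S(1,3) by auto
    fix a assume a: "a \<in> set ws"
    have "b \<in> set ws" if "E a b" for b
      using that a ws(1) S(4)[of b a] sym E by blast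
    then show "(\<Sum>b\<in>set ws. lap_entry E a b) = 0"
      using a by (intro lap_entry_row_sum) auto
  qed
  then obtain r2 where r2: "?c ws = [:0, 1:] * r2"
    by (auto simp: poly_eq_0_iff_dvd elim: dvdE)
  show thesis
  proof (rule that[of "us @ ws" "r1 * r2"])
    show "distinct (us @ ws)" "set (us @ ws) = V"
      using us ws S(1) by auto
    show "?c (us @ ws) = [:0, 1:] ^ 2 * (r1 * r2)"
      unfolding prod r1 r2 by (simp only: power2_eq_square mult_ac)
  qed
qed

section \<open>The explicit dumbbell and its degrees\<close>

lemma path_weight_upt:
  "path_weight [i..<j] a b = of_bool (b = Suc a \<and> i \<le> a \<and> b < j) + of_bool (a = Suc b \<and> i \<le> b \<and> a < j)"
proof (induction j)
  case (Suc j)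
  show ?case
  proof (cases "i < j")
    case True
    have 1: "path_weight ([i..<j] @ [j]) a b = path_weight [i..<j] a b + edge_weight (last [i..<j]) j a b"
      using True by (intro path_weight_snoc) simp
    have 2: "last [i..<j] = j - 1"
      using True by simp
    have 3: "edge_weight (j - 1) j a b = of_bool (b = Suc a \<and> b = j) + of_bool (a = Suc b \<and> a = j)"
      unfolding edge_weight_def using True by (intro arg_cong2[where f = "(+)"] arg_cong[where f = of_bool]) auto
    have 4: "of_bool (b = Suc a \<and> i \<le> a \<and> b < j) + of_bool (b = Suc a \<and> b = j) = (of_bool (b = Suc a \<and> i \<le> a \<and> b < Suc j) :: real)"
      by (subst of_bool_add_exclusive) (use True in \<open>auto intro: arg_cong[where f = of_bool]\<close>)
    have 5: "of_bool (a = Suc b \<and> i \<le> b \<and> a < j) + of_bool (a = Suc b \<and> a = j) = (of_bool (a = Suc b \<and> i \<le> b \<and> a < Suc j) :: real)"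
      by (subst of_bool_add_exclusive) (use True in \<open>auto intro: arg_cong[where f = of_bool]\<close>)
    have 6: "[i..<Suc j] = [i..<j] @ [j]"
      using True by simp
    show ?thesis
      unfolding 6 1 2 3 Suc.IH 4[symmetric] 5[symmetric] by (simp only: add_ac)
  next
    case False
    then have n: "\<not> (b = Suc a \<and> i \<le> a \<and> b < Suc j)" "\<not> (a = Suc b \<and> i \<le> b \<and> a < Suc j)"
      by auto
    have "path_weight [i..<Suc j] a b = 0"
      using False by (cases "i = j") auto
    then show ?thesis
      unfolding n[THEN eq_False[THEN iffD2]] by simp
  qed
qed simp

text \<open>This brings the numbered dumbbell into the shape used for abstract graphs:
  \<open>p - 1\<close> and \<open>p + k\<close> are the branching vertices, and the three intervals
  are the inner vertices of the two cycles and of the connecting path.\<close>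

lemma dumbbell_path_weights:
  assumes pq: "3 \<le> p" "3 \<le> q" and ab: "a < p + k + q" "b < p + k + q"
  shows "of_bool ((a, b) \<in> parcs (dumbbell p k q)) =
    path_weight ((p - 1) # [0..<p - 1] @ [p - 1]) a b +
    path_weight ((p + k) # [p + k + 1..<p + k + q] @ [p + k]) a b +
    path_weight ((p - 1) # [p..<p + k] @ [p + k]) a b"
proof -
  \<comment> \<open>Both lengths are written as successors so that no truncated subtraction
    remains.\<close>
  define p' q' where "p' = p - 3" and "q' = q - 3"
  then have p': "p = Suc (Suc (Suc p'))" and q': "q = Suc (Suc (Suc q'))"
    using pq by simp_all
  have l1: "(p - 1) # [0..<p - 1] @ [p - 1] = (p - 1) # [0..<p]"
    using pq upt_Suc_append[of 0 "p - 1"] by simp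
  have l2: "(p + k) # [p + k + 1..<p + k + q] @ [p + k] = [p + k..<p + k + q] @ [p + k]"
    using pq upt_conv_Cons[of "p + k" "p + k + q"] by simp
  have l3: "(p - 1) # [p..<p + k] @ [p + k] = [p - 1..<p + k + 1]"
    using pq upt_conv_Cons[of "p - 1" "p + k + 1"] by simp
  have w1: "path_weight ((p - 1) # [0..<p]) a b = edge_weight (p - 1) 0 a b + path_weight [0..<p] a b"
    using pq by (subst path_weight_Cons) (auto simp: hd_upt)
  have w2: "path_weight ([p + k..<p + k + q] @ [p + k]) a b =
      path_weight [p + k..<p + k + q] a b + edge_weight (p + k + q - 1) (p + k) a b"
    using pq by (subst path_weight_snoc) (auto simp: last_upt)
  have arc: "(a, b) \<in> parcs (dumbbell p k q) \<longleftrightarrow> b = Suc a \<or> a = Suc b \<or>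
     a = 0 \<and> b = p - 1 \<or> a = p - 1 \<and> b = 0 \<or> a = p + k \<and> b = p + k + q - 1 \<or> a = p + k + q - 1 \<and> b = p + k"
    using pq ab by (subst parcs_dumbbell) (auto simp: doubleton_eq_iff)
  note eqs = l1 l2 l3 w1 w2 path_weight_upt arc edge_weight_def
  show ?thesis
  proof (cases "b = Suc a")
    case up: True
    consider "Suc a < p" | "p \<le> Suc a" "a < p + k" | "p + k \<le> a"
      by linarith
    then show ?thesis
      using ab unfolding eqs unfolding up p' q' by cases auto
  next
    case nup: False
    show ?thesis
    proof (cases "a = Suc b")
      case down: True
      consider "Suc b < p" | "p \<le> Suc b" "b < p + k" | "p + k \<le> b"
        by linarith
      then show ?thesis
        using ab unfolding eqs unfolding down p' q' by cases auto
    next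
      case ndown: False
      \<comment> \<open>Edges between vertices with non-consecutive numbers can only be the closing
        edges of the two cycles.\<close>
      consider "a = 0" "b = p - 1" | "a = p - 1" "b = 0" | "a = p + k" "b = p + k + q - 1"
        | "a = p + k + q - 1" "b = p + k" | "\<not> (a = 0 \<and> b = p - 1)" "\<not> (a = p - 1 \<and> b = 0)"
          "\<not> (a = p + k \<and> b = p + k + q - 1)" "\<not> (a = p + k + q - 1 \<and> b = p + k)"
        by blast
      then show ?thesis
      proof cases
        case 5
        show ?thesis
          unfolding eqs unfolding 5[THEN eq_False[THEN iffD2]] nup[THEN eq_False[THEN iffD2]] ndown[THEN eq_False[THEN iffD2]]
          using 5 by (simp add: conj_commute)
      qed (unfold eqs, unfold p' q', simp_all)
    qed
  qed
qed


lemma edge_weight_row_sum: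
  assumes "finite V" "c \<in> V" "d \<in> V"
  shows "(\<Sum>b\<in>V. edge_weight c d a b) = of_bool (a = c) + of_bool (a = d)"
  using assms by (simp add: edge_weight_def sum.distrib of_bool_conj flip: sum_distrib_left)

lemma path_weight_row_sum_aux:
  assumes "finite V" "distinct zs" "set zs \<subseteq> V" "zs \<noteq> []"
  shows "(\<Sum>b\<in>V. path_weight zs a b) = 2 * of_bool (a \<in> set zs) - of_bool (a = hd zs) - of_bool (a = last zs)"
  using assms(2-4)
proof (induction zs)
  case (Cons c zs)
  show ?case
  proof (cases "zs = []")
    case False
    have hd: "hd zs \<in> V"
      using Cons.prems(2) False hd_in_set[OF False] by auto
    have "(\<Sum>b\<in>V. path_weight (c # zs) a b) =
        of_bool (a = c) + of_bool (a = hd zs) + (\<Sum>b\<in>V. path_weight zs a b)"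
      using edge_weight_row_sum[OF assms(1) _ hd, of c] Cons.prems(2) False
      by (simp add: path_weight_Cons sum.distrib)
    then show ?thesis
      using Cons False by (cases "a = c") simp_all
  qed simp
qed simp

lemma path_weight_row_sum:
  assumes "finite V" "distinct ys" "set ys \<subseteq> V" "s \<in> V" "t \<in> V"
  shows "(\<Sum>b\<in>V. path_weight (s # ys @ [t]) a b) = 2 * of_bool (a \<in> set ys) + of_bool (a = s) + of_bool (a = t)"
proof (cases "ys = []")
  case True
  then show ?thesis
    using edge_weight_row_sum[OF assms(1,4,5)] by simp
next
  case False
  then have "hd ys \<in> V" "last ys \<in> V"
    using assms(3) hd_in_set last_in_set by blast+
  then show ?thesis
    using path_weight_row_sum_aux[OF assms(1-3) False, of a] edge_weight_row_sum[OF assms(1,4), of "hd ys" a]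
      edge_weight_row_sum[OF assms(1) _ assms(5), of "last ys" a]
    by (simp add: path_weight_ends[OF False] sum.distrib)
qed

text \<open>Degrees are row sums: a walk gives 2 to each inner vertex and 1 to each end, so a cycle
  gives 2 to its branching vertex and the connecting path adds 1.\<close>

lemma dumbbell_degree:
  assumes d: "distinct (ys1 @ ys2 @ ys3 @ [u, v])" and V: "V = set (ys1 @ ys2 @ ys3 @ [u, v])"
    and E: "\<And>a b. E a b \<Longrightarrow> b \<in> V"
    and W: "\<And>a b. a \<in> V \<Longrightarrow> b \<in> V \<Longrightarrow> of_bool (E a b) = path_weight (u # ys1 @ [u]) a b +
      path_weight (v # ys2 @ [v]) a b + path_weight (u # ys3 @ [v]) a b"
    and a: "a \<in> V"
  shows "card {b. E a b} = (if a \<in> {u, v} then 3 else 2)"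
proof -
  have fin: "finite V"
    by (simp add: V)
  have sub: "set ys1 \<subseteq> V" "set ys2 \<subseteq> V" "set ys3 \<subseteq> V" "u \<in> V" "v \<in> V"
    by (auto simp: V)
  have dist: "distinct ys1" "distinct ys2" "distinct ys3"
    using d by simp_all
  have "real (card {b. E a b}) = (\<Sum>b\<in>V. of_bool (E a b))"
    by (rule sum_of_bool_card[OF fin E, symmetric])
  also have "\<dots> = (\<Sum>b\<in>V. path_weight (u # ys1 @ [u]) a b +
      path_weight (v # ys2 @ [v]) a b + path_weight (u # ys3 @ [v]) a b)"
    using W[OF a] by (intro sum.cong refl)
  also have "\<dots> = (2 * of_bool (a \<in> set ys1) + of_bool (a = u) + of_bool (a = u)) +
    (2 * of_bool (a \<in> set ys2) + of_bool (a = v) + of_bool (a = v)) +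
    (2 * of_bool (a \<in> set ys3) + of_bool (a = u) + of_bool (a = v))"
    unfolding sum.distrib using path_weight_row_sum[OF fin dist(1) sub(1,4,4), of a]
      path_weight_row_sum[OF fin dist(2) sub(2,5,5), of a] path_weight_row_sum[OF fin dist(3) sub(3,4,5), of a]
    by simp
  also have "\<dots> = real (if a \<in> {u, v} then 3 else 2)"
  proof -
    consider "a \<in> set ys1" | "a \<in> set ys2" | "a \<in> set ys3" | "a = u" | "a = v"
      using a V by auto
    then show ?thesis
    proof cases
      case 1
      then have "a \<notin> set ys2" "a \<notin> set ys3" "a \<noteq> u" "a \<noteq> v"
        using d by auto
      then show ?thesis
        using 1 by simp
    next
      case 2
      then have "a \<notin> set ys1" "a \<notin> set ys3" "a \<noteq> u" "a \<noteq> v"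
        using d by auto
      then show ?thesis
        using 2 by simp
    next
      case 3
      then have "a \<notin> set ys1" "a \<notin> set ys2" "a \<noteq> u" "a \<noteq> v"
        using d by auto
      then show ?thesis
        using 3 by simp
    next
      case 4
      then have "a \<notin> set ys1" "a \<notin> set ys2" "a \<notin> set ys3" "a \<noteq> v"
        using d by auto
      then show ?thesis
        using 4 by simp
    next
      case 5
      then have "a \<notin> set ys1" "a \<notin> set ys2" "a \<notin> set ys3" "a \<noteq> u"
        using d by auto
      then show ?thesis
        using 5 by simp
    qed
  qed
  finally show ?thesis
    by (simp only: of_nat_eq_iff)
qed

section \<open>Building the isomorphism\<close>

lemma map_nth_segment:
  "i = length xs \<Longrightarrow> j = i + length ys \<Longrightarrow> map (\<lambda>k. (xs @ ys @ zs) ! k) [i..<j] = ys"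
  by (rule nth_equalityI) (simp_all add: nth_append)

lemma dumbbell_isoI:
  fixes H :: "'a pair_pre_digraph"
  assumes H: "pair_graph H" and d: "distinct (ys1 @ ys2 @ ys3 @ [u, v])"
    and V: "set (ys1 @ ys2 @ ys3 @ [u, v]) = pverts H"
    and W: "\<And>a b. a \<in> pverts H \<Longrightarrow> b \<in> pverts H \<Longrightarrow> of_bool ((a, b) \<in> parcs H) = path_weight (u # ys1 @ [u]) a b +
      path_weight (v # ys2 @ [v]) a b + path_weight (u # ys3 @ [v]) a b"
    and p: "p = Suc (length ys1)" "3 \<le> p" and q: "q = Suc (length ys2)" "3 \<le> q" and k: "k = length ys3"
  shows "digraph_iso (with_proj H) (with_proj (dumbbell p k q))"
proof -
  interpret H: pair_graph H
    by (rule H)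
  interpret D: pair_graph "dumbbell p k q"
    by (rule pair_graph_dumbbell) (use p q in simp_all)
  \<comment> \<open>This order matches the numbering of \<open>dumbbell\<close>: the first cycle
    with its branching vertex at position \<open>p - 1\<close>, the inner vertices of the path, the
    second branching vertex at \<open>p + k\<close>, then the rest of the second cycle.\<close>
  define zs where "zs = ys1 @ [u] @ ys3 @ [v] @ ys2"
  define f where "f = (\<lambda>i. zs ! i)"
  let ?n = "p + k + q"
  have len: "length zs = ?n"
    by (simp add: zs_def p q k)
  have "distinct zs"
    using d by (auto simp: zs_def)
  have Vn: "pverts (dumbbell p k q) = {..<?n}"
    using p q by (subst pverts_dumbbell) auto
  have inj: "inj_on f {..<?n}"
    using \<open>distinct zs\<close> len by (auto simp: inj_on_def f_def nth_eq_iff_index_eq)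
  have img: "f ` {..<?n} = pverts H"
  proof -
    have "f ` {..<?n} = set zs"
      by (auto simp: f_def len[symmetric] set_conv_nth)
    also have "\<dots> = pverts H"
      unfolding V[symmetric] by (auto simp: zs_def)
    finally show ?thesis .
  qed
  have m: "map f [0..<p - 1] = ys1" "map f [p..<p + k] = ys3" "map f [p + k + 1..<?n] = ys2"
    using map_nth_segment[of 0 "[]" "p - 1" ys1 "[u] @ ys3 @ [v] @ ys2"]
      map_nth_segment[of p "ys1 @ [u]" "p + k" ys3 "[v] @ ys2"]
      map_nth_segment[of "p + k + 1" "ys1 @ [u] @ ys3 @ [v]" ?n ys2 "[]"]
    by (simp_all add: f_def zs_def p(1) q(1) k)
  have "map f [p - 1..<p] = [u]" "map f [p + k..<p + k + 1] = [v]"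
    using map_nth_segment[of "p - 1" "ys1" p "[u]" "ys3 @ [v] @ ys2"]
      map_nth_segment[of "p + k" "ys1 @ [u] @ ys3" "p + k + 1" "[v]" ys2]
    by (simp_all add: f_def zs_def p(1) k)
  moreover have "[p - 1..<p] = [p - 1]" "[p + k..<p + k + 1] = [p + k]"
    by (simp_all add: p(1))
  ultimately have m': "f (p - 1) = u" "f (p + k) = v"
    by simp_all
  \<comment> \<open>Both adjacency relations are the same sum of path weights, transported along the
    injection \<open>f\<close>.\<close>
  have arcs: "(f i, f j) \<in> parcs H \<longleftrightarrow> (i, j) \<in> parcs (dumbbell p k q)" if ij: "i < ?n" "j < ?n" for i j
  proof -
    have fij: "f i \<in> pverts H" "f j \<in> pverts H"
      using ij img by blast+
    have pw: "path_weight (map f ws) (f i) (f j) = path_weight ws i j" if "set ws \<subseteq> {..<?n}" for ws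
      by (rule path_weight_map, rule inj_on_subset[OF inj]) (use ij that in auto)
    have sub: "set ((p - 1) # [0..<p - 1] @ [p - 1]) \<subseteq> {..<?n}"
      "set ((p + k) # [p + k + 1..<?n] @ [p + k]) \<subseteq> {..<?n}"
      "set ((p - 1) # [p..<p + k] @ [p + k]) \<subseteq> {..<?n}"
      using p(2) q(2) by auto
    have "of_bool ((f i, f j) \<in> parcs H) = (of_bool ((i, j) \<in> parcs (dumbbell p k q)) :: real)"
      unfolding W[OF fij] dumbbell_path_weights[OF p(2) q(2) ij]
      using pw[OF sub(1)] pw[OF sub(2)] pw[OF sub(3)] by (simp only: list.map map_append m m')
    then show ?thesis
      by (simp only: of_bool_eq_iff)
  qed
  let ?h = "\<lparr>iso_verts = f, iso_arcs = map_prod f f, iso_head = snd, iso_tail = fst\<rparr>"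
  have sub: "parcs (dumbbell p k q) \<subseteq> {..<?n} \<times> {..<?n}"
    using D.arc_fst_in_verts D.arc_snd_in_verts unfolding Vn by (fastforce simp: mem_Times_iff)
  have img_arcs: "map_prod f f ` parcs (dumbbell p k q) = parcs H"
  proof (intro equalityI subsetI)
    fix e assume "e \<in> map_prod f f ` parcs (dumbbell p k q)"
    then show "e \<in> parcs H"
      using sub arcs by auto
  next
    fix e assume e: "e \<in> parcs H"
    then have "fst e \<in> f ` {..<?n}" "snd e \<in> f ` {..<?n}"
      unfolding img by (rule H.arc_fst_in_verts, rule H.arc_snd_in_verts)
    then obtain i j where ij: "i < ?n" "j < ?n" "fst e = f i" "snd e = f j"
      by auto
    then have "e = map_prod f f (i, j)" "(i, j) \<in> parcs (dumbbell p k q)"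
      using e arcs by (simp_all add: prod_eq_iff) (metis prod.collapse)
    then show "e \<in> map_prod f f ` parcs (dumbbell p k q)"
      by blast
  qed
  have "inj_on (map_prod f f) (parcs (dumbbell p k q))"
    by (rule inj_on_subset[OF map_prod_inj_on[OF inj inj] sub])
  then have "pre_digraph.digraph_isomorphism (with_proj (dumbbell p k q)) ?h"
    unfolding pre_digraph.digraph_isomorphism_def using D.wf_digraph_axioms inj by (simp add: Vn)
  moreover have "with_proj H = app_iso ?h (with_proj (dumbbell p k q))"
    using img img_arcs by (simp add: app_iso_def with_proj_def Vn)
  ultimately have "digraph_iso (with_proj (dumbbell p k q)) (with_proj H)"
    unfolding digraph_iso_def by blast
  then show ?thesis
    by (rule digraph_iso_swap[OF D.wf_digraph_axioms])
qed

text \<open>The sum of \<open>(d - 2) * (d - 3)\<close> is fixed by the number of vertices and the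
  two power sums. No natural number makes this product negative, so it vanishes termwise. The degree
  sum then exceeds twice the number of vertices by 2, which counts the vertices of degree 3.\<close>

lemma degrees_of_power_sums:
  assumes finV: "finite V" and finU: "finite U" and card: "card V = card U"
    and U: "\<And>a. a \<in> U \<Longrightarrow> e a = (if a \<in> {s, t} then 3 else 2)" "s \<in> U" "t \<in> U" "s \<noteq> t"
    and sum1: "(\<Sum>a\<in>V. real (d a)) = (\<Sum>a\<in>U. real (e a))"
    and sum2: "(\<Sum>a\<in>V. real (d a) ^ 2) = (\<Sum>a\<in>U. real (e a) ^ 2)"
  obtains u v where "u \<in> V" "v \<in> V" "u \<noteq> v" "\<And>a. a \<in> V \<Longrightarrow> d a = (if a \<in> {u, v} then 3 else 2)"
proof -
  have expand: "(\<Sum>a\<in>A. (real (c a) - 2) * (real (c a) - 3)) =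
      (\<Sum>a\<in>A. real (c a) ^ 2) - 5 * (\<Sum>a\<in>A. real (c a)) + 6 * real (card A)" for A :: "'x set" and c
    by (simp add: sum_subtractf sum.distrib sum_distrib_left algebra_simps power2_eq_square)
  have "(\<Sum>a\<in>U. (real (e a) - 2) * (real (e a) - 3)) = 0"
    by (rule sum.neutral) (use U(1) in auto)
  then have zero: "(\<Sum>a\<in>V. (real (d a) - 2) * (real (d a) - 3)) = 0"
    unfolding expand sum1 sum2 card .
  have nonneg: "0 \<le> (real m - 2) * (real m - 3)" for m
  proof (cases "m \<le> 2")
    case True
    then show ?thesis
      by (intro mult_nonpos_nonpos) auto
  qed (simp add: mult_nonneg_nonneg)
  have d23: "d a = 2 \<or> d a = 3" if "a \<in> V" for a
    using zero that nonneg finV by (subst (asm) sum_nonneg_eq_0_iff) auto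
  have "(\<Sum>a\<in>U. real (e a)) = (\<Sum>a\<in>U. 2 + of_bool (a \<in> {s, t}))"
    by (rule sum.cong) (use U(1) in auto)
  also have "\<dots> = 2 * real (card U) + 2"
  proof -
    have "(\<Sum>a\<in>U. of_bool (a \<in> {s, t})) = real (card {b. b \<in> {s, t}})"
      by (rule sum_of_bool_card[OF finU]) (use U in auto)
    moreover have "{b. b \<in> {s, t}} = {s, t}"
      by blast
    ultimately have "(\<Sum>a\<in>U. of_bool (a \<in> {s, t})) = (2 :: real)"
      using U(4) by (simp only: card_2_iff) simp
    then show ?thesis
      by (simp only: sum.distrib) simp
  qed
  finally have "(\<Sum>a\<in>V. real (d a)) = 2 * real (card V) + 2"
    using sum1 card by simp
  moreover have "(\<Sum>a\<in>V. real (d a)) = (\<Sum>a\<in>V. 2 + of_bool (a \<in> V \<and> d a = 3))"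
    by (rule sum.cong) (use d23 in auto)
  moreover have "(\<Sum>a\<in>V. of_bool (a \<in> V \<and> d a = 3)) = real (card {a. a \<in> V \<and> d a = 3})"
    by (rule sum_of_bool_card[OF finV]) simp
  ultimately have "card {a. a \<in> V \<and> d a = 3} = 2"
    by (simp add: sum.distrib)
  then obtain u v where uv: "{a. a \<in> V \<and> d a = 3} = {u, v}" "u \<noteq> v"
    by (auto simp: card_2_iff)
  show thesis
  proof (rule that[of u v])
    show "u \<in> V" "v \<in> V" "u \<noteq> v"
      using uv by blast+
    show "d a = (if a \<in> {u, v} then 3 else 2)" if "a \<in> V" for a
      unfolding uv(1)[symmetric] using that d23[OF that] by auto
  qed
qed


section \<open>From the spectrum to the isomorphism\<close>

theorem theorem1p1:
  fixes p k q :: nat and H :: "'a pair_pre_digraph"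
  assumes "3 \<le> q" and "q \<le> p"
    and "pair_graph H"
    and "L_cospectral H (dumbbell p k q)"
  shows "digraph_iso (with_proj H) (with_proj (dumbbell p k q))"
proof -
  let ?D = "dumbbell p k q" and ?n = "p + k + q"
  have p: "3 \<le> p"
    using assms(1,2) by simp
  interpret H: pair_graph H
    by (rule assms(3))
  interpret D: pair_graph ?D
    by (rule pair_graph_dumbbell[OF assms(1) p])
  define E where "E = (\<lambda>a b. (a, b) \<in> parcs H)"
  define F where "F = (\<lambda>a b. (a, b) \<in> parcs ?D)"
  have E: "E a b \<Longrightarrow> a \<in> pverts H \<and> b \<in> pverts H" "E a b \<Longrightarrow> E b a" "\<not> E a a" for a b
    using H.arc_fst_in_verts[of "(a, b)"] H.arc_snd_in_verts[of "(a, b)"] H.arcs_symmetric[of a b]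
      H.pair_no_loops[of "(a, a)"] by (auto simp: E_def)
  have F: "F a b \<Longrightarrow> a \<in> pverts ?D \<and> b \<in> pverts ?D" "F a b \<Longrightarrow> F b a" "\<not> F a a" for a b
    using D.arc_fst_in_verts[of "(a, b)"] D.arc_snd_in_verts[of "(a, b)"] D.arcs_symmetric[of a b]
      D.pair_no_loops[of "(a, a)"] by (auto simp: F_def)
  have finH: "finite (pverts H)" and finD: "finite (pverts ?D)"
    by (rule H.pair_finite_verts, rule D.pair_finite_verts)
  have VD: "pverts ?D = {..<?n}"
    using assms(1) p by (subst pverts_dumbbell) auto

  define xs1 xs2 xs3 where "xs1 = [0..<p - 1]" and "xs2 = [p + k + 1..<?n]" and "xs3 = [p..<p + k]"
  define ws where "ws = xs1 @ xs2 @ xs3 @ [p - 1, p + k]"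
  have len: "Suc (length xs1) = p" "Suc (length xs2) = q" "length xs3 = k"
    using assms(1) p by (simp_all add: xs1_def xs2_def xs3_def)
  have dist: "distinct ws"
    using assms(1) p by (auto simp: ws_def xs1_def xs2_def xs3_def)
  have set: "set ws = pverts ?D"
    unfolding VD using assms(1) p by (auto simp: ws_def xs1_def xs2_def xs3_def)
  have length: "length ws = ?n"
    using distinct_card[OF dist] by (simp add: set VD)
  have WD: "of_bool (F a b) = path_weight ((p - 1) # xs1 @ [p - 1]) a b +
      path_weight ((p + k) # xs2 @ [p + k]) a b + path_weight ((p - 1) # xs3 @ [p + k]) a b"
    if "a \<in> pverts ?D" "b \<in> pverts ?D" for a b
    using dumbbell_path_weights[OF p assms(1), of a k b] that unfolding VD F_def xs1_def xs2_def xs3_def by simp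
  have degD: "card {b. F a b} = (if a \<in> {p - 1, p + k} then 3 else 2)" if "a \<in> pverts ?D" for a
    by (rule dumbbell_degree[OF dist[unfolded ws_def] set[unfolded ws_def, symmetric]]) (use F WD that in auto)
  have lap_D: "lap_entry F a b = (if a = b then if a \<in> {p - 1, p + k} then 3 else 2 else 0) - of_bool (F a b)"
    if "a \<in> pverts ?D" for a b
    unfolding lap_entry_def degD[OF that] by simp
  define c where "c = char_poly (list_mat (lap_entry F) ws)"
  have poly_c: "dumbbell_poly p q k x = (x - 1) * (x + 1) ^ 3 * x ^ ?n * ((- 1) ^ ?n * poly c (2 - x - inverse x))"
    if "1 < x" for x
  proof -
    have "lap_entry F a b = (if a = b then if a \<in> {p - 1, p + k} then 3 else 2 else 0) -
        (path_weight ((p - 1) # xs1 @ [p - 1]) a b + path_weight ((p + k) # xs2 @ [p + k]) a b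
          + path_weight ((p - 1) # xs3 @ [p + k]) a b)"
      if "a \<in> set ws" "b \<in> set ws" for a b
      using that unfolding set by (simp only: lap_D WD)
    from dumbbell_char_poly[OF that dist[unfolded ws_def] this[unfolded ws_def] length[unfolded ws_def, symmetric]]
    show ?thesis
      unfolding len c_def ws_def .
  qed

  \<comment> \<open>Stated for every enumeration, since the argument for connectedness and the
    decompositions into paths each bring their own.\<close>
  have char_poly_H: "char_poly (list_mat (lap_entry E) vs) = c" if "distinct vs" "set vs = pverts H" for vs
  proof -
    have "mat_spectrum (laplacian H vs) = mat_spectrum (laplacian ?D ws)"
      using assms(4) L_spectrum_eq[OF that] L_spectrum_eq[OF dist set] by (simp add: L_cospectral_def)
    then have "char_poly (laplacian H vs) = char_poly (laplacian ?D ws)"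
      by (simp only: mat_spectrum_eq_iff[OF laplacian_carrier laplacian_carrier])
    then show ?thesis
      unfolding laplacian_eq_list_mat[OF that(1)] laplacian_eq_list_mat[OF dist] E_def F_def c_def .
  qed
  obtain vs where vs: "set vs = pverts H" "distinct vs"
    using finite_distinct_list[OF finH] by blast
  have c: "char_poly (list_mat (lap_entry E) vs) = char_poly (list_mat (lap_entry F) ws)"
    using char_poly_H[OF vs(2,1)] by (simp add: c_def)
  \<comment> \<open>The degree of the characteristic polynomial is the number of vertices.\<close>
  have length_vs: "length vs = ?n"
    using degree_monic_char_poly[OF list_mat_carrier[of "lap_entry E" vs]]
      degree_monic_char_poly[OF list_mat_carrier[of "lap_entry F" ws]] c length by simp
  have card_H: "card (pverts H) = card (pverts ?D)"
    using distinct_card[OF vs(2)] distinct_card[OF dist] vs(1) set length length_vs by simp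
  note traces = trace_eq_of_char_poly_eq[OF list_mat_carrier[of "lap_entry E" vs, unfolded length_vs]
      list_mat_carrier[of "lap_entry F" ws, unfolded length] c]
  have sum1: "(\<Sum>a\<in>pverts H. real (card {b. E a b})) = (\<Sum>a\<in>pverts ?D. real (card {b. F a b}))"
    using traces(1) lap_entry_trace[of E, OF E(3)] lap_entry_trace[of F, OF F(3)]
    by (simp add: trace_list_mat vs dist set)
  have "(\<Sum>a\<in>pverts H. real (card {b. E a b}) ^ 2 + real (card {b. E a b})) =
      (\<Sum>a\<in>pverts ?D. real (card {b. F a b}) ^ 2 + real (card {b. F a b}))"
    using traces(2) lap_entry_trace_square[of "pverts H" E, OF finH E(3,2)] lap_entry_trace_square[of "pverts ?D" F, OF finD F(3,2)]
      E(1) F(1) by (simp add: trace_list_mat_square vs dist set)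
  then have sum2: "(\<Sum>a\<in>pverts H. real (card {b. E a b}) ^ 2) = (\<Sum>a\<in>pverts ?D. real (card {b. F a b}) ^ 2)"
    using sum1 by (simp add: sum.distrib)
  have ends: "p - 1 \<in> pverts ?D" "p + k \<in> pverts ?D" "p - 1 \<noteq> p + k"
    using assms(1) p by (auto simp: VD)
  obtain u v where uv: "u \<in> pverts H" "v \<in> pverts H" "u \<noteq> v"
    and degH: "\<And>a. a \<in> pverts H \<Longrightarrow> card {b. E a b} = (if a \<in> {u, v} then 3 else 2)"
    using degrees_of_power_sums[OF finH finD card_H degD ends sum1 sum2] by blast

  interpret two_branch_graph "pverts H" E u v
  proof
    \<comment> \<open>A proper closed set would make 0 a double root of the common characteristic
      polynomial, which is excluded for a dumbbell.\<close>
    show "S = pverts H" if S: "S \<subseteq> pverts H" "S \<noteq> {}" "\<And>a b. a \<in> S \<Longrightarrow> E a b \<Longrightarrow> b \<in> S" for S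
    proof (rule ccontr)
      assume ne: "S \<noteq> pverts H"
      obtain vs' r where "distinct vs'" "set vs' = pverts H"
        "char_poly (list_mat (lap_entry E) vs') = [:0, 1:] ^ 2 * r"
        by (rule closed_subset_double_root[of "pverts H" E S]) (use finH E S ne in blast)+
      then have "c = [:0, 1:] ^ 2 * r"
        using char_poly_H by simp
      moreover have "1 \<le> p" "1 \<le> q"
        using assms(1) p by simp_all
      ultimately show False
        using dumbbell_simple_root[of p q k ?n c r, OF poly_c] by blast
    qed
  qed (use finH E uv degH in auto)

  have lap_H: "lap_entry E a b = (if a = b then if a \<in> {u, v} then 3 else 2 else 0) - of_bool (E a b)"
    if "a \<in> pverts H" for a b
    unfolding lap_entry_def degH[OF that] by simp
  show ?thesis
  proof (cases "\<exists>ys. branch_path u ys u")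
    case True
    then obtain ys1 ys2 ys3 where ys: "distinct (ys1 @ ys2 @ ys3 @ [u, v])" "set (ys1 @ ys2 @ ys3 @ [u, v]) = pverts H"
      and W: "\<And>a b. a \<in> pverts H \<Longrightarrow> b \<in> pverts H \<Longrightarrow> of_bool (E a b) = path_weight (u # ys1 @ [u]) a b +
        path_weight (v # ys2 @ [v]) a b + path_weight (u # ys3 @ [v]) a b"
      using dumbbell_case by metis
    let ?p = "Suc (length ys1)" and ?q = "Suc (length ys2)" and ?k = "length ys3"
    have n: "length (ys1 @ ys2 @ ys3 @ [u, v]) = ?n"
      using distinct_card[OF ys(1)] ys(2) distinct_card[OF vs(2)] vs(1) length_vs by simp
    have "dumbbell_poly p q k x = dumbbell_poly ?p ?q ?k x" if x: "1 < x" for x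
    proof -
      have "lap_entry E a b = (if a = b then if a \<in> {u, v} then 3 else 2 else 0) -
        (path_weight (u # ys1 @ [u]) a b + path_weight (v # ys2 @ [v]) a b + path_weight (u # ys3 @ [v]) a b)"
        if "a \<in> set (ys1 @ ys2 @ ys3 @ [u, v])" "b \<in> set (ys1 @ ys2 @ ys3 @ [u, v])" for a b
        using that unfolding ys(2) by (simp only: lap_H W)
      from dumbbell_char_poly[OF x ys(1) this n[symmetric]]
      show ?thesis
        unfolding poly_c[OF x] char_poly_H[OF ys] by simp
    qed
    then consider "?p = p" "?q = q" "?k = k" | "?p = q" "?q = p" "?k = k"
      using dumbbell_poly_eqD[of p q k ?p ?q ?k] n assms(1,2) by fastforce
    then show ?thesis
    proof cases
      case 1
      show ?thesis
        by (rule dumbbell_isoI[OF assms(3) ys]) (use 1 W assms(1) p in \<open>simp_all add: E_def\<close>)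
    next
      case 2
      \<comment> \<open>The cycle of length \<open>p\<close> is the one at \<open>v\<close>, so
        \<open>u\<close> and \<open>v\<close> exchange roles and the connecting path is
        reversed.\<close>
      have d: "distinct (ys2 @ ys1 @ rev ys3 @ [v, u])" "set (ys2 @ ys1 @ rev ys3 @ [v, u]) = pverts H"
        using ys by auto
      have "path_weight (v # rev ys3 @ [u]) a b = path_weight (u # ys3 @ [v]) a b" for a b
        using path_weight_rev[of "u # ys3 @ [v]"] by simp
      then have "of_bool ((a, b) \<in> parcs H) = path_weight (v # ys2 @ [v]) a b +
        path_weight (u # ys1 @ [u]) a b + path_weight (v # rev ys3 @ [u]) a b"
        if "a \<in> pverts H" "b \<in> pverts H" for a b
        using W[OF that] by (simp only: E_def)
      from dumbbell_isoI[OF assms(3) d this] show ?thesis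
        using 2 assms(1) p by simp
    qed
  next
    case False
    obtain ys1 ys2 ys3 where ys: "distinct (ys1 @ ys2 @ ys3 @ [u, v])" "set (ys1 @ ys2 @ ys3 @ [u, v]) = pverts H"
      and W: "\<And>a b. a \<in> pverts H \<Longrightarrow> b \<in> pverts H \<Longrightarrow> of_bool (E a b) = path_weight (u # ys1 @ [v]) a b +
        path_weight (u # ys2 @ [v]) a b + path_weight (u # ys3 @ [v]) a b"
      using theta_case[OF False] by metis
    let ?a = "Suc (length ys1)" and ?b = "Suc (length ys2)" and ?c = "Suc (length ys3)"
    have n: "length (ys1 @ ys2 @ ys3 @ [u, v]) = ?n"
      using distinct_card[OF ys(1)] ys(2) distinct_card[OF vs(2)] vs(1) length_vs by simp
    have "dumbbell_poly p q k x = theta_poly ?a ?b ?c x" if x: "1 < x" for x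
    proof -
      have "lap_entry E a b = (if a = b then if a \<in> {u, v} then 3 else 2 else 0) -
        (path_weight (u # ys1 @ [v]) a b + path_weight (u # ys2 @ [v]) a b + path_weight (u # ys3 @ [v]) a b)"
        if "a \<in> set (ys1 @ ys2 @ ys3 @ [u, v])" "b \<in> set (ys1 @ ys2 @ ys3 @ [u, v])" for a b
        using that unfolding ys(2) by (simp only: lap_H W)
      from theta_char_poly[OF x ys(1) this n[symmetric]]
      show ?thesis
        unfolding poly_c[OF x] char_poly_H[OF ys] by simp
    qed
    then have False
      by (rule dumbbell_poly_neq_theta_poly) (use n assms(1,2) in simp_all)
    then show ?thesis ..
  qed
qed

end
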